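(* Let $\mu$ be a probability measure on $\mathbb{R}$ with positive density $\varphi=e^{-V}$, $V\in C^2(\mathbb{R})$, and finite absolute fifth moment. Let $\Phi(s)=\int_{-\infty}^s d\mu$, and let $a,b>0$ be fixed. Let $$H(x,y)=\Phi\left(a\Phi^{-1}(x)+b\Phi^{-1}(y)\right)\quad\text{on } [0,1]^2\setminus\{(0,1),(1,0)\},$$ and set $H(0,1)=H(1,0)=0$. For $n\ge1$ let $\mu_n=\mu\times\cdots\times\mu$ ($n$ factors), and consider the inequality $$\int_{\mathbb{R}^n}\operatorname*{ess\,sup}_{y\in\mathbb{R}^n}H\left(f\left(\tfrac{x-y}{a}\right),g\left(\tfrac{y}{b}\right)\right)d\mu_n(x)\ \ge\ H\left(\int_{\mathbb{R}^n} f\,d\mu_n,\int_{\mathbb{R}^n} g\,d\mu_n\right).\qquad( * )$$ Consider also the condition (C) $V'(ax+by)\le aV'(x)+bV'(y)$ for all $x,y\in\mathbb{R}$; $|1-a^2-b^2|\le 2ab$; and $\int_{\mathbb{R}}x\,d\mu=0$ if $a+b>1$. (i) If $( * )$ holds for $n=1$ and all Borel measurable $f,g:\mathbb{R}\to[0,1]$, then (C) holds. (ii) If $\mu=\gamma_1$ is the standard Gaussian measure (so $\mu_n=\gamma_n$), then (C) is necessary and sufficient for $( * )$ to hold for any $n\ge1$ and all Borel measurable $f,g:\mathbb{R}^n\to[0,1]$.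
   Context: $\gamma_n$ is the standard Gaussian measure on $\mathbb{R}^n$, $d\gamma_n(x)=(2\pi)^{-n/2}e^{-|x|^2/2}dx$. The essential supremum is with respect to Lebesgue measure. Conventions: $\Phi^{-1}(0)=-\infty$, $\Phi^{-1}(1)=+\infty$, $\Phi(-\infty)=0$, $\Phi(+\infty)=1$. *)

theory Defs
  imports "HOL-Probability.Probability"
begin

definition C2_on_reals :: "(real \<Rightarrow> real) \<Rightarrow> bool" where
  "C2_on_reals V \<longleftrightarrow>
     V differentiable_on UNIV \<and> deriv V differentiable_on UNIV \<and>
     continuous_on UNIV (deriv (deriv V))"

definition exp_measure :: "(real \<Rightarrow> real) \<Rightarrow> real measure" where
  "exp_measure V = density lborel (\<lambda>x. ennreal (exp (- V x)))"

definition std_gaussian :: "real measure" where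
  "std_gaussian = density lborel (\<lambda>x. ennreal (std_normal_density x))"

text \<open>
  \<open>cdf_ext M\<close> is the distribution function of \<open>M\<close> on the extended line.
  \<open>cdf_inv M\<close> is its inverse on \<open>[0,1]\<close>; it is only used for \<open>M\<close> with a positive density,
  where \<open>cdf M\<close> is a bijection from the reals onto the open unit interval.
\<close>

definition cdf_ext :: "real measure \<Rightarrow> ereal \<Rightarrow> real" where
  "cdf_ext M s = (case s of ereal r \<Rightarrow> cdf M r | PInfty \<Rightarrow> 1 | MInfty \<Rightarrow> 0)"

definition cdf_inv :: "real measure \<Rightarrow> real \<Rightarrow> ereal" where
  "cdf_inv M t = (if t = 0 then - \<infinity> else if t = 1 then \<infinity> else ereal (inv (cdf M) t))"

text \<open>
  For \<open>a, b > 0\<close> the sum below never adds infinities of opposite sign, because the two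
  corners where this could happen are treated separately.
\<close>

definition H_fun :: "real measure \<Rightarrow> real \<Rightarrow> real \<Rightarrow> real \<Rightarrow> real \<Rightarrow> real" where
  "H_fun M a b x y =
     (if (x, y) = (0, 1) \<or> (x, y) = (1, 0) then 0
      else cdf_ext M (ereal a * cdf_inv M x + ereal b * cdf_inv M y))"

text \<open>
  Points of \<open>n\<close>-dimensional space are functions in \<open>{..<n} \<rightarrow>\<^sub>E UNIV\<close>, which is the
  space of the product measures below.
\<close>

definition prod_measure :: "nat \<Rightarrow> real measure \<Rightarrow> (nat \<Rightarrow> real) measure" where
  "prod_measure n M = Pi\<^sub>M {..<n} (\<lambda>_. M)"

definition borel_unit_funs :: "nat \<Rightarrow> ((nat \<Rightarrow> real) \<Rightarrow> real) set" where
  "borel_unit_funs n =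
     {f \<in> borel_measurable (Pi\<^sub>M {..<n} (\<lambda>_. borel)).
        \<forall>x \<in> {..<n} \<rightarrow>\<^sub>E UNIV. 0 \<le> f x \<and> f x \<le> 1}"

text \<open>
  All quantities in the inequality are nonnegative, so it is stated in \<open>ennreal\<close>; the
  essential supremum is taken with respect to \<open>n\<close>-dimensional Lebesgue measure.
\<close>

definition ehrhard_ineq ::
  "real measure \<Rightarrow> real \<Rightarrow> real \<Rightarrow> nat \<Rightarrow> ((nat \<Rightarrow> real) \<Rightarrow> real) \<Rightarrow> ((nat \<Rightarrow> real) \<Rightarrow> real) \<Rightarrow> bool"
where
  "ehrhard_ineq M a b n f g \<longleftrightarrow>
     (\<integral>\<^sup>+ x. esssup (prod_measure n lborel)
               (\<lambda>y. ennreal (H_fun M a b (f (\<lambda>i\<in>{..<n}. (x i - y i) / a)) (g (\<lambda>i\<in>{..<n}. y i / b))))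
        \<partial>prod_measure n M)
     \<ge> ennreal (H_fun M a b (\<integral>x. f x \<partial>prod_measure n M) (\<integral>x. g x \<partial>prod_measure n M))"

definition cond_C :: "(real \<Rightarrow> real) \<Rightarrow> real \<Rightarrow> real \<Rightarrow> bool" where
  "cond_C V a b \<longleftrightarrow>
     (\<forall>x y. deriv V (a * x + b * y) \<le> a * deriv V x + b * deriv V y) \<and>
     \<bar>1 - a\<^sup>2 - b\<^sup>2\<bar> \<le> 2 * a * b \<and>
     (a + b > 1 \<longrightarrow> (\<integral>x. x \<partial>exp_measure V) = 0)"

end

theory Submission
  imports Defs
begin

text \<open>
  Write \<open>\<Psi> = \<Phi>\<inverse>\<close>. In the coordinates \<open>f = \<Phi> \<circ> v\<close>, \<open>g = \<Phi> \<circ> w\<close> the function \<open>H\<close> is the linear form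
  \<open>a v + b w\<close>, and the inequality says: if \<open>a v(x) + b w(y) \<le> u(a x + b y)\<close> for all \<open>x, y\<close>, then
  \<open>a \<Psi>(\<integral> \<Phi>(v)) + b \<Psi>(\<integral> \<Phi>(w)) \<le> \<Psi>(\<integral> \<Phi>(u))\<close>.

  Necessity (\<open>ehrhard_necessary\<close>) tests this with small perturbations of constants for which the
  supremal convolution is explicit. Parallel linear functions give \<open>(a + b) m = m\<close> for the mean \<open>m\<close> to
  first order, and after centering \<open>V'(a p + b q) \<le> a V'(p) + b V'(q)\<close> to second order. Quadratic
  functions give \<open>(a - b)\<^sup>2 \<le> 1 \<le> (a + b)\<^sup>2\<close>, which is \<open>\<bar>1 - a\<^sup>2 - b\<^sup>2\<bar> \<le> 2 a b\<close>.

  In the Gaussian case this last condition provides a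
  correlation \<open>\<rho> \<in> [-1, 1]\<close> with \<open>a\<^sup>2 + b\<^sup>2 + 2 a b \<rho> = 1\<close>. In dimension one let \<open>f, g, h\<close> evolve by the
  heat flow up to time \<open>1\<close>, where they become their Gaussian means, and follow
  \<open>S(x, y) = \<Psi>(h(a x + b y)) - a \<Psi>(f(x)) - b \<Psi>(g(y))\<close>. The flow of \<open>v = \<Psi>(f)\<close> is
  \<open>v\<^sub>t = (v'' - v v'\<^sup>2) / 2\<close>. At a minimum of \<open>S\<close> the three gradients agree, so the nonlinear terms
  combine to \<open>- S u'\<^sup>2\<close>, and by the choice of \<open>\<rho>\<close> the second-order terms
  \<open>u'' - a v'' - b w'' = S\<^sub>x\<^sub>x + 2 \<rho> S\<^sub>x\<^sub>y + S\<^sub>y\<^sub>y\<close> are nonnegative. Hence \<open>S \<ge> 0\<close> persists: this is Borell's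
  maximum principle. It is carried out in discrete time (\<open>heat_step\<close>): a step of variance \<open>\<theta>^4\<close>
  loses at most \<open>O(\<theta>^5)\<close>, because points that are not nearly minimal have room to spare, and nearly
  minimal points satisfy the first and second order conditions up to \<open>O(\<theta>)\<close>. In this form no
  minimizer has to exist, and the flow enters only through second-order expansions with uniform
  remainders, which averaging preserves.

  The passage to Borel functions and the essential supremum goes through Lipschitz functions
  (\<open>ehrhard_lipschitz\<close>, by averaging) and upper semicontinuous ones (\<open>ehrhard_usc\<close>, by Lipschitz
  majorants, which commute with supremal convolution). Borel functions are approximated from below
  by step functions on compact sets of points where the level sets are thick at a fixed small scale.
  Thick points \<open>x\<close> and \<open>y\<close> of two level sets make the combination \<open>a x + b y\<close> visible to the essential
  supremum (\<open>esssup_ge_on_sumset\<close>), so nothing is lost (\<open>ehrhard_real_line\<close>). Finally the inequality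
  is stable under products (\<open>ehrhard_ineq_Suc\<close>), which gives every dimension.
\<close>

section \<open>The distribution function of a measure with positive continuous density\<close>

locale exp_prob =
  fixes V :: "real \<Rightarrow> real"
  assumes prob: "prob_space (exp_measure V)" and C2: "C2_on_reals V"
begin

abbreviation "\<mu> \<equiv> exp_measure V"
abbreviation "\<Phi> \<equiv> cdf \<mu>"
abbreviation "\<Psi> \<equiv> inv \<Phi>"

sublocale prob_space \<mu> by (rule prob)

lemma V_deriv: "(V has_real_derivative deriv V x) (at x)"
  using C2 DERIV_deriv_iff_real_differentiable
  unfolding C2_on_reals_def differentiable_on_def by auto

lemma V_deriv2: "(deriv V has_real_derivative deriv (deriv V) x) (at x)"
  using C2 DERIV_deriv_iff_real_differentiable
  unfolding C2_on_reals_def differentiable_on_def by auto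

lemma V_cont: "continuous_on A V"
  by (meson DERIV_continuous V_deriv continuous_at_imp_continuous_on)

lemma V_meas[measurable]: "V \<in> borel_measurable borel"
  using V_cont borel_measurable_continuous_onI by blast

lemma sets_mu[simp, measurable_cong]: "sets \<mu> = sets borel"
  by (simp add: exp_measure_def)

lemma space_mu[simp]: "space \<mu> = UNIV"
  by (simp add: exp_measure_def)

sublocale real_distribution \<mu>
  by standard (auto simp: sets_mu)

lemma integral_mu: "f \<in> borel_measurable borel \<Longrightarrow> (\<integral>x. f x \<partial>\<mu>) = (\<integral>x. exp (- V x) * f x \<partial>lborel)"
  unfolding exp_measure_def by (subst integral_density) auto

lemma integrable_exp_V: "integrable lborel (\<lambda>x. exp (- V x))"
proof -
  have "integrable \<mu> (\<lambda>x. 1::real)" by simp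
  then show ?thesis unfolding exp_measure_def by (subst (asm) integrable_density) auto
qed

lemma cdf_diff: assumes "x \<le> y" shows "\<Phi> y - \<Phi> x = integral {x..y} (\<lambda>t. exp (- V t))"
proof -
  have c: "continuous_on {x..y} (\<lambda>t. exp (- V t))"
    by (intro continuous_intros V_cont)
  have *: "emeasure \<mu> {x..y} = ennreal (integral {x..y} (\<lambda>t. exp (- V t)))"
  proof -
    have "emeasure \<mu> {x..y} = (\<integral>\<^sup>+t. ennreal (indicator {x..y} t * exp (- V t)) \<partial>lborel)"
      unfolding exp_measure_def by (subst emeasure_density) (auto intro!: nn_integral_cong split: split_indicator)
    also have "\<dots> = ennreal (integral\<^sup>L lborel (\<lambda>t. indicator {x..y} t * exp (- V t)))"
      using integrable_real_mult_indicator[OF _ integrable_exp_V, of "{x..y}"]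
      by (intro nn_integral_eq_integral) (auto simp: mult.commute)
    also have "integral\<^sup>L lborel (\<lambda>t. indicator {x..y} t * exp (- V t)) = (LINT t:{x..y}|lborel. exp (- V t))"
      by (simp add: set_lebesgue_integral_def)
    also have "\<dots> = integral {x..y} (\<lambda>t. exp (- V t))"
      by (intro set_borel_integral_eq_integral borel_integrable_atLeastAtMost' c)
    finally show ?thesis .
  qed
  have nn: "integral {x..y} (\<lambda>t. exp (- V t)) \<ge> 0"
    by (intro integral_nonneg integrable_continuous_real c) auto
  have sing: "measure \<mu> {x} = 0"
  proof -
    have "emeasure \<mu> {x} = (\<integral>\<^sup>+t. ennreal (exp (- V t)) * indicator {x} t \<partial>lborel)"
      unfolding exp_measure_def by (subst emeasure_density) auto
    also have "\<dots> = 0"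
      by (subst nn_integral_0_iff_AE) (auto intro!: AE_I[of _ _ "{x}"] split: split_indicator_asm)
    finally show ?thesis by (simp add: measure_def)
  qed
  have "measure \<mu> {x..y} = measure \<mu> {x<..y} + measure \<mu> {x}"
    using assms by (subst finite_measure_Union[symmetric]) (auto intro!: arg_cong[of _ _ "measure \<mu>"])
  moreover have "\<Phi> y - \<Phi> x = measure \<mu> {x<..y}"
    by (cases "x = y") (use assms cdf_diff_eq[of x y] in auto)
  moreover have "measure \<mu> {x..y} = integral {x..y} (\<lambda>t. exp (- V t))"
    using * nn by (simp add: measure_def)
  ultimately show ?thesis using sing by simp
qed

lemma cdf_deriv: "(\<Phi> has_real_derivative exp (- V x)) (at x)"
proof -
  let ?I = "\<lambda>y. integral {x - 1..y} (\<lambda>t. exp (- V t))"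
  have "(?I has_real_derivative exp (- V x)) (at x within {x - 1..x + 1})"
  proof (rule integral_has_real_derivative)
    show "continuous_on {x - 1..x + 1} (\<lambda>t. exp (- V t))"
      by (intro continuous_intros V_cont)
  qed simp
  then have I: "(?I has_real_derivative exp (- V x)) (at x)"
    by (subst (asm) at_within_interior) simp_all
  have "((\<lambda>y. \<Phi> (x - 1) + ?I y) has_real_derivative exp (- V x)) (at x)"
    using DERIV_add[OF DERIV_const I] by simp
  then show ?thesis
  proof (rule has_field_derivative_transform_within_open[where S = "{x - 1<..}"])
    fix y assume "y \<in> {x - 1<..}"
    then show "\<Phi> (x - 1) + ?I y = \<Phi> y" using cdf_diff[of "x - 1" y] by simp
  qed auto
qed

lemma cdf_cont: "continuous_on A \<Phi>"
  by (meson DERIV_continuous cdf_deriv continuous_at_imp_continuous_on)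

lemma cdf_meas[measurable]: "\<Phi> \<in> borel_measurable borel"
  using cdf_cont borel_measurable_continuous_onI by blast

lemma cdf_strict_mono: "strict_mono \<Phi>"
proof (rule strict_monoI)
  fix x y :: real assume "x < y"
  then show "\<Phi> x < \<Phi> y"
  proof (rule DERIV_pos_imp_increasing[where f = \<Phi>])
    fix t
    show "\<exists>d. (\<Phi> has_real_derivative d) (at t) \<and> 0 < d"
      using cdf_deriv[of t] by (intro exI[of _ "exp (- V t)"]) simp
  qed
qed

lemma cdf_less_iff[simp]: "\<Phi> x < \<Phi> y \<longleftrightarrow> x < y"
  using cdf_strict_mono by (rule strict_mono_less)

lemma cdf_le_iff[simp]: "\<Phi> x \<le> \<Phi> y \<longleftrightarrow> x \<le> y"
  using cdf_strict_mono by (rule strict_mono_less_eq)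

lemma cdf_pos: "0 < \<Phi> x"
  using cdf_nonneg[of "x - 1"] cdf_less_iff[of "x - 1" x] by linarith

lemma cdf_less_1: "\<Phi> x < 1"
  using cdf_bounded_prob[of "x + 1"] cdf_less_iff[of x "x + 1"] by linarith

lemma Psi_cdf[simp]: "\<Psi> (\<Phi> x) = x"
  by (rule inv_f_f) (rule strict_mono_imp_inj_on[OF cdf_strict_mono])

lemma cdf_surj: assumes "0 < p" "p < 1" shows "\<exists>x. \<Phi> x = p"
proof -
  have "eventually (\<lambda>x. \<Phi> x < p) at_bot"
    using cdf_lim_at_bot assms(1) by (rule order_tendstoD)
  then obtain l where l: "\<Phi> l < p" using eventually_happens'[OF trivial_limit_at_bot_linorder] by blast
  have "eventually (\<lambda>x. p < \<Phi> x) at_top"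
    using cdf_lim_at_top_prob assms(2) by (rule order_tendstoD)
  then obtain u where u: "p < \<Phi> u" using eventually_happens'[OF trivial_limit_at_top_linorder] by blast
  have "\<Phi> l < \<Phi> u" using l u by linarith
  then have "l \<le> u" using cdf_less_iff[of l u] by linarith
  then show ?thesis using IVT'[of \<Phi> l p u] l u cdf_cont[of "{l..u}"] by auto
qed

lemma cdf_Psi[simp]: "0 < p \<Longrightarrow> p < 1 \<Longrightarrow> \<Phi> (\<Psi> p) = p"
  using cdf_surj[of p] by auto

lemma Psi_le_iff: "0 < p \<Longrightarrow> p < 1 \<Longrightarrow> \<Psi> p \<le> x \<longleftrightarrow> p \<le> \<Phi> x"
  using cdf_le_iff[of "\<Psi> p" x] by simp

lemma le_Psi_iff: "0 < p \<Longrightarrow> p < 1 \<Longrightarrow> x \<le> \<Psi> p \<longleftrightarrow> \<Phi> x \<le> p"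
  using cdf_le_iff[of x "\<Psi> p"] by simp

lemma Psi_mono: "0 < p \<Longrightarrow> p \<le> q \<Longrightarrow> q < 1 \<Longrightarrow> \<Psi> p \<le> \<Psi> q"
  by (subst Psi_le_iff) auto

lemma Psi_deriv: assumes "0 < p" "p < 1"
  shows "(\<Psi> has_real_derivative inverse (exp (- V (\<Psi> p)))) (at p)"
proof (rule DERIV_inverse_function[where f = \<Phi> and a = 0 and b = 1])
  have "isCont \<Psi> (\<Phi> (\<Psi> p))"
    by (rule isCont_inverse_function[where d = 1]) (simp_all add: DERIV_isCont[OF cdf_deriv])
  then show "isCont \<Psi> p" using assms by simp
qed (use assms cdf_deriv in auto)

lemma Psi_cont: "continuous_on {0<..<1} \<Psi>"
proof (rule continuous_at_imp_continuous_on, rule ballI)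
  fix p :: real assume "p \<in> {0<..<1}"
  then show "isCont \<Psi> p" using DERIV_isCont[OF Psi_deriv[of p]] by simp
qed

text \<open>Measurability of \<open>\<Psi>\<close> on all of the reals needs to know its junk values: off \<open>(0,1)\<close> the choice function behind \<^const>\<open>inv\<close> always picks the same point.\<close>

lemma Psi_outside: assumes "\<not> (0 < p \<and> p < 1)" shows "\<Psi> p = (SOME x. False)"
proof -
  have "\<Phi> x \<noteq> p" for x using assms cdf_pos[of x] cdf_less_1[of x] by auto
  then have "(\<lambda>x. \<Phi> x = p) = (\<lambda>x. False)" by simp
  then show ?thesis by (simp add: inv_def)
qed

lemma Psi_meas[measurable]: "\<Psi> \<in> borel_measurable borel"
proof -
  have "(\<lambda>p. if p \<in> {0<..<1} then \<Psi> p else (SOME x. False)) \<in> borel_measurable borel"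
    by (rule borel_measurable_continuous_on_if) (simp_all add: Psi_cont)
  also have "(\<lambda>p. if p \<in> {0<..<1} then \<Psi> p else (SOME x. False)) = \<Psi>"
    using Psi_outside by (auto simp: fun_eq_iff)
  finally show ?thesis .
qed

lemma H_eq: assumes "a > 0" "b > 0"
  shows "H_fun \<mu> a b x y = (if x = 0 \<or> y = 0 then 0 else if x = 1 \<or> y = 1 then 1
           else \<Phi> (a * \<Psi> x + b * \<Psi> y))"
  using assms by (auto simp: H_fun_def cdf_inv_def cdf_ext_def split: if_splits)

lemma H_inner: "a > 0 \<Longrightarrow> b > 0 \<Longrightarrow> 0 < x \<Longrightarrow> x < 1 \<Longrightarrow> 0 < y \<Longrightarrow> y < 1 \<Longrightarrow>
    H_fun \<mu> a b x y = \<Phi> (a * \<Psi> x + b * \<Psi> y)"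
  by (simp add: H_eq)

lemma H_cdf: "a > 0 \<Longrightarrow> b > 0 \<Longrightarrow> H_fun \<mu> a b (\<Phi> x) (\<Phi> y) = \<Phi> (a * x + b * y)"
  by (simp add: H_inner cdf_pos cdf_less_1)

lemma H_range: "a > 0 \<Longrightarrow> b > 0 \<Longrightarrow> 0 \<le> H_fun \<mu> a b x y \<and> H_fun \<mu> a b x y \<le> 1"
  by (auto simp: H_eq cdf_nonneg cdf_bounded_prob)

lemma H_measurable: assumes "a > 0" "b > 0" and [measurable]: "f \<in> borel_measurable N" "g \<in> borel_measurable N"
  shows "(\<lambda>x. H_fun \<mu> a b (f x) (g x)) \<in> borel_measurable N"
  unfolding H_eq[OF assms(1,2)] by measurable

lemma H_ge_cdf: assumes "a > 0" "b > 0" "\<Phi> x \<le> p" "p \<le> 1" "\<Phi> y \<le> q" "q \<le> 1"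
  shows "\<Phi> (a * x + b * y) \<le> H_fun \<mu> a b p q"
proof -
  have "0 < p" "0 < q" using assms cdf_pos[of x] cdf_pos[of y] by linarith+
  then show ?thesis
  proof (cases "p = 1 \<or> q = 1")
    case True
    then show ?thesis using assms(1,2) \<open>0 < p\<close> \<open>0 < q\<close> by (simp add: H_eq cdf_bounded_prob)
  next
    case False
    then have "x \<le> \<Psi> p" "y \<le> \<Psi> q"
      using assms \<open>0 < p\<close> \<open>0 < q\<close> by (simp_all add: le_Psi_iff)
    then have "a * x + b * y \<le> a * \<Psi> p + b * \<Psi> q"
      using assms by (intro add_mono mult_left_mono) simp_all
    then show ?thesis using False assms(1,2) \<open>0 < p\<close> \<open>0 < q\<close> by (simp add: H_eq)
  qed
qed

lemma bounded_integrable: "f \<in> borel_measurable borel \<Longrightarrow> (\<And>x. \<bar>f x\<bar> \<le> (K::real)) \<Longrightarrow> integrable \<mu> f"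
  by (rule integrable_const_bound[where B = K]) auto

lemma integral_cdf_pos: assumes [measurable]: "v \<in> borel_measurable borel"
  shows "0 < (\<integral>x. \<Phi> (v x) \<partial>\<mu>)" "(\<integral>x. \<Phi> (v x) \<partial>\<mu>) < 1"
proof -
  have i: "integrable \<mu> (\<lambda>x. \<Phi> (v x))"
    by (rule bounded_integrable[where K = 1]) (simp_all add: cdf_bounded_prob cdf_nonneg)
  have "(\<integral>x. 0 \<partial>\<mu>) < (\<integral>x. \<Phi> (v x) \<partial>\<mu>)"
    by (rule integral_less_AE_space) (use i cdf_pos in \<open>auto simp: emeasure_space_1[simplified]\<close>)
  then show "0 < (\<integral>x. \<Phi> (v x) \<partial>\<mu>)" by simp
  have "(\<integral>x. \<Phi> (v x) \<partial>\<mu>) < (\<integral>x. 1 \<partial>\<mu>)"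
    by (rule integral_less_AE_space) (use i cdf_less_1 in \<open>auto simp: emeasure_space_1[simplified]\<close>)
  then show "(\<integral>x. \<Phi> (v x) \<partial>\<mu>) < 1" using prob_space by simp
qed

end

section \<open>Necessity of the condition\<close>

context exp_prob
begin

lemma borel_unit_fun_cdf: assumes [measurable]: "v \<in> borel_measurable borel"
  shows "(\<lambda>x. \<Phi> (v (x 0))) \<in> borel_unit_funs 1"
  unfolding borel_unit_funs_def by (auto simp: cdf_nonneg cdf_bounded_prob)

lemma prod_measure_1: "prod_measure 1 M = Pi\<^sub>M {0} (\<lambda>_. M)"
  by (auto simp: prod_measure_def intro!: PiM_cong)

text \<open>In the coordinates \<open>f = \<Phi> \<circ> v\<close>, \<open>g = \<Phi> \<circ> w\<close> the function \<open>H\<close> is linear, so that an explicit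
  majorant \<open>u\<close> of the supremal convolution of \<open>v\<close> and \<open>w\<close> turns the inequality into one between
  three ordinary integrals.\<close>

lemma ehrhard_test:
  assumes ineq: "\<forall>f\<in>borel_unit_funs 1. \<forall>g\<in>borel_unit_funs 1. ehrhard_ineq \<mu> a b 1 f g"
    and ab: "a > 0" "b > 0"
    and [measurable]: "v \<in> borel_measurable borel" "w \<in> borel_measurable borel" "u \<in> borel_measurable borel"
    and le: "\<And>x y. a * v x + b * w y \<le> u (a * x + b * y)"
  shows "a * \<Psi> (\<integral>x. \<Phi> (v x) \<partial>\<mu>) + b * \<Psi> (\<integral>x. \<Phi> (w x) \<partial>\<mu>) \<le> \<Psi> (\<integral>x. \<Phi> (u x) \<partial>\<mu>)"
proof -
  interpret P: product_sigma_finite "\<lambda>_::nat. \<mu>" by standard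
  have sing: "(\<integral>x. \<Phi> (h (x 0)) \<partial>prod_measure 1 \<mu>) = (\<integral>x. \<Phi> (h x) \<partial>\<mu>)"
    if [measurable]: "h \<in> borel_measurable borel" for h
    unfolding prod_measure_1
    by (rule P.product_integral_singleton[of "\<lambda>x. \<Phi> (h x)" 0]) measurable
  have "ennreal (H_fun \<mu> a b (\<integral>x. \<Phi> (v x) \<partial>\<mu>) (\<integral>x. \<Phi> (w x) \<partial>\<mu>))
      \<le> (\<integral>\<^sup>+ x. esssup (prod_measure 1 lborel) (\<lambda>y. ennreal (H_fun \<mu> a b (\<Phi> (v ((x 0 - y 0) / a))) (\<Phi> (w (y 0 / b)))))
          \<partial>prod_measure 1 \<mu>)"
    using ineq[rule_format, OF borel_unit_fun_cdf[of v] borel_unit_fun_cdf[of w]]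
    by (simp add: ehrhard_ineq_def sing[simplified])
  also have "\<dots> \<le> (\<integral>\<^sup>+ x. ennreal (\<Phi> (u (x 0))) \<partial>prod_measure 1 \<mu>)"
  proof (rule nn_integral_mono, rule esssup_I)
    fix x :: "nat \<Rightarrow> real"
    have [measurable]: "(\<lambda>y. y 0) \<in> borel_measurable (prod_measure 1 lborel)"
      unfolding prod_measure_def by measurable
    show "(\<lambda>y. ennreal (H_fun \<mu> a b (\<Phi> (v ((x 0 - y 0) / a))) (\<Phi> (w (y 0 / b))))) \<in> borel_measurable (prod_measure 1 lborel)"
      unfolding H_cdf[OF ab] by measurable
    show "AE y in prod_measure 1 lborel. ennreal (H_fun \<mu> a b (\<Phi> (v ((x 0 - y 0) / a))) (\<Phi> (w (y 0 / b)))) \<le> ennreal (\<Phi> (u (x 0)))"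
    proof (rule AE_I2)
      fix y :: "nat \<Rightarrow> real"
      have "a * v ((x 0 - y 0) / a) + b * w (y 0 / b) \<le> u (x 0)"
        using le[of "(x 0 - y 0) / a" "y 0 / b"] ab by simp
      then show "ennreal (H_fun \<mu> a b (\<Phi> (v ((x 0 - y 0) / a))) (\<Phi> (w (y 0 / b)))) \<le> ennreal (\<Phi> (u (x 0)))"
        by (intro ennreal_leI) (simp add: H_cdf[OF ab])
    qed
  qed
  also have "\<dots> = (\<integral>\<^sup>+ x. ennreal (\<Phi> (u x)) \<partial>\<mu>)"
    unfolding prod_measure_1
    by (rule P.product_nn_integral_singleton[of "\<lambda>x. ennreal (\<Phi> (u x))" 0]) measurable
  also have "\<dots> = ennreal (\<integral>x. \<Phi> (u x) \<partial>\<mu>)"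
    by (rule nn_integral_eq_integral)
      (auto intro!: bounded_integrable[where K = 1] simp: cdf_nonneg cdf_bounded_prob)
  finally have "H_fun \<mu> a b (\<integral>x. \<Phi> (v x) \<partial>\<mu>) (\<integral>x. \<Phi> (w x) \<partial>\<mu>) \<le> (\<integral>x. \<Phi> (u x) \<partial>\<mu>)"
    by (subst (asm) ennreal_le_iff) (use integral_cdf_pos(1)[of u] in auto)
  then show ?thesis
    using integral_cdf_pos[of u] integral_cdf_pos[of v] integral_cdf_pos[of w]
    by (simp add: H_inner[OF ab] le_Psi_iff)
qed

text \<open>A chain rule that asks for the difference quotients along a single sequence only.\<close>

lemma deriv_along_sequence:
  fixes f :: "real \<Rightarrow> real"
  assumes f: "(f has_real_derivative D) (at q)"
    and G: "(\<lambda>n. (G n - q) / d n) \<longlonglongrightarrow> L" and d: "d \<longlonglongrightarrow> 0" "\<And>n. d n \<noteq> (0::real)"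
  shows "(\<lambda>n. (f (G n) - f q) / d n) \<longlonglongrightarrow> D * L"
proof -
  obtain g where g: "\<And>z. f z - f q = g z * (z - q)" "isCont g q" "g q = D"
    using f unfolding CARAT_DERIV by blast
  have "(\<lambda>n. (G n - q) / d n * d n) \<longlonglongrightarrow> L * 0" by (intro tendsto_intros G d)
  then have "(\<lambda>n. G n - q) \<longlonglongrightarrow> 0" using d by simp
  then have "G \<longlonglongrightarrow> q" by (rule Lim_null[THEN iffD2])
  then have "(\<lambda>n. g (G n)) \<longlonglongrightarrow> D" using isCont_tendsto_compose[OF g(2)] g(3) by simp
  then have "(\<lambda>n. g (G n) * ((G n - q) / d n)) \<longlonglongrightarrow> D * L" by (intro tendsto_intros G)
  then show ?thesis by (simp add: g(1))
qed

lemma density_deriv: "((\<lambda>x. exp (- V x)) has_real_derivative (- deriv V x * exp (- V x))) (at x)"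
  by (rule derivative_eq_intros V_deriv refl | simp)+

lemma deriv_V_cont: "continuous_on A (deriv V)"
  by (meson DERIV_continuous V_deriv2 continuous_at_imp_continuous_on)

lemma cdf_lagrange: "\<exists>t. \<bar>t - p\<bar> \<le> \<bar>x - p\<bar> \<and> \<Phi> x = \<Phi> p + exp (- V t) * (x - p)"
proof (cases "x = p")
  case False
  then have "x < p \<or> p < x" by auto
  then show ?thesis
  proof
    assume "x < p"
    from MVT2[OF this, of \<Phi> "\<lambda>x. exp (- V x)"] cdf_deriv
    obtain z where "x < z" "z < p" "\<Phi> p - \<Phi> x = (p - x) * exp (- V z)" by blast
    then show ?thesis by (intro exI[of _ z]) (auto simp: algebra_simps)
  next
    assume "p < x"
    from MVT2[OF this, of \<Phi> "\<lambda>x. exp (- V x)"] cdf_deriv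
    obtain z where "p < z" "z < x" "\<Phi> x - \<Phi> p = (x - p) * exp (- V z)" by blast
    then show ?thesis by (intro exI[of _ z]) (auto simp: algebra_simps)
  qed
qed auto

lemma cdf_taylor2:
  "\<exists>t. \<bar>t - p\<bar> \<le> \<bar>x - p\<bar> \<and>
       \<Phi> x = \<Phi> p + exp (- V p) * (x - p) - deriv V t * exp (- V t) / 2 * (x - p)\<^sup>2"
proof (cases "x = p")
  case False
  define diff where "diff = (\<lambda>m::nat. if m = 0 then \<Phi> else if m = 1 then (\<lambda>x. exp (- V x))
                         else (\<lambda>x. - deriv V x * exp (- V x)))"
  have "\<exists>t. (if x < p then x < t \<and> t < p else p < t \<and> t < x) \<and>
      \<Phi> x = (\<Sum>m<2. (diff m p / fact m) * (x - p)^m) + (diff 2 t / fact 2) * (x - p)^2"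
  proof (rule Taylor)
    show "\<forall>m t. m < 2 \<and> min x p \<le> t \<and> t \<le> max x p \<longrightarrow> (diff m has_real_derivative diff (Suc m) t) (at t)"
    proof (intro allI impI)
      fix m :: nat and t assume "m < 2 \<and> min x p \<le> t \<and> t \<le> max x p"
      then have "m = 0 \<or> m = 1" by auto
      then show "(diff m has_real_derivative diff (Suc m) t) (at t)"
        using cdf_deriv[of t] density_deriv[of t] by (auto simp: diff_def)
    qed
  qed (use False in \<open>auto simp: diff_def\<close>)
  then obtain t where t: "if x < p then x < t \<and> t < p else p < t \<and> t < x"
    "\<Phi> x = (\<Sum>m<2. (diff m p / fact m) * (x - p)^m) + (diff 2 t / fact 2) * (x - p)^2" by blast
  show ?thesis
    by (rule exI[of _ t]) (use t in \<open>auto simp: diff_def numeral_2_eq_2 split: if_splits\<close>)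
qed auto

lemma cdf_lipschitz_at: "\<exists>K. \<forall>t. \<bar>\<Phi> (p + t) - \<Phi> p\<bar> \<le> K * \<bar>t\<bar>"
proof -
  have "compact ((\<lambda>x. exp (- V x)) ` {p - 1..p + 1})"
    by (intro compact_continuous_image continuous_intros V_cont compact_Icc)
  then have "bounded ((\<lambda>x. exp (- V x)) ` {p - 1..p + 1})" by (rule compact_imp_bounded)
  then obtain B where "\<forall>z \<in> (\<lambda>x. exp (- V x)) ` {p - 1..p + 1}. norm z \<le> B" unfolding bounded_iff by blast
  then have B: "\<bar>exp (- V t)\<bar> \<le> B" if "t \<in> {p - 1..p + 1}" for t using that by auto
  have "\<bar>\<Phi> (p + t) - \<Phi> p\<bar> \<le> max 1 B * \<bar>t\<bar>" for t
  proof (cases "\<bar>t\<bar> \<le> 1")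
    case True
    obtain s where s: "\<bar>s - p\<bar> \<le> \<bar>t\<bar>" "\<Phi> (p + t) = \<Phi> p + exp (- V s) * t"
      using cdf_lagrange[of p "p + t"] by auto
    have "\<bar>exp (- V s)\<bar> \<le> B" using s(1) True by (intro B) auto
    then show ?thesis by (simp add: s(2) abs_mult mult_right_mono)
  next
    case False
    have "\<bar>\<Phi> (p + t) - \<Phi> p\<bar> \<le> 1"
      using cdf_nonneg[of "p + t"] cdf_bounded_prob[of "p + t"] cdf_nonneg[of p] cdf_bounded_prob[of p] by linarith
    also have "1 \<le> max 1 B * \<bar>t\<bar>" using False mult_mono[of 1 "max 1 B" 1 "\<bar>t\<bar>"] by simp
    finally show ?thesis .
  qed
  then show ?thesis by blast
qed

lemma cdf_quadratic_at: "\<exists>K. \<forall>t. \<bar>\<Phi> (p + t) - \<Phi> p - exp (- V p) * t\<bar> \<le> K * t\<^sup>2"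
proof -
  have "compact ((\<lambda>x. deriv V x * exp (- V x)) ` {p - 1..p + 1})"
    by (intro compact_continuous_image continuous_intros V_cont deriv_V_cont compact_Icc)
  then have "bounded ((\<lambda>x. deriv V x * exp (- V x)) ` {p - 1..p + 1})" by (rule compact_imp_bounded)
  then obtain B where "\<forall>z \<in> (\<lambda>x. deriv V x * exp (- V x)) ` {p - 1..p + 1}. norm z \<le> B"
    unfolding bounded_iff by blast
  then have B: "\<bar>deriv V t * exp (- V t)\<bar> \<le> B" if "t \<in> {p - 1..p + 1}" for t using that by auto
  define K where "K = max (1 + exp (- V p)) (B / 2)"
  have "\<bar>\<Phi> (p + t) - \<Phi> p - exp (- V p) * t\<bar> \<le> K * t\<^sup>2" for t
  proof (cases "\<bar>t\<bar> \<le> 1")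
    case True
    obtain s where s: "\<bar>s - p\<bar> \<le> \<bar>t\<bar>" "\<Phi> (p + t) = \<Phi> p + exp (- V p) * t - deriv V s * exp (- V s) / 2 * t\<^sup>2"
      using cdf_taylor2[of p "p + t"] by auto
    have "\<bar>deriv V s * exp (- V s)\<bar> \<le> B" using s(1) True by (intro B) auto
    then have "\<bar>deriv V s * exp (- V s) / 2\<bar> \<le> K" unfolding K_def by linarith
    then have "\<bar>deriv V s * exp (- V s) / 2 * t\<^sup>2\<bar> \<le> K * t\<^sup>2"
      by (metis abs_mult abs_power2 mult_right_mono zero_le_power2)
    then show ?thesis using s(2) by simp
  next
    case False
    have "\<bar>\<Phi> (p + t) - \<Phi> p\<bar> \<le> 1"
      using cdf_nonneg[of "p + t"] cdf_bounded_prob[of "p + t"] cdf_nonneg[of p] cdf_bounded_prob[of p] by linarith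
    moreover have "\<bar>exp (- V p) * t\<bar> = exp (- V p) * \<bar>t\<bar>" by (simp add: abs_mult)
    ultimately have "\<bar>\<Phi> (p + t) - \<Phi> p - exp (- V p) * t\<bar> \<le> 1 + exp (- V p) * \<bar>t\<bar>" by linarith
    also have "\<dots> \<le> t\<^sup>2 + exp (- V p) * t\<^sup>2"
    proof (intro add_mono mult_left_mono)
      show t: "1 \<le> t\<^sup>2" using False abs_le_square_iff[of 1 t] by simp
      show "\<bar>t\<bar> \<le> t\<^sup>2" using mult_mono[of 1 "\<bar>t\<bar>" "\<bar>t\<bar>" "\<bar>t\<bar>"] False by (simp add: power2_eq_square)
    qed simp
    also have "\<dots> = (1 + exp (- V p)) * t\<^sup>2" by (simp add: algebra_simps)
    also have "\<dots> \<le> K * t\<^sup>2" unfolding K_def by (intro mult_right_mono) auto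
    finally show ?thesis .
  qed
  then show ?thesis by blast
qed

text \<open>First variation of the \<open>\<Phi>\<close>-mean \<open>\<Psi> (\<integral> \<Phi> (p + d c))\<close> around a constant. The density may be
  unbounded, so the domination uses that \<open>\<Phi>\<close> itself is bounded far from \<open>p\<close>.\<close>

lemma Phi_mean_first_order:
  assumes c: "integrable \<mu> c" and d: "d \<longlonglongrightarrow> 0" "\<And>n. d n \<noteq> (0::real)"
  shows "(\<lambda>n. (\<Psi> (\<integral>x. \<Phi> (p + d n * c x) \<partial>\<mu>) - p) / d n) \<longlonglongrightarrow> (\<integral>x. c x \<partial>\<mu>)"
proof -
  have [measurable]: "c \<in> borel_measurable borel" using c by auto
  obtain K where K: "\<And>t. \<bar>\<Phi> (p + t) - \<Phi> p\<bar> \<le> K * \<bar>t\<bar>" using cdf_lipschitz_at by blast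
  have "(\<lambda>n. \<integral>x. (\<Phi> (p + d n * c x) - \<Phi> p) / d n \<partial>\<mu>) \<longlonglongrightarrow> (\<integral>x. exp (- V p) * c x \<partial>\<mu>)"
  proof (rule integral_dominated_convergence[where w = "\<lambda>x. K * \<bar>c x\<bar>"])
    show "AE x in \<mu>. (\<lambda>n. (\<Phi> (p + d n * c x) - \<Phi> p) / d n) \<longlonglongrightarrow> exp (- V p) * c x"
      by (intro AE_I2 deriv_along_sequence cdf_deriv d) (use d in simp)
    show "AE x in \<mu>. norm ((\<Phi> (p + d n * c x) - \<Phi> p) / d n) \<le> K * \<bar>c x\<bar>" for n
    proof (rule AE_I2)
      fix x
      have "\<bar>\<Phi> (p + d n * c x) - \<Phi> p\<bar> \<le> K * \<bar>c x\<bar> * \<bar>d n\<bar>" using K[of "d n * c x"] by (simp add: abs_mult ac_simps)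
      then show "norm ((\<Phi> (p + d n * c x) - \<Phi> p) / d n) \<le> K * \<bar>c x\<bar>"
        using d(2)[of n] by (simp add: pos_divide_le_eq)
    qed
  qed (use c in auto)
  moreover have eq: "(\<integral>x. (\<Phi> (p + d n * c x) - \<Phi> p) / d n \<partial>\<mu>) = ((\<integral>x. \<Phi> (p + d n * c x) \<partial>\<mu>) - \<Phi> p) / d n" for n
  proof -
    have "integrable \<mu> (\<lambda>x. \<Phi> (p + d n * c x))"
      by (rule bounded_integrable[where K = 1]) (simp_all add: cdf_bounded_prob cdf_nonneg)
    then show ?thesis by (simp add: prob_space[simplified])
  qed
  ultimately have "(\<lambda>n. ((\<integral>x. \<Phi> (p + d n * c x) \<partial>\<mu>) - \<Phi> p) / d n) \<longlonglongrightarrow> exp (- V p) * (\<integral>x. c x \<partial>\<mu>)"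
    unfolding eq by simp
  from deriv_along_sequence[OF Psi_deriv this d] show ?thesis
    by (simp add: cdf_pos cdf_less_1 exp_minus mult.assoc[symmetric])
qed

text \<open>For a centered perturbation the first variation vanishes, so that \<open>(d n)\<^sup>2\<close> is the right scale and the
  derivative of \<open>\<Psi>\<close> alone transports the expansion of the integral.\<close>

lemma Phi_mean_second_order:
  assumes c: "integrable \<mu> (\<lambda>x. (c x)\<^sup>2)" "integrable \<mu> c" "(\<integral>x. c x \<partial>\<mu>) = 0"
    and d: "d \<longlonglongrightarrow> 0" "\<And>n. d n \<noteq> (0::real)"
  shows "(\<lambda>n. (\<Psi> (\<integral>x. \<Phi> (p + d n * c x) \<partial>\<mu>) - p) / (d n)\<^sup>2) \<longlonglongrightarrow> - (deriv V p / 2 * (\<integral>x. (c x)\<^sup>2 \<partial>\<mu>))"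
proof -
  have [measurable]: "c \<in> borel_measurable borel" using c by auto
  obtain K where K: "\<And>t. \<bar>\<Phi> (p + t) - \<Phi> p - exp (- V p) * t\<bar> \<le> K * t\<^sup>2" using cdf_quadratic_at by blast
  let ?e = "- (deriv V p * exp (- V p) / 2)"
  have "(\<lambda>n. \<integral>x. (\<Phi> (p + d n * c x) - \<Phi> p - exp (- V p) * (d n * c x)) / (d n)\<^sup>2 \<partial>\<mu>) \<longlonglongrightarrow> (\<integral>x. ?e * (c x)\<^sup>2 \<partial>\<mu>)"
  proof (rule integral_dominated_convergence[where w = "\<lambda>x. K * (c x)\<^sup>2"])
    show "AE x in \<mu>. (\<lambda>n. (\<Phi> (p + d n * c x) - \<Phi> p - exp (- V p) * (d n * c x)) / (d n)\<^sup>2) \<longlonglongrightarrow> ?e * (c x)\<^sup>2"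
    proof (rule AE_I2)
      fix x
      have "\<forall>n. \<exists>t. \<bar>t - p\<bar> \<le> \<bar>d n * c x\<bar> \<and>
         \<Phi> (p + d n * c x) = \<Phi> p + exp (- V p) * (d n * c x) - deriv V t * exp (- V t) / 2 * (d n * c x)\<^sup>2"
        using cdf_taylor2[of p "p + d _ * c x"] by (simp add: add_diff_cancel_left')
      then obtain t where t: "\<And>n. \<bar>t n - p\<bar> \<le> \<bar>d n * c x\<bar>"
        "\<And>n. \<Phi> (p + d n * c x) = \<Phi> p + exp (- V p) * (d n * c x) - deriv V (t n) * exp (- V (t n)) / 2 * (d n * c x)\<^sup>2"
        by metis
      have "(\<lambda>n. d n * c x) \<longlonglongrightarrow> 0 * c x" by (intro tendsto_intros d)
      then have "(\<lambda>n. \<bar>d n * c x\<bar>) \<longlonglongrightarrow> 0" using tendsto_rabs_zero_iff by fastforce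
      then have "(\<lambda>n. t n - p) \<longlonglongrightarrow> 0"
        by (rule Lim_null_comparison[rotated]) (simp add: t(1))
      then have tp: "t \<longlonglongrightarrow> p" by (rule Lim_null[THEN iffD2])
      have "isCont (\<lambda>t. deriv V t * exp (- V t) / 2) p"
        using DERIV_isCont[OF V_deriv2] DERIV_isCont[OF V_deriv] by (intro continuous_intros) auto
      then have "(\<lambda>n. deriv V (t n) * exp (- V (t n)) / 2) \<longlonglongrightarrow> deriv V p * exp (- V p) / 2"
        by (rule isCont_tendsto_compose[OF _ tp])
      then have "(\<lambda>n. - (deriv V (t n) * exp (- V (t n)) / 2) * (c x)\<^sup>2) \<longlonglongrightarrow> ?e * (c x)\<^sup>2"
        by (rule tendsto_mult[OF tendsto_minus tendsto_const])
      moreover have "(\<Phi> (p + d n * c x) - \<Phi> p - exp (- V p) * (d n * c x)) / (d n)\<^sup>2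
          = - (deriv V (t n) * exp (- V (t n)) / 2) * (c x)\<^sup>2" for n
        unfolding t(2)[of n] using d(2)[of n] by (simp add: power_mult_distrib field_simps)
      ultimately show "(\<lambda>n. (\<Phi> (p + d n * c x) - \<Phi> p - exp (- V p) * (d n * c x)) / (d n)\<^sup>2) \<longlonglongrightarrow> ?e * (c x)\<^sup>2" by simp
    qed
    show "AE x in \<mu>. norm ((\<Phi> (p + d n * c x) - \<Phi> p - exp (- V p) * (d n * c x)) / (d n)\<^sup>2) \<le> K * (c x)\<^sup>2" for n
    proof (rule AE_I2)
      fix x
      have "\<bar>\<Phi> (p + d n * c x) - \<Phi> p - exp (- V p) * (d n * c x)\<bar> \<le> K * (c x)\<^sup>2 * (d n)\<^sup>2"
        using K[of "d n * c x"] by (simp add: power_mult_distrib ac_simps)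
      then show "norm ((\<Phi> (p + d n * c x) - \<Phi> p - exp (- V p) * (d n * c x)) / (d n)\<^sup>2) \<le> K * (c x)\<^sup>2"
        using d(2)[of n] by (simp add: pos_divide_le_eq)
    qed
  qed (use c in auto)
  moreover have eq: "(\<integral>x. (\<Phi> (p + d n * c x) - \<Phi> p - exp (- V p) * (d n * c x)) / (d n)\<^sup>2 \<partial>\<mu>)
      = ((\<integral>x. \<Phi> (p + d n * c x) \<partial>\<mu>) - \<Phi> p) / (d n)\<^sup>2" for n
  proof -
    have "integrable \<mu> (\<lambda>x. \<Phi> (p + d n * c x))"
      by (rule bounded_integrable[where K = 1]) (simp_all add: cdf_bounded_prob cdf_nonneg)
    then show ?thesis using c by (simp add: prob_space[simplified])
  qed
  ultimately have "(\<lambda>n. ((\<integral>x. \<Phi> (p + d n * c x) \<partial>\<mu>) - \<Phi> p) / (d n)\<^sup>2) \<longlonglongrightarrow> ?e * (\<integral>x. (c x)\<^sup>2 \<partial>\<mu>)"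
    unfolding eq by simp
  moreover have "(\<lambda>n. (d n)\<^sup>2) \<longlonglongrightarrow> 0\<^sup>2" by (intro tendsto_intros d)
  ultimately have "(\<lambda>n. (\<Psi> (\<integral>x. \<Phi> (p + d n * c x) \<partial>\<mu>) - \<Psi> (\<Phi> p)) / (d n)\<^sup>2)
      \<longlonglongrightarrow> inverse (exp (- V (\<Psi> (\<Phi> p)))) * (?e * (\<integral>x. (c x)\<^sup>2 \<partial>\<mu>))"
    using d by (intro deriv_along_sequence[OF Psi_deriv[OF cdf_pos cdf_less_1]]) simp_all
  then show ?thesis by (simp add: exp_minus field_simps)
qed

lemma ehrhard_first_order:
  assumes ineq: "\<forall>f\<in>borel_unit_funs 1. \<forall>g\<in>borel_unit_funs 1. ehrhard_ineq \<mu> a b 1 f g"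
    and ab: "a > 0" "b > 0"
    and int: "integrable \<mu> c1" "integrable \<mu> c2" "integrable \<mu> c3"
    and le: "\<And>x y. a * c1 x + b * c2 y \<le> c3 (a * x + b * y)"
  shows "a * (\<integral>x. c1 x \<partial>\<mu>) + b * (\<integral>x. c2 x \<partial>\<mu>) \<le> (\<integral>x. c3 x \<partial>\<mu>)"
proof -
  have [measurable]: "c1 \<in> borel_measurable borel" "c2 \<in> borel_measurable borel" "c3 \<in> borel_measurable borel"
    using int by auto
  define d where "d n = inverse (real (Suc n))" for n
  have d: "d \<longlonglongrightarrow> 0" unfolding d_def by (rule LIMSEQ_inverse_real_of_nat)
  have dpos: "d n > 0" for n by (simp add: d_def)
  have d0: "d n \<noteq> 0" for n using dpos[of n] by simp
  note lim = Phi_mean_first_order[OF _ d d0, of _ 0, simplified]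
  have "(\<lambda>n. a * (\<Psi> (\<integral>x. \<Phi> (d n * c1 x) \<partial>\<mu>) / d n) + b * (\<Psi> (\<integral>x. \<Phi> (d n * c2 x) \<partial>\<mu>) / d n))
      \<longlonglongrightarrow> a * (\<integral>x. c1 x \<partial>\<mu>) + b * (\<integral>x. c2 x \<partial>\<mu>)"
    by (intro tendsto_intros lim int)
  moreover have "(\<lambda>n. \<Psi> (\<integral>x. \<Phi> (d n * c3 x) \<partial>\<mu>) / d n) \<longlonglongrightarrow> (\<integral>x. c3 x \<partial>\<mu>)"
    by (intro lim int)
  ultimately show ?thesis
  proof (rule lim_mono[rotated 1, where N = 0])
    fix n
    have "a * (d n * c1 x) + b * (d n * c2 y) \<le> d n * c3 (a * x + b * y)" for x y
      using mult_left_mono[OF le[of x y], of "d n"] dpos[of n] by (simp add: algebra_simps)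
    then have "a * \<Psi> (\<integral>x. \<Phi> (d n * c1 x) \<partial>\<mu>) + b * \<Psi> (\<integral>x. \<Phi> (d n * c2 x) \<partial>\<mu>) \<le> \<Psi> (\<integral>x. \<Phi> (d n * c3 x) \<partial>\<mu>)"
      by (intro ehrhard_test[OF ineq ab]) simp_all
    then show "a * (\<Psi> (\<integral>x. \<Phi> (d n * c1 x) \<partial>\<mu>) / d n) + b * (\<Psi> (\<integral>x. \<Phi> (d n * c2 x) \<partial>\<mu>) / d n)
        \<le> \<Psi> (\<integral>x. \<Phi> (d n * c3 x) \<partial>\<mu>) / d n"
      using divide_right_mono[of _ _ "d n"] dpos[of n] by (simp add: add_divide_distrib[symmetric])
  qed
qed

text \<open>Both \<open>v\<close> and \<open>w\<close> are perturbed with the same slope, so their supremal convolution is linear as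
  well. Centering at the mean \<open>m\<close> is compatible with the convolution because \<open>(a + b) m = m\<close>.\<close>

lemma ehrhard_second_order:
  assumes ineq: "\<forall>f\<in>borel_unit_funs 1. \<forall>g\<in>borel_unit_funs 1. ehrhard_ineq \<mu> a b 1 f g"
    and ab: "a > 0" "b > 0"
    and int: "integrable \<mu> (\<lambda>x. x)" "integrable \<mu> (\<lambda>x. x\<^sup>2)"
    and m: "m = (\<integral>x. x \<partial>\<mu>)" "(a + b) * m = m" and var: "(\<integral>x. (x - m)\<^sup>2 \<partial>\<mu>) > 0"
  shows "deriv V (a * p + b * q) \<le> a * deriv V p + b * deriv V q"
proof -
  define d where "d n = inverse (real (Suc n))" for n
  have d: "d \<longlonglongrightarrow> 0" unfolding d_def by (rule LIMSEQ_inverse_real_of_nat)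
  have dpos: "d n > 0" for n by (simp add: d_def)
  have d0: "d n \<noteq> 0" for n using dpos[of n] by simp
  let ?s = "\<integral>x. (x - m)\<^sup>2 \<partial>\<mu>"
  let ?G = "\<lambda>p n. \<Psi> (\<integral>x. \<Phi> (p + d n * (x - m)) \<partial>\<mu>)"
  have i2: "integrable \<mu> (\<lambda>x. (x - m)\<^sup>2)"
    unfolding power2_diff using int by simp
  have i0: "(\<integral>x. x - m \<partial>\<mu>) = 0" using int m by (simp add: prob_space[simplified])
  have lim: "(\<lambda>n. (?G p n - p) / (d n)\<^sup>2) \<longlonglongrightarrow> - (deriv V p / 2 * ?s)" for p
    by (rule Phi_mean_second_order[OF i2 _ i0 d d0]) (use int in simp)
  let ?r = "a * p + b * q"
  have "(\<lambda>n. a * ((?G p n - p) / (d n)\<^sup>2) + b * ((?G q n - q) / (d n)\<^sup>2))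
      \<longlonglongrightarrow> a * - (deriv V p / 2 * ?s) + b * - (deriv V q / 2 * ?s)"
    by (intro tendsto_intros lim)
  moreover have "(\<lambda>n. (?G ?r n - ?r) / (d n)\<^sup>2) \<longlonglongrightarrow> - (deriv V ?r / 2 * ?s)"
    by (rule lim)
  ultimately have "a * - (deriv V p / 2 * ?s) + b * - (deriv V q / 2 * ?s) \<le> - (deriv V ?r / 2 * ?s)"
  proof (rule lim_mono[rotated 1, where N = 0])
    fix n
    have "a * ?G p n + b * ?G q n \<le> ?G ?r n"
    proof (rule ehrhard_test[OF ineq ab])
      fix x y
      have "?r + d n * (a * x + b * y - m) - (a * (p + d n * (x - m)) + b * (q + d n * (y - m))) = d n * ((a + b) * m - m)"
        by (simp add: algebra_simps)
      then show "a * (p + d n * (x - m)) + b * (q + d n * (y - m)) \<le> ?r + d n * (a * x + b * y - m)"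
        using m(2) by simp
    qed simp_all
    then have "a * (?G p n - p) + b * (?G q n - q) \<le> ?G ?r n - ?r" by (simp add: algebra_simps)
    from divide_right_mono[OF this, of "(d n)\<^sup>2"]
    show "a * ((?G p n - p) / (d n)\<^sup>2) + b * ((?G q n - q) / (d n)\<^sup>2) \<le> (?G ?r n - ?r) / (d n)\<^sup>2"
      by (simp add: add_divide_distrib)
  qed
  then have "?s * deriv V ?r \<le> ?s * (a * deriv V p + b * deriv V q)" by (simp add: algebra_simps)
  then show ?thesis using var by (simp only: mult_le_cancel_left_pos)
qed

lemma centered_square_pos: assumes "integrable \<mu> (\<lambda>x. (x - m)\<^sup>2)" shows "(\<integral>x. (x - m)\<^sup>2 \<partial>\<mu>) > 0"
proof -
  have "(\<integral>x. 0 \<partial>\<mu>) < (\<integral>x. (x - m)\<^sup>2 \<partial>\<mu>)"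
  proof (rule integral_less_AE_space)
    have "measure \<mu> {m} = 0" using DERIV_isCont[OF cdf_deriv] isCont_cdf by blast
    then have "AE x in \<mu>. x \<notin> {m}"
      by (intro AE_not_in) (auto simp: null_sets_def emeasure_eq_measure)
    then show "AE x in \<mu>. 0 < (x - m)\<^sup>2" by eventually_elim auto
  qed (use assms emeasure_space_1 in auto)
  then show ?thesis by simp
qed

text \<open>Perturbations of constants by linear functions give the statements about the mean and about \<open>V'\<close>.
  Perturbations by quadratic functions of equal sign give \<open>a + b \<ge> 1\<close>, by quadratic functions of
  opposite sign \<open>\<bar>a - b\<bar> \<le> 1\<close>; the convolutions of these quadratics are explicit.\<close>

lemma ehrhard_necessary:
  assumes ineq: "\<forall>f\<in>borel_unit_funs 1. \<forall>g\<in>borel_unit_funs 1. ehrhard_ineq \<mu> a b 1 f g"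
    and ab: "a > 0" "b > 0"
    and mom: "integrable \<mu> (\<lambda>x. \<bar>x\<bar> ^ 5)"
  shows "cond_C V a b"
proof -
  have i1: "integrable \<mu> (\<lambda>x. x)"
  proof (rule Bochner_Integration.integrable_bound)
    show "integrable \<mu> (\<lambda>x. 1 + \<bar>x\<bar> ^ 5)" using mom by simp
    have "\<bar>x\<bar> \<le> 1 + \<bar>x\<bar> ^ 5" for x :: real
    proof (cases "\<bar>x\<bar> \<le> 1")
      case False then show ?thesis using power_increasing[of 1 5 "\<bar>x\<bar>"] by simp
    qed (simp add: add_increasing2)
    then show "AE x in \<mu>. norm x \<le> norm (1 + \<bar>x\<bar> ^ 5)" by simp
  qed simp
  have i2: "integrable \<mu> (\<lambda>x. x\<^sup>2)"
  proof (rule Bochner_Integration.integrable_bound)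
    show "integrable \<mu> (\<lambda>x. 1 + \<bar>x\<bar> ^ 5)" using mom by simp
    have "x\<^sup>2 \<le> 1 + \<bar>x\<bar> ^ 5" for x :: real
    proof (cases "\<bar>x\<bar> \<le> 1")
      case True
      then have "x\<^sup>2 \<le> 1" by (simp add: abs_square_le_1)
      then show ?thesis by (simp add: add_increasing2)
    next
      case False then show ?thesis using power_increasing[of 2 5 "\<bar>x\<bar>"] by simp
    qed
    then show "AE x in \<mu>. norm (x\<^sup>2) \<le> norm (1 + \<bar>x\<bar> ^ 5)" by simp
  qed simp
  note first = ehrhard_first_order[OF ineq ab]
  define m where "m = (\<integral>x. x \<partial>\<mu>)"
  define s where "s = (\<integral>x. x\<^sup>2 \<partial>\<mu>)"
  have spos: "s > 0" using centered_square_pos[of 0] i2 by (simp add: s_def)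
  have "a * m + b * m \<le> m"
    unfolding m_def by (rule first) (use i1 in simp_all)
  moreover have "a * (\<integral>x. - x \<partial>\<mu>) + b * (\<integral>x. - x \<partial>\<mu>) \<le> (\<integral>x. - x \<partial>\<mu>)"
    by (rule first) (use i1 in simp_all)
  then have "m \<le> a * m + b * m" by (simp add: m_def)
  ultimately have m: "(a + b) * m = m" by (simp add: algebra_simps)
  have "deriv V (a * p + b * q) \<le> a * deriv V p + b * deriv V q" for p q
    by (rule ehrhard_second_order[OF ineq ab i1 i2 m_def m], rule centered_square_pos)
      (use i1 i2 in \<open>simp add: power2_diff\<close>)
  moreover have "1 \<le> (a + b)\<^sup>2"
  proof -
    have "a * (\<integral>x. - x\<^sup>2 \<partial>\<mu>) + b * (\<integral>x. - x\<^sup>2 \<partial>\<mu>) \<le> (\<integral>x. - (x\<^sup>2 / (a + b)) \<partial>\<mu>)"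
    proof (rule first)
      fix x y :: real
      have "(a + b) * (a * x\<^sup>2 + b * y\<^sup>2) - (a * x + b * y)\<^sup>2 = a * b * (x - y)\<^sup>2"
        by (simp add: algebra_simps power2_eq_square)
      moreover have "a * b * (x - y)\<^sup>2 \<ge> 0" using ab by simp
      ultimately have "(a * x + b * y)\<^sup>2 / (a + b) \<le> a * x\<^sup>2 + b * y\<^sup>2"
        using ab by (subst pos_divide_le_eq) (linarith, subst mult.commute, linarith)
      then show "a * - x\<^sup>2 + b * - y\<^sup>2 \<le> - ((a * x + b * y)\<^sup>2 / (a + b))" by simp
    qed (use i2 in simp_all)
    then have "a * - s + b * - s \<le> - (s / (a + b))" by (simp add: s_def)
    then have "s * 1 \<le> s * (a + b)\<^sup>2"
      using ab by (simp add: field_simps power2_eq_square)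
    then show ?thesis using spos by (simp only: mult_le_cancel_left_pos)
  qed
  moreover have "(a - b)\<^sup>2 \<le> 1"
  proof (rule linorder_cases[of a b])
    assume l: "a < b"
    have "a * (\<integral>x. - x\<^sup>2 \<partial>\<mu>) + b * (\<integral>x. x\<^sup>2 \<partial>\<mu>) \<le> (\<integral>x. x\<^sup>2 / (b - a) \<partial>\<mu>)"
    proof (rule first)
      fix x y :: real
      have "(a * x + b * y)\<^sup>2 - (b - a) * (b * y\<^sup>2 - a * x\<^sup>2) = a * b * (x + y)\<^sup>2"
        by (simp add: algebra_simps power2_eq_square)
      moreover have "a * b * (x + y)\<^sup>2 \<ge> 0" using ab by simp
      ultimately show "a * - x\<^sup>2 + b * y\<^sup>2 \<le> (a * x + b * y)\<^sup>2 / (b - a)"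
        using l by (simp add: pos_le_divide_eq mult.commute)
    qed (use i2 in simp_all)
    then have "a * - s + b * s \<le> s / (b - a)" by (simp add: s_def)
    then have "s * (a - b)\<^sup>2 \<le> s * 1"
      using l by (simp add: field_simps power2_eq_square)
    then show ?thesis using spos by (simp only: mult_le_cancel_left_pos)
  next
    assume l: "b < a"
    have "a * (\<integral>x. x\<^sup>2 \<partial>\<mu>) + b * (\<integral>x. - x\<^sup>2 \<partial>\<mu>) \<le> (\<integral>x. x\<^sup>2 / (a - b) \<partial>\<mu>)"
    proof (rule first)
      fix x y :: real
      have "(a * x + b * y)\<^sup>2 - (a - b) * (a * x\<^sup>2 - b * y\<^sup>2) = a * b * (x + y)\<^sup>2"
        by (simp add: algebra_simps power2_eq_square)
      moreover have "a * b * (x + y)\<^sup>2 \<ge> 0" using ab by simp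
      ultimately show "a * x\<^sup>2 + b * - y\<^sup>2 \<le> (a * x + b * y)\<^sup>2 / (a - b)"
        using l by (simp add: pos_le_divide_eq mult.commute)
    qed (use i2 in simp_all)
    then have "a * s + b * - s \<le> s / (a - b)" by (simp add: s_def)
    then have "s * (a - b)\<^sup>2 \<le> s * 1"
      using l by (simp add: field_simps power2_eq_square)
    then show ?thesis using spos by (simp only: mult_le_cancel_left_pos)
  qed simp
  ultimately show ?thesis
    unfolding cond_C_def
  proof (intro conjI allI impI)
    assume "1 \<le> (a + b)\<^sup>2" "(a - b)\<^sup>2 \<le> 1"
    then show "\<bar>1 - a\<^sup>2 - b\<^sup>2\<bar> \<le> 2 * a * b"
      by (auto simp: abs_le_iff power2_eq_square algebra_simps)
  next
    assume "1 < a + b"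
    then show "(\<integral>x. x \<partial>\<mu>) = 0" using m by (simp add: m_def)
  qed
qed

end

section \<open>The heat semigroup on functions with a uniform Taylor expansion\<close>

lemma exp_gaussian_potential: "exp (- (x\<^sup>2 / 2 + ln (sqrt (2 * pi)))) = std_normal_density x"
proof -
  have "- (x\<^sup>2 / 2 + ln (sqrt (2 * pi))) = - x\<^sup>2 / 2 - ln (sqrt (2 * pi))" by simp
  then show ?thesis by (simp only: exp_diff) (simp add: std_normal_density_def)
qed

locale gaussian = exp_prob V for V +
  assumes V_eq: "V = (\<lambda>x. x\<^sup>2 / 2 + ln (sqrt (2 * pi)))"
begin

lemma density_eq: "exp (- V x) = std_normal_density x"
  by (simp only: V_eq exp_gaussian_potential)

lemma mu_eq: "\<mu> = density lborel std_normal_density"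
  unfolding exp_measure_def density_eq ..

lemma moments:
  "integrable \<mu> (\<lambda>y. y)" "(\<integral>y. y \<partial>\<mu>) = 0" "integrable \<mu> (\<lambda>y. y\<^sup>2)" "(\<integral>y. y\<^sup>2 \<partial>\<mu>) = 1"
  "integrable \<mu> (\<lambda>y. \<bar>y\<bar>^3)"
proof -
  have i: "integrable \<mu> f \<longleftrightarrow> integrable lborel (\<lambda>x. std_normal_density x * f x)"
    if [measurable]: "f \<in> borel_measurable borel" for f :: "real \<Rightarrow> real"
    unfolding mu_eq by (subst integrable_density) auto
  have e: "(\<integral>y. f y \<partial>\<mu>) = (\<integral>x. std_normal_density x * f x \<partial>lborel)"
    if [measurable]: "f \<in> borel_measurable borel" for f :: "real \<Rightarrow> real"
    using integral_mu[of f] by (simp add: density_eq)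
  show "integrable \<mu> (\<lambda>y. y)" using integrable_std_normal_moment[of 1] by (subst i) simp_all
  show "integrable \<mu> (\<lambda>y. y\<^sup>2)" using integrable_std_normal_moment[of 2] by (subst i) simp_all
  show "integrable \<mu> (\<lambda>y. \<bar>y\<bar>^3)" using integrable_std_normal_moment_abs[of 3] by (subst i) simp_all
  show "(\<integral>y. y \<partial>\<mu>) = 0" using integral_std_normal_moment_odd[of 0] by (subst e) simp_all
  show "(\<integral>y. y\<^sup>2 \<partial>\<mu>) = 1" using integral_std_normal_moment_even[of 1] by (subst e) simp_all
qed

definition third_moment :: real where "third_moment = (\<integral>y. \<bar>y\<bar>^3 \<partial>\<mu>)"

lemma third_moment_nonneg: "third_moment \<ge> 0"
  unfolding third_moment_def by (rule integral_nonneg_AE) simp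

definition heat :: "real \<Rightarrow> (real \<Rightarrow> real) \<Rightarrow> real \<Rightarrow> real" where
  "heat \<eta> f x = (\<integral>y. f (x + \<eta> * y) \<partial>\<mu>)"

lemma heat_0: "heat 0 f = f"
  by (simp add: heat_def fun_eq_iff prob_space[simplified])

lemma heat_1_at_0: "heat 1 f 0 = (\<integral>y. f y \<partial>\<mu>)"
  by (simp add: heat_def)

lemma heat_measurable[measurable]: assumes [measurable]: "f \<in> borel_measurable borel"
  shows "heat \<eta> f \<in> borel_measurable borel"
  unfolding heat_def by measurable

lemma heat_range:
  assumes [measurable]: "f \<in> borel_measurable borel" and r: "\<And>x. f x \<in> {l..r}"
  shows "heat \<eta> f x \<in> {l..r}"
proof -
  have "integrable \<mu> (\<lambda>y. f (x + \<eta> * y))"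
  proof (rule bounded_integrable[where K = "\<bar>l\<bar> + \<bar>r\<bar>"])
    show "\<bar>f (x + \<eta> * y)\<bar> \<le> \<bar>l\<bar> + \<bar>r\<bar>" for y using r[of "x + \<eta> * y"] by (simp add: abs_le_iff) linarith
  qed measurable
  then show ?thesis
    using integral_ge_const[of "\<lambda>y. f (x + \<eta> * y)" l] integral_le_const[of "\<lambda>y. f (x + \<eta> * y)" r] r
    by (auto simp: heat_def)
qed

lemma scaled_gaussian: assumes "s > 0"
  shows "distr \<mu> lborel (\<lambda>y. s * y) = density lborel (normal_density 0 s)"
proof -
  have "distributed \<mu> lborel (\<lambda>y. y) std_normal_density"
    unfolding distributed_def using distr_id2[of lborel \<mu>] by (auto simp: mu_eq)
  from normal_density_affine[OF this, of s 0] assms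
  have "distributed \<mu> lborel (\<lambda>y. s * y) (normal_density 0 s)" by simp
  then show ?thesis by (rule distributed_distr_eq_density)
qed

lemma heat_semigroup:
  assumes [measurable]: "f \<in> borel_measurable borel" and K: "\<And>x. \<bar>f x\<bar> \<le> K" and st: "s \<ge> 0" "t \<ge> 0"
  shows "heat s (heat t f) = heat (sqrt (s\<^sup>2 + t\<^sup>2)) f"
proof (cases "s = 0 \<or> t = 0")
  case True
  then show ?thesis using st by (auto simp: heat_0)
next
  case False
  then have pos: "s > 0" "t > 0" "sqrt (s\<^sup>2 + t\<^sup>2) > 0" using st by (auto simp: sum_power2_gt_zero_iff)
  define N where "N = (\<lambda>r. density lborel (\<lambda>x. ennreal (normal_density 0 r x)))"
  have pN: "prob_space (N r)" if "r > 0" for r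
    unfolding N_def by (rule prob_space_normal_density[OF that])
  have sN[measurable_cong]: "sets (N r) = sets borel" for r by (simp add: N_def)
  have hN: "heat r g x = (\<integral>z. g (x + z) \<partial>N r)" if "r > 0" and [measurable]: "g \<in> borel_measurable borel" for r g x
    unfolding N_def scaled_gaussian[OF that(1), symmetric] heat_def by (subst integral_distr) auto
  have conv: "N s \<star> N t = N (sqrt (s\<^sup>2 + t\<^sup>2))"
  proof -
    have "N s \<star> N t = density lborel (\<lambda>x. \<integral>\<^sup>+y. ennreal (normal_density 0 s (x - y)) * ennreal (normal_density 0 t y) \<partial>lborel)"
      unfolding N_def
      by (rule convolution_density)
        (use pN[OF pos(1)] pN[OF pos(2)] in \<open>auto simp: N_def dest: prob_space.finite_measure\<close>)
    also have "\<dots> = N (sqrt (s\<^sup>2 + t\<^sup>2))"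
      unfolding N_def using fun_cong[OF conv_normal_density_zero_mean[OF pos(1,2)]]
      by (intro arg_cong[of _ _ "density lborel"] ext) (simp add: ennreal_mult')
    finally show ?thesis .
  qed
  interpret s: prob_space "N s" by (rule pN) fact
  interpret t: prob_space "N t" by (rule pN) fact
  interpret st: pair_prob_space "N s" "N t" ..
  show ?thesis
  proof
    fix x
    have "heat (sqrt (s\<^sup>2 + t\<^sup>2)) f x = (\<integral>z. f (x + z) \<partial>(N s \<star> N t))"
      by (subst hN[OF pos(3)]) (auto simp: conv)
    also have "\<dots> = (\<integral>p. f (x + (fst p + snd p)) \<partial>(N s \<Otimes>\<^sub>M N t))"
      unfolding convolution_def by (subst integral_distr) (auto simp: case_prod_beta)
    also have "\<dots> = (\<integral>y. (\<integral>z. f (x + (y + z)) \<partial>N t) \<partial>N s)"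
    proof (subst st.integral_fst'[symmetric])
      show "integrable (N s \<Otimes>\<^sub>M N t) (\<lambda>p. f (x + (fst p + snd p)))"
        by (rule st.P.integrable_const_bound[where B = K]) (use K in auto)
    qed simp
    also have "\<dots> = (\<integral>y. heat t f (x + y) \<partial>N s)"
      by (intro Bochner_Integration.integral_cong refl) (simp add: hN[OF pos(2)] add.assoc)
    also have "\<dots> = heat s (heat t f) x"
      by (subst hN[OF pos(1)]) auto
    finally show "heat s (heat t f) x = heat (sqrt (s\<^sup>2 + t\<^sup>2)) f x" ..
  qed
qed

lemma heat_iterate:
  assumes [measurable]: "f \<in> borel_measurable borel" and K: "\<And>x. f x \<in> {l..r}" and "\<eta> \<ge> 0"
  shows "(heat \<eta> ^^ n) f = heat (sqrt n * \<eta>) f"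
proof (induction n)
  case (Suc n)
  have "\<bar>f x\<bar> \<le> \<bar>l\<bar> + \<bar>r\<bar>" for x using K[of x] by (simp add: abs_le_iff) linarith
  then have "heat \<eta> (heat (sqrt n * \<eta>) f) = heat (sqrt (\<eta>\<^sup>2 + (sqrt n * \<eta>)\<^sup>2)) f"
    using assms by (intro heat_semigroup) auto
  also have "\<eta>\<^sup>2 + (sqrt n * \<eta>)\<^sup>2 = real (Suc n) * \<eta>\<^sup>2" by (simp add: power_mult_distrib algebra_simps)
  also have "sqrt \<dots> = sqrt (Suc n) * \<eta>" using assms(3) by (simp add: real_sqrt_mult)
  finally show ?case using Suc by simp
qed (simp add: heat_0)

end

text \<open>The class of functions on which the argument runs. It asks for a Taylor expansion with a
  uniform remainder rather than for derivatives, because in this form it is visibly stable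
  under averaging.\<close>

definition taylor3 :: "real \<Rightarrow> (real \<Rightarrow> real) \<Rightarrow> (real \<Rightarrow> real) \<Rightarrow> (real \<Rightarrow> real) \<Rightarrow> bool" where
  "taylor3 K f f1 f2 \<longleftrightarrow> f \<in> borel_measurable borel \<and> f1 \<in> borel_measurable borel \<and> f2 \<in> borel_measurable borel \<and>
     (\<forall>x. \<bar>f1 x\<bar> \<le> K) \<and> (\<forall>x. \<bar>f2 x\<bar> \<le> K) \<and>
     (\<forall>x h. \<bar>f (x + h) - f x - f1 x * h - f2 x * h\<^sup>2 / 2\<bar> \<le> K * \<bar>h\<bar>^3)"

text \<open>Chain rule for second-order expansions: \<open>A\<close> and \<open>B\<close> are the first two derivatives of the
  outer function, \<open>\<Delta>\<close> is the increment of the inner one.\<close>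

lemma taylor_compose:
  fixes A B C K h \<Delta> f1 f2 R :: real
  assumes A: "\<bar>A\<bar> \<le> C" and B: "\<bar>B\<bar> \<le> C" and R: "\<bar>R - A * \<Delta> - B * \<Delta>\<^sup>2 / 2\<bar> \<le> C * \<bar>\<Delta>\<bar>^3"
    and \<Delta>: "\<bar>\<Delta> - f1 * h - f2 * h\<^sup>2 / 2\<bar> \<le> K * \<bar>h\<bar>^3" and f: "\<bar>f1\<bar> \<le> K" "\<bar>f2\<bar> \<le> K" and h: "\<bar>h\<bar> \<le> 1"
    and K: "K \<ge> 0" and C: "C \<ge> 0"
  shows "\<bar>R - (A * f1) * h - (A * f2 + B * f1\<^sup>2) * h\<^sup>2 / 2\<bar> \<le> (27 * C * K^3 + C * K + 5 * C * K\<^sup>2) * \<bar>h\<bar>^3"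
proof -
  have h2: "h\<^sup>2 \<le> \<bar>h\<bar>" and h3: "\<bar>h\<bar>^3 \<le> h\<^sup>2"
    using h power_decreasing[of 1 2 "\<bar>h\<bar>"] power_decreasing[of 2 3 "\<bar>h\<bar>"] by simp_all
  have f2h: "\<bar>f2 * h\<^sup>2 / 2\<bar> \<le> K * h\<^sup>2 / 2"
    using mult_right_mono[OF f(2), of "h\<^sup>2"] by (simp add: abs_mult)
  have f1h: "\<bar>f1 * h\<bar> \<le> K * \<bar>h\<bar>" using mult_right_mono[OF f(1), of "\<bar>h\<bar>"] by (simp add: abs_mult)
  have Kh3: "K * \<bar>h\<bar>^3 \<le> K * h\<^sup>2" and Kh2: "K * h\<^sup>2 \<le> K * \<bar>h\<bar>" using K h2 h3 by (auto intro: mult_left_mono)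
  have d1: "\<bar>\<Delta> - f1 * h\<bar> \<le> 2 * K * h\<^sup>2" using \<Delta> f2h Kh3 mult_nonneg_nonneg[OF K zero_le_power2[of h]] by linarith
  have d2: "\<bar>\<Delta>\<bar> \<le> 3 * K * \<bar>h\<bar>" using d1 f1h Kh2 by linarith
  have d3: "\<bar>\<Delta> + f1 * h\<bar> \<le> 4 * K * \<bar>h\<bar>" using d2 f1h by linarith
  have sq: "\<bar>\<Delta>\<^sup>2 - (f1 * h)\<^sup>2\<bar> \<le> 8 * K\<^sup>2 * \<bar>h\<bar>^3"
  proof -
    have "\<bar>\<Delta>\<^sup>2 - (f1 * h)\<^sup>2\<bar> = \<bar>\<Delta> - f1 * h\<bar> * \<bar>\<Delta> + f1 * h\<bar>"
      by (simp add: abs_mult[symmetric] power2_eq_square algebra_simps)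
    also have "\<dots> \<le> (2 * K * h\<^sup>2) * (4 * K * \<bar>h\<bar>)" using d1 d3 K by (intro mult_mono) auto
    also have "\<dots> = 8 * K\<^sup>2 * \<bar>h\<bar>^3" by (simp add: power2_eq_square power3_eq_cube algebra_simps)
    finally show ?thesis .
  qed
  have cube: "\<bar>\<Delta>\<bar>^3 \<le> 27 * K^3 * \<bar>h\<bar>^3"
    using power_mono[OF d2, of 3] by (simp add: power_mult_distrib)
  have "R - (A * f1) * h - (A * f2 + B * f1\<^sup>2) * h\<^sup>2 / 2
      = (R - A * \<Delta> - B * \<Delta>\<^sup>2 / 2) + A * (\<Delta> - f1 * h - f2 * h\<^sup>2 / 2) + B / 2 * (\<Delta>\<^sup>2 - (f1 * h)\<^sup>2)"
    by (simp add: power_mult_distrib field_simps)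
  also have "\<bar>\<dots>\<bar> \<le> \<bar>R - A * \<Delta> - B * \<Delta>\<^sup>2 / 2\<bar> + \<bar>A * (\<Delta> - f1 * h - f2 * h\<^sup>2 / 2)\<bar> + \<bar>B / 2 * (\<Delta>\<^sup>2 - (f1 * h)\<^sup>2)\<bar>"
    by linarith
  also have "\<dots> \<le> C * (27 * K^3 * \<bar>h\<bar>^3) + C * (K * \<bar>h\<bar>^3) + C / 2 * (8 * K\<^sup>2 * \<bar>h\<bar>^3)"
    unfolding abs_mult using A B C \<Delta> sq
    by (intro add_mono order_trans[OF R] mult_mono mult_left_mono cube) auto
  also have "\<dots> = (27 * C * K^3 + C * K + 4 * C * K\<^sup>2) * \<bar>h\<bar>^3" by (simp add: algebra_simps)
  also have "\<dots> \<le> (27 * C * K^3 + C * K + 5 * C * K\<^sup>2) * \<bar>h\<bar>^3"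
    using C by (intro mult_right_mono) auto
  finally show ?thesis .
qed

context gaussian
begin

lemma taylor3_heat: assumes f: "taylor3 K f f1 f2" and r: "\<And>x. f x \<in> {l..r}"
  shows "taylor3 K (heat \<eta> f) (heat \<eta> f1) (heat \<eta> f2)"
proof -
  have [measurable]: "f \<in> borel_measurable borel" "f1 \<in> borel_measurable borel" "f2 \<in> borel_measurable borel"
    and f12: "\<And>x. \<bar>f1 x\<bar> \<le> K" "\<And>x. \<bar>f2 x\<bar> \<le> K"
    and exp: "\<And>x h. \<bar>f (x + h) - f x - f1 x * h - f2 x * h\<^sup>2 / 2\<bar> \<le> K * \<bar>h\<bar>^3"
    using f unfolding taylor3_def by blast+
  have i: "integrable \<mu> (\<lambda>y. f (x + \<eta> * y))" "integrable \<mu> (\<lambda>y. f1 (x + \<eta> * y))" "integrable \<mu> (\<lambda>y. f2 (x + \<eta> * y))" for x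
  proof -
    show "integrable \<mu> (\<lambda>y. f (x + \<eta> * y))"
    proof (rule bounded_integrable[where K = "\<bar>l\<bar> + \<bar>r\<bar>"])
      show "\<bar>f (x + \<eta> * y)\<bar> \<le> \<bar>l\<bar> + \<bar>r\<bar>" for y using r[of "x + \<eta> * y"] by (simp add: abs_le_iff) linarith
    qed measurable
    show "integrable \<mu> (\<lambda>y. f1 (x + \<eta> * y))"
      by (rule bounded_integrable[where K = K]) (measurable, rule f12)
    show "integrable \<mu> (\<lambda>y. f2 (x + \<eta> * y))"
      by (rule bounded_integrable[where K = K]) (measurable, rule f12)
  qed
  have b: "\<bar>heat \<eta> g x\<bar> \<le> K" if "\<And>x. \<bar>g x\<bar> \<le> K" and [measurable]: "g \<in> borel_measurable borel" for g x
  proof -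
    have "g x \<in> {- K..K}" for x using that(1)[of x] by (auto simp: abs_le_iff)
    from heat_range[OF that(2) this, of \<eta> x] show ?thesis by (auto simp: abs_le_iff)
  qed
  have "\<bar>heat \<eta> f (x + h) - heat \<eta> f x - heat \<eta> f1 x * h - heat \<eta> f2 x * h\<^sup>2 / 2\<bar> \<le> K * \<bar>h\<bar>^3" for x h
  proof -
    let ?g = "\<lambda>y. f (x + h + \<eta> * y) - f (x + \<eta> * y) - f1 (x + \<eta> * y) * h - f2 (x + \<eta> * y) * h\<^sup>2 / 2"
    have eq: "heat \<eta> f (x + h) - heat \<eta> f x - heat \<eta> f1 x * h - heat \<eta> f2 x * h\<^sup>2 / 2 = (\<integral>y. ?g y \<partial>\<mu>)"
      unfolding heat_def
      by (simp add: i Bochner_Integration.integral_diff)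
    have "\<bar>\<integral>y. ?g y \<partial>\<mu>\<bar> \<le> (\<integral>y. \<bar>?g y\<bar> \<partial>\<mu>)" by (rule integral_abs_bound)
    also have "\<dots> \<le> K * \<bar>h\<bar>^3"
    proof (rule integral_le_const)
      show "integrable \<mu> (\<lambda>y. \<bar>?g y\<bar>)" using i by simp
      have "\<bar>?g y\<bar> \<le> K * \<bar>h\<bar>^3" for y
      proof -
        have "\<bar>f ((x + \<eta> * y) + h) - f (x + \<eta> * y) - f1 (x + \<eta> * y) * h - f2 (x + \<eta> * y) * h\<^sup>2 / 2\<bar> \<le> K * \<bar>h\<bar>^3"
          by (rule exp)
        moreover have "(x + \<eta> * y) + h = x + h + \<eta> * y" by simp
        ultimately show ?thesis by (simp only:)
      qed
      then show "AE y in \<mu>. \<bar>?g y\<bar> \<le> K * \<bar>h\<bar>^3" by simp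
    qed
    finally show ?thesis unfolding eq .
  qed
  moreover have "\<bar>heat \<eta> f1 x\<bar> \<le> K" "\<bar>heat \<eta> f2 x\<bar> \<le> K" for x
    by (intro b f12; measurable)+
  ultimately show ?thesis unfolding taylor3_def by (intro conjI allI heat_measurable) simp_all
qed

lemma heat_expand: assumes f: "taylor3 K f f1 f2" and r: "\<And>x. f x \<in> {l..r}" and \<eta>: "\<eta> \<ge> 0"
  shows "\<bar>heat \<eta> f x - f x - f2 x * \<eta>\<^sup>2 / 2\<bar> \<le> K * third_moment * \<eta>^3"
proof -
  have [measurable]: "f \<in> borel_measurable borel" using f by (auto simp: taylor3_def)
  have i: "integrable \<mu> (\<lambda>y. f (x + \<eta> * y))"
  proof (rule bounded_integrable[where K = "\<bar>l\<bar> + \<bar>r\<bar>"])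
    show "\<bar>f (x + \<eta> * y)\<bar> \<le> \<bar>l\<bar> + \<bar>r\<bar>" for y using r[of "x + \<eta> * y"] by (simp add: abs_le_iff) linarith
  qed measurable
  let ?g = "\<lambda>y. f (x + \<eta> * y) - f x - (f1 x * \<eta>) * y - (f2 x * \<eta>\<^sup>2 / 2) * y\<^sup>2"
  have eq: "heat \<eta> f x - f x - f2 x * \<eta>\<^sup>2 / 2 = (\<integral>y. ?g y \<partial>\<mu>)"
    unfolding heat_def using i moments by (simp add: prob_space[simplified])
  have "\<bar>\<integral>y. ?g y \<partial>\<mu>\<bar> \<le> (\<integral>y. \<bar>?g y\<bar> \<partial>\<mu>)" by (rule integral_abs_bound)
  also have "\<dots> \<le> (\<integral>y. K * \<eta>^3 * \<bar>y\<bar>^3 \<partial>\<mu>)"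
  proof (rule integral_mono)
    show "integrable \<mu> (\<lambda>y. \<bar>?g y\<bar>)" using i moments by simp
    show "integrable \<mu> (\<lambda>y. K * \<eta>^3 * \<bar>y\<bar>^3)" using moments by simp
    fix y
    have "\<bar>f (x + \<eta> * y) - f x - f1 x * (\<eta> * y) - f2 x * (\<eta> * y)\<^sup>2 / 2\<bar> \<le> K * \<bar>\<eta> * y\<bar>^3"
      using f unfolding taylor3_def by blast
    then show "\<bar>?g y\<bar> \<le> K * \<eta>^3 * \<bar>y\<bar>^3"
      using \<eta> by (simp add: abs_mult power_mult_distrib algebra_simps)
  qed
  also have "\<dots> = K * third_moment * \<eta>^3" by (simp add: third_moment_def)
  finally show ?thesis unfolding eq .
qed

text \<open>Derivatives of \<open>\<Psi>\<close>; here the shape of the Gaussian density enters: \<open>\<phi>' = - x \<phi>\<close>.\<close>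

lemma V_deriv_id: "(V has_real_derivative x) (at x)"
proof -
  have "((\<lambda>x. x\<^sup>2 / 2 + ln (sqrt (2 * pi))) has_real_derivative x) (at x)"
    by (auto intro!: derivative_eq_intros)
  then show ?thesis by (simp only: V_eq)
qed

lemma Psi_derivs:
  assumes p: "0 < p" "p < 1"
  shows "(\<Psi> has_real_derivative exp (V (\<Psi> p))) (at p)"
    "((\<lambda>p. exp (V (\<Psi> p))) has_real_derivative \<Psi> p * exp (V (\<Psi> p))^2) (at p)"
    "((\<lambda>p. \<Psi> p * exp (V (\<Psi> p))^2) has_real_derivative (1 + 2 * (\<Psi> p)\<^sup>2) * exp (V (\<Psi> p))^3) (at p)"
proof -
  show P: "(\<Psi> has_real_derivative exp (V (\<Psi> p))) (at p)"
    using Psi_deriv[OF p] by (simp add: exp_minus)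
  have V: "((\<lambda>p. V (\<Psi> p)) has_real_derivative \<Psi> p * exp (V (\<Psi> p))) (at p)"
    using DERIV_chain2[OF V_deriv_id P] .
  show E: "((\<lambda>p. exp (V (\<Psi> p))) has_real_derivative \<Psi> p * exp (V (\<Psi> p))^2) (at p)"
    using DERIV_chain2[OF DERIV_exp V] by (simp add: power2_eq_square ac_simps)
  show "((\<lambda>p. \<Psi> p * exp (V (\<Psi> p))^2) has_real_derivative (1 + 2 * (\<Psi> p)\<^sup>2) * exp (V (\<Psi> p))^3) (at p)"
    using DERIV_mult[OF P DERIV_power[OF E, of 2]] by (simp add: power2_eq_square power3_eq_cube algebra_simps)
qed

lemma Psi_taylor:
  assumes \<epsilon>: "0 < \<epsilon>"
  obtains C where "C \<ge> 1"
    "\<And>p. p \<in> {\<epsilon>..1 - \<epsilon>} \<Longrightarrow> \<bar>\<Psi> p\<bar> \<le> C \<and> \<bar>exp (V (\<Psi> p))\<bar> \<le> C \<and> \<bar>\<Psi> p * exp (V (\<Psi> p))^2\<bar> \<le> C"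
    "\<And>p q. p \<in> {\<epsilon>..1 - \<epsilon>} \<Longrightarrow> q \<in> {\<epsilon>..1 - \<epsilon>} \<Longrightarrow>
      \<bar>(\<Psi> q - \<Psi> p) - exp (V (\<Psi> p)) * (q - p) - \<Psi> p * exp (V (\<Psi> p))^2 * (q - p)\<^sup>2 / 2\<bar> \<le> C * \<bar>q - p\<bar>^3"
proof -
  let ?I = "{\<epsilon>..1 - \<epsilon>}"
  let ?d3 = "\<lambda>p. (1 + 2 * (\<Psi> p)\<^sup>2) * exp (V (\<Psi> p))^3"
  have cP: "continuous_on ?I \<Psi>" by (rule continuous_on_subset[OF Psi_cont]) (use \<epsilon> in auto)
  have cE: "continuous_on ?I (\<lambda>p. exp (V (\<Psi> p)))"
    by (intro continuous_intros continuous_on_compose2[OF V_cont[of UNIV] cP]) auto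
  have bd: "\<exists>B. \<forall>p\<in>?I. \<bar>g p\<bar> \<le> B" if "continuous_on ?I g" for g :: "real \<Rightarrow> real"
    using compact_imp_bounded[OF compact_continuous_image[OF that compact_Icc]] by (auto simp: bounded_iff)
  obtain B0 where B0: "\<forall>p\<in>?I. \<bar>\<Psi> p\<bar> \<le> B0" using bd[OF cP] by blast
  obtain B1 where B1: "\<forall>p\<in>?I. \<bar>exp (V (\<Psi> p))\<bar> \<le> B1" using bd[OF cE] by blast
  obtain B2 where B2: "\<forall>p\<in>?I. \<bar>\<Psi> p * exp (V (\<Psi> p))^2\<bar> \<le> B2"
    using bd[OF continuous_on_mult[OF cP continuous_on_power[OF cE]]] by blast
  have "continuous_on ?I ?d3" by (intro continuous_intros cP cE)
  from bd[OF this] obtain B3 where B3: "\<forall>p\<in>?I. \<bar>?d3 p\<bar> \<le> B3" by blast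
  define C where "C = max 1 (max (max B0 B1) (max B2 B3))"
  show ?thesis
  proof
    show "C \<ge> 1" by (simp add: C_def)
    show "\<bar>\<Psi> p\<bar> \<le> C \<and> \<bar>exp (V (\<Psi> p))\<bar> \<le> C \<and> \<bar>\<Psi> p * exp (V (\<Psi> p))^2\<bar> \<le> C" if "p \<in> ?I" for p
      using B0 B1 B2 that unfolding C_def by (meson le_max_iff_disj)
    show "\<bar>(\<Psi> q - \<Psi> p) - exp (V (\<Psi> p)) * (q - p) - \<Psi> p * exp (V (\<Psi> p))^2 * (q - p)\<^sup>2 / 2\<bar> \<le> C * \<bar>q - p\<bar>^3"
      if pq: "p \<in> ?I" "q \<in> ?I" for p q
    proof (cases "p = q")
      case False
      define diff where "diff = (\<lambda>m::nat. if m = 0 then \<Psi> else if m = 1 then (\<lambda>p. exp (V (\<Psi> p)))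
          else if m = 2 then (\<lambda>p. \<Psi> p * exp (V (\<Psi> p))^2) else ?d3)"
      have "\<exists>t. (if q < p then q < t \<and> t < p else p < t \<and> t < q) \<and>
          \<Psi> q = (\<Sum>m<3. (diff m p / fact m) * (q - p)^m) + (diff 3 t / fact 3) * (q - p)^3"
      proof (rule Taylor)
        show "\<forall>m t. m < 3 \<and> \<epsilon> \<le> t \<and> t \<le> 1 - \<epsilon> \<longrightarrow> (diff m has_real_derivative diff (Suc m) t) (at t)"
        proof (intro allI impI)
          fix m :: nat and t assume *: "m < 3 \<and> \<epsilon> \<le> t \<and> t \<le> 1 - \<epsilon>"
          then have m: "m = 0 \<or> m = 1 \<or> m = 2" by auto
          have t: "0 < t" "t < 1" using * \<epsilon> by auto
          show "(diff m has_real_derivative diff (Suc m) t) (at t)"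
            using m Psi_derivs[OF t] by (auto simp: diff_def)
        qed
      qed (use False pq in \<open>auto simp: diff_def\<close>)
      then obtain t where t: "if q < p then q < t \<and> t < p else p < t \<and> t < q"
        "\<Psi> q = (\<Sum>m<3. (diff m p / fact m) * (q - p)^m) + (diff 3 t / fact 3) * (q - p)^3" by blast
      have tI: "t \<in> ?I" using t(1) pq by (auto split: if_splits)
      have eq: "(\<Psi> q - \<Psi> p) - exp (V (\<Psi> p)) * (q - p) - \<Psi> p * exp (V (\<Psi> p))^2 * (q - p)\<^sup>2 / 2 = ?d3 t / 6 * (q - p)^3"
        using t(2) by (simp add: diff_def eval_nat_numeral)
      have le: "\<bar>?d3 t / 6\<bar> \<le> C"
      proof -
        have "\<bar>?d3 t\<bar> \<le> C" using B3 tI unfolding C_def by (meson le_max_iff_disj)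
        then show ?thesis by linarith
      qed
      show ?thesis unfolding eq
        using mult_right_mono[OF le, of "\<bar>q - p\<bar>^3"] by (simp only: abs_mult[of "?d3 t / 6"] power_abs) simp
    qed simp
  qed
qed

end

section \<open>The maximum principle\<close>

text \<open>The second-order conditions at a point where \<open>S x y = u (a x + b y) - a v x - b w y\<close> is close
  to a lower bound \<open>m\<close> of \<open>S\<close>: comparing with the points at distance of order \<open>\<theta>\<close> shows that the gradient of
  \<open>S\<close> is of order \<open>\<theta>\<close> and that its second derivatives are bounded below by a multiple of \<open>- \<theta>\<close>.
  The two directions \<open>(1, \<rho>)\<close> and \<open>(0, sqrt (1 - \<rho>\<^sup>2))\<close> are chosen such that the second derivatives of
  \<open>u\<close>, \<open>v\<close> and \<open>w\<close> all enter with the same weight; for \<open>u\<close> this is the equation for \<open>\<rho>\<close>.\<close>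

lemma near_minimum:
  fixes u v w :: "real \<Rightarrow> real" and a b C B \<theta> \<rho> x y z m u1 u2 v1 v2 w1 w2 :: real
  assumes ab: "a > 0" "b > 0" and \<rho>: "\<bar>\<rho>\<bar> \<le> 1" "a\<^sup>2 + b\<^sup>2 + 2 * a * b * \<rho> = 1"
    and \<theta>: "0 < \<theta>" "\<theta> \<le> 1" "\<theta> * (a + b) \<le> 1" and CB: "C \<ge> 0" "B \<ge> 0" and z: "z = a * x + b * y"
    and u: "\<And>h. \<bar>h\<bar> \<le> 1 \<Longrightarrow> \<bar>u (z + h) - u z - u1 * h - u2 * h\<^sup>2 / 2\<bar> \<le> C * \<bar>h\<bar>^3"
    and v: "\<And>h. \<bar>h\<bar> \<le> 1 \<Longrightarrow> \<bar>v (x + h) - v x - v1 * h - v2 * h\<^sup>2 / 2\<bar> \<le> C * \<bar>h\<bar>^3"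
    and w: "\<And>h. \<bar>h\<bar> \<le> 1 \<Longrightarrow> \<bar>w (y + h) - w y - w1 * h - w2 * h\<^sup>2 / 2\<bar> \<le> C * \<bar>h\<bar>^3"
    and bd2: "\<bar>u2\<bar> \<le> C" "\<bar>v2\<bar> \<le> C" "\<bar>w2\<bar> \<le> C"
    and min: "\<And>x y. m \<le> u (a * x + b * y) - a * v x - b * w y"
    and near: "u z - a * v x - b * w y \<le> m + B * \<theta>^4"
  defines "E \<equiv> C * ((a + b)^3 + a + b)"
  defines "D \<equiv> C * ((a + b)\<^sup>2 + a + b) / 2 + E + B"
  shows "a * \<bar>u1 - v1\<bar> \<le> D * \<theta>" "b * \<bar>u1 - w1\<bar> \<le> D * \<theta>"
    "- (4 * (E + B)) * \<theta> \<le> u2 - a * v2 - b * w2"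
proof -
  define G where "G d1 d2 = u1 * (a * d1 + b * d2) - a * v1 * d1 - b * w1 * d2" for d1 d2
  define Q where "Q d1 d2 = u2 * (a * d1 + b * d2)\<^sup>2 - a * v2 * d1\<^sup>2 - b * w2 * d2\<^sup>2" for d1 d2
  have dir: "0 \<le> G d1 d2 * \<theta> + Q d1 d2 * \<theta>\<^sup>2 / 2 + E * \<theta>^3 + B * \<theta>^4"
    if d: "\<bar>d1\<bar> \<le> 1" "\<bar>d2\<bar> \<le> 1" for d1 d2
  proof -
    define \<delta> where "\<delta> = a * d1 + b * d2"
    have "\<bar>\<delta>\<bar> \<le> \<bar>a * d1\<bar> + \<bar>b * d2\<bar>" unfolding \<delta>_def by (rule abs_triangle_ineq)
    also have "\<dots> \<le> a * 1 + b * 1" unfolding abs_mult using ab d by (intro add_mono mult_mono) auto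
    finally have \<delta>: "\<bar>\<delta>\<bar> \<le> a + b" by simp
    have t\<delta>: "\<bar>\<theta> * \<delta>\<bar> \<le> \<theta> * (a + b)" using \<delta> \<theta> by (simp add: abs_mult)
    have t1: "\<bar>\<theta> * d1\<bar> \<le> \<theta>" and t2: "\<bar>\<theta> * d2\<bar> \<le> \<theta>"
      using d \<theta> by (simp_all add: abs_mult mult_left_le)
    have U: "u (z + \<theta> * \<delta>) \<le> u z + u1 * (\<theta> * \<delta>) + u2 * (\<theta> * \<delta>)\<^sup>2 / 2 + C * (\<theta>^3 * (a + b)^3)"
    proof -
      have "C * \<bar>\<theta> * \<delta>\<bar>^3 \<le> C * (\<theta> * (a + b))^3" by (intro mult_left_mono power_mono t\<delta> CB) simp
      then show ?thesis using u[of "\<theta> * \<delta>"] t\<delta> \<theta>(3) by (simp add: power_mult_distrib)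
    qed
    have W1: "v x + v1 * (\<theta> * d1) + v2 * (\<theta> * d1)\<^sup>2 / 2 - C * \<theta>^3 \<le> v (x + \<theta> * d1)"
    proof -
      have "C * \<bar>\<theta> * d1\<bar>^3 \<le> C * \<theta>^3" by (intro mult_left_mono power_mono t1 CB) simp
      then show ?thesis using v[of "\<theta> * d1"] t1 \<theta>(2) by simp
    qed
    have W2: "w y + w1 * (\<theta> * d2) + w2 * (\<theta> * d2)\<^sup>2 / 2 - C * \<theta>^3 \<le> w (y + \<theta> * d2)"
    proof -
      have "C * \<bar>\<theta> * d2\<bar>^3 \<le> C * \<theta>^3" by (intro mult_left_mono power_mono t2 CB) simp
      then show ?thesis using w[of "\<theta> * d2"] t2 \<theta>(2) by simp
    qed
    have "a * (x + \<theta> * d1) + b * (y + \<theta> * d2) = z + \<theta> * \<delta>"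
      by (simp add: z \<delta>_def algebra_simps)
    with min[of "x + \<theta> * d1" "y + \<theta> * d2"]
    have "m \<le> u (z + \<theta> * \<delta>) - a * v (x + \<theta> * d1) - b * w (y + \<theta> * d2)" by simp
    also have "\<dots> \<le> (u z + u1 * (\<theta> * \<delta>) + u2 * (\<theta> * \<delta>)\<^sup>2 / 2 + C * (\<theta>^3 * (a + b)^3))
        - a * (v x + v1 * (\<theta> * d1) + v2 * (\<theta> * d1)\<^sup>2 / 2 - C * \<theta>^3)
        - b * (w y + w1 * (\<theta> * d2) + w2 * (\<theta> * d2)\<^sup>2 / 2 - C * \<theta>^3)"
      using ab by (intro diff_mono mult_left_mono U W1 W2) auto
    also have "\<dots> = (u z - a * v x - b * w y) + G d1 d2 * \<theta> + Q d1 d2 * \<theta>\<^sup>2 / 2 + E * \<theta>^3"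
      unfolding G_def Q_def E_def \<delta>_def[symmetric] by (simp add: power_mult_distrib field_simps)
    finally show ?thesis using near by linarith
  qed
  have E0: "E \<ge> 0" using ab CB by (simp add: E_def)
  have Gm: "G (- d1) (- d2) = - G d1 d2" and Qm: "Q (- d1) (- d2) = Q d1 d2" for d1 d2
    by (simp_all add: G_def Q_def power2_eq_square algebra_simps)
  have hess: "- (2 * (E + B)) * \<theta> \<le> Q d1 d2" if d: "\<bar>d1\<bar> \<le> 1" "\<bar>d2\<bar> \<le> 1" for d1 d2
  proof -
    have "0 \<le> Q d1 d2 * \<theta>\<^sup>2 + 2 * E * \<theta>^3 + 2 * B * \<theta>^4"
      using dir[OF d] dir[of "- d1" "- d2"] d by (simp add: Gm Qm)
    also have "\<dots> \<le> Q d1 d2 * \<theta>\<^sup>2 + 2 * E * \<theta>^3 + 2 * B * \<theta>^3"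
      using power_decreasing[of 3 4 \<theta>] \<theta> CB by (simp add: mult_left_mono)
    also have "\<dots> = \<theta>\<^sup>2 * (Q d1 d2 + 2 * (E + B) * \<theta>)" by (simp add: power2_eq_square power3_eq_cube algebra_simps)
    finally have "0 \<le> Q d1 d2 + 2 * (E + B) * \<theta>" using \<theta> by (simp add: zero_le_mult_iff)
    then show ?thesis by (simp add: algebra_simps)
  qed
  have grad: "\<bar>G d1 d2\<bar> \<le> D * \<theta>" if d: "\<bar>d1\<bar> \<le> 1" "\<bar>d2\<bar> \<le> 1" and s: "\<bar>a * d1 + b * d2\<bar> \<le> a + b" for d1 d2
  proof -
    have "\<bar>Q d1 d2\<bar> \<le> \<bar>u2\<bar> * (a * d1 + b * d2)\<^sup>2 + a * \<bar>v2\<bar> * d1\<^sup>2 + b * \<bar>w2\<bar> * d2\<^sup>2"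
    proof -
      have "\<bar>u2 * (a * d1 + b * d2)\<^sup>2\<bar> = \<bar>u2\<bar> * (a * d1 + b * d2)\<^sup>2" "\<bar>a * v2 * d1\<^sup>2\<bar> = a * \<bar>v2\<bar> * d1\<^sup>2"
        "\<bar>b * w2 * d2\<^sup>2\<bar> = b * \<bar>w2\<bar> * d2\<^sup>2" using ab by (simp_all add: abs_mult)
      then show ?thesis unfolding Q_def by linarith
    qed
    also have "\<dots> \<le> C * (a + b)\<^sup>2 + a * C * 1 + b * C * 1"
    proof (intro add_mono mult_mono)
      show "(a * d1 + b * d2)\<^sup>2 \<le> (a + b)\<^sup>2" using s by (metis abs_ge_zero power2_abs power_mono)
      show "d1\<^sup>2 \<le> 1" "d2\<^sup>2 \<le> 1" using d by (simp_all add: abs_square_le_1)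
    qed (use bd2 ab CB in auto)
    finally have Q: "\<bar>Q d1 d2\<bar> \<le> C * ((a + b)\<^sup>2 + a + b)" by (simp add: algebra_simps)
    have "\<bar>G d1 d2\<bar> * \<theta> = \<bar>G d1 d2 * \<theta>\<bar>" using \<theta> by (simp add: abs_mult)
    also have "\<dots> \<le> Q d1 d2 * \<theta>\<^sup>2 / 2 + E * \<theta>^3 + B * \<theta>^4"
      using dir[OF d] dir[of "- d1" "- d2"] d by (simp add: Gm Qm abs_le_iff)
    also have "\<dots> \<le> (C * ((a + b)\<^sup>2 + a + b)) * \<theta>\<^sup>2 / 2 + E * \<theta>\<^sup>2 + B * \<theta>\<^sup>2"
    proof (intro add_mono)
      have "Q d1 d2 \<le> C * ((a + b)\<^sup>2 + a + b)" using Q by linarith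
      then show "Q d1 d2 * \<theta>\<^sup>2 / 2 \<le> (C * ((a + b)\<^sup>2 + a + b)) * \<theta>\<^sup>2 / 2" by (simp add: mult_right_mono)
      show "E * \<theta>^3 \<le> E * \<theta>\<^sup>2" "B * \<theta>^4 \<le> B * \<theta>\<^sup>2"
        using power_decreasing[of 2 3 \<theta>] power_decreasing[of 2 4 \<theta>] \<theta> E0 CB by (simp_all add: mult_left_mono)
    qed
    also have "\<dots> = (D * \<theta>) * \<theta>" by (simp add: D_def power2_eq_square field_simps)
    finally show ?thesis using \<theta> by (simp only: mult_le_cancel_right_pos)
  qed
  have "G 1 0 = a * (u1 - v1)" "G 0 1 = b * (u1 - w1)" by (simp_all add: G_def algebra_simps)
  then have G: "a * \<bar>u1 - v1\<bar> = \<bar>G 1 0\<bar>" "b * \<bar>u1 - w1\<bar> = \<bar>G 0 1\<bar>" using ab by (simp_all add: abs_mult)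
  show "a * \<bar>u1 - v1\<bar> \<le> D * \<theta>" "b * \<bar>u1 - w1\<bar> \<le> D * \<theta>"
    unfolding G by (rule grad; use ab in simp)+
  define \<sigma> where "\<sigma> = sqrt (1 - \<rho>\<^sup>2)"
  have r1: "\<rho>\<^sup>2 \<le> 1" using \<rho> by (simp add: abs_square_le_1)
  then have \<sigma>2: "\<sigma>\<^sup>2 = 1 - \<rho>\<^sup>2" and \<sigma>1: "\<bar>\<sigma>\<bar> \<le> 1" by (simp_all add: \<sigma>_def)
  have "Q 1 \<rho> + Q 0 \<sigma> = u2 * (a\<^sup>2 + 2 * a * b * \<rho> + b\<^sup>2 * (\<rho>\<^sup>2 + \<sigma>\<^sup>2)) - a * v2 - b * w2 * (\<rho>\<^sup>2 + \<sigma>\<^sup>2)"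
    by (simp add: Q_def power2_eq_square algebra_simps)
  also have "\<dots> = u2 * (a\<^sup>2 + b\<^sup>2 + 2 * a * b * \<rho>) - a * v2 - b * w2" by (simp add: \<sigma>2 algebra_simps)
  finally have "Q 1 \<rho> + Q 0 \<sigma> = u2 - a * v2 - b * w2" by (simp add: \<rho>(2))
  moreover have "- (2 * (E + B)) * \<theta> \<le> Q 1 \<rho>" "- (2 * (E + B)) * \<theta> \<le> Q 0 \<sigma>"
    using hess[of 1 \<rho>] hess[of 0 \<sigma>] \<rho>(1) \<sigma>1 by simp_all
  moreover have "- (4 * (E + B)) * \<theta> = - (2 * (E + B)) * \<theta> + - (2 * (E + B)) * \<theta>" by (simp add: algebra_simps)
  ultimately show "- (4 * (E + B)) * \<theta> \<le> u2 - a * v2 - b * w2" by linarith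
qed

text \<open>For \<open>v = \<Psi> \<circ> f\<close> the heat equation for \<open>f\<close> becomes \<open>v\<^sub>t = (v'' - v v'\<^sup>2) / 2\<close>. The resulting drift of
  \<open>S\<close> is bounded from below near a lower bound \<open>m\<close> of \<open>S\<close>: there all gradients nearly agree, so that the nonlinear
  terms combine to \<open>- S u'\<^sup>2\<close>, and \<open>S\<close> is almost nonpositive.\<close>

lemma drift_bound:
  fixes a b C B D F \<theta> m u u1 u2 v v1 v2 w w1 w2 :: real
  assumes ab: "a > 0" "b > 0" and \<theta>: "0 < \<theta>" "\<theta> \<le> 1" and CB: "C \<ge> 0" "B \<ge> 0"
    and bd: "\<bar>u1\<bar> \<le> C" "\<bar>v\<bar> \<le> C" "\<bar>v1\<bar> \<le> C" "\<bar>w\<bar> \<le> C" "\<bar>w1\<bar> \<le> C"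
    and grad: "a * \<bar>u1 - v1\<bar> \<le> D * \<theta>" "b * \<bar>u1 - w1\<bar> \<le> D * \<theta>"
    and hess: "- F * \<theta> \<le> u2 - a * v2 - b * w2"
    and s: "u - a * v - b * w \<le> m + B * \<theta>^4" "m \<le> 0"
  shows "- (F + 4 * C\<^sup>2 * D + B * C\<^sup>2) * \<theta> \<le> (u2 - u * u1\<^sup>2) - a * (v2 - v * v1\<^sup>2) - b * (w2 - w * w1\<^sup>2)"
proof -
  have err: "\<bar>c * q * r\<^sup>2 - c * q * u1\<^sup>2\<bar> \<le> 2 * C\<^sup>2 * (D * \<theta>)"
    if "c > 0" "\<bar>q\<bar> \<le> C" "\<bar>r\<bar> \<le> C" "c * \<bar>u1 - r\<bar> \<le> D * \<theta>" for c q r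
  proof -
    have "\<bar>c * q * r\<^sup>2 - c * q * u1\<^sup>2\<bar> = \<bar>q\<bar> * (c * \<bar>u1 - r\<bar>) * \<bar>u1 + r\<bar>"
    proof -
      have "c * q * r\<^sup>2 - c * q * u1\<^sup>2 = q * (c * (r - u1)) * (u1 + r)" by (simp add: power2_eq_square algebra_simps)
      then show ?thesis using that(1) by (simp only: abs_mult) (simp add: abs_minus_commute)
    qed
    also have "\<dots> \<le> C * (D * \<theta>) * (2 * C)"
    proof -
      have n: "0 \<le> c * \<bar>u1 - r\<bar>" using that(1) by simp
      then have "0 \<le> D * \<theta>" using that(4) by linarith
      then have "0 \<le> C * (D * \<theta>)" using CB(1) by (rule mult_nonneg_nonneg[rotated])
      moreover have "\<bar>u1 + r\<bar> \<le> 2 * C" using bd(1) that(3) by linarith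
      ultimately show ?thesis
        by (intro mult_mono[OF mult_mono[OF that(2,4) CB(1) n]]) simp_all
    qed
    finally show ?thesis by (simp add: power2_eq_square algebra_simps)
  qed
  have su: "(u - a * v - b * w) * u1\<^sup>2 \<le> (B * \<theta>) * C\<^sup>2"
  proof -
    have "B * \<theta>^4 \<le> B * \<theta>" using power_decreasing[of 1 4 \<theta>] \<theta> CB by (simp add: mult_left_mono)
    then have "u - a * v - b * w \<le> B * \<theta>" using s by linarith
    then have "(u - a * v - b * w) * u1\<^sup>2 \<le> (B * \<theta>) * u1\<^sup>2" by (rule mult_right_mono) simp
    also have "\<dots> \<le> (B * \<theta>) * C\<^sup>2"
      using bd(1) CB \<theta> by (intro mult_left_mono) (auto simp: abs_le_square_iff[symmetric])
    finally show ?thesis .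
  qed
  have "(u2 - u * u1\<^sup>2) - a * (v2 - v * v1\<^sup>2) - b * (w2 - w * w1\<^sup>2)
      = (u2 - a * v2 - b * w2) - (u - a * v - b * w) * u1\<^sup>2
        + (a * v * v1\<^sup>2 - a * v * u1\<^sup>2) + (b * w * w1\<^sup>2 - b * w * u1\<^sup>2)"
    by (simp add: algebra_simps)
  moreover have "- (F + 4 * C\<^sup>2 * D + B * C\<^sup>2) * \<theta> = - F * \<theta> - (B * \<theta>) * C\<^sup>2 - 2 * C\<^sup>2 * (D * \<theta>) - 2 * C\<^sup>2 * (D * \<theta>)"
    by (simp add: algebra_simps)
  ultimately show ?thesis
    using err[OF ab(1) bd(2,3) grad(1)] err[OF ab(2) bd(4,5) grad(2)] su hess by linarith
qed

context gaussian
begin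

text \<open>The last clause says that for \<open>v = \<Psi> \<circ> f\<close> the heat flow has the generator
  \<open>(v'' - v v'\<^sup>2) / 2\<close>, up to an error that is of higher order than the variance of the step.\<close>

definition expands :: "real \<Rightarrow> (real \<Rightarrow> real) \<Rightarrow> (real \<Rightarrow> real) \<Rightarrow> (real \<Rightarrow> real) \<Rightarrow> bool" where
  "expands C f v1 v2 \<longleftrightarrow> (\<forall>x. \<bar>\<Psi> (f x)\<bar> \<le> C \<and> \<bar>v1 x\<bar> \<le> C \<and> \<bar>v2 x\<bar> \<le> C \<and>
     (\<forall>h. \<bar>h\<bar> \<le> 1 \<longrightarrow> \<bar>\<Psi> (f (x + h)) - \<Psi> (f x) - v1 x * h - v2 x * h\<^sup>2 / 2\<bar> \<le> C * \<bar>h\<bar>^3) \<and>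
     (\<forall>\<eta>. 0 \<le> \<eta> \<longrightarrow> \<eta> \<le> 1 \<longrightarrow>
        \<bar>\<Psi> (heat \<eta> f x) - \<Psi> (f x) - (v2 x - \<Psi> (f x) * (v1 x)\<^sup>2) * \<eta>\<^sup>2 / 2\<bar> \<le> C * \<eta>^3))"

lemma Psi_expansion:
  assumes \<epsilon>: "\<epsilon> > 0" and K: "K \<ge> 0"
  obtains C where "C \<ge> 1"
    "\<And>f f1 f2. taylor3 K f f1 f2 \<Longrightarrow> (\<And>x. f x \<in> {\<epsilon>..1 - \<epsilon>}) \<Longrightarrow> \<exists>v1 v2. expands C f v1 v2"
proof -
  obtain C where C: "C \<ge> 1"
    and Cb: "\<And>p. p \<in> {\<epsilon>..1 - \<epsilon>} \<Longrightarrow> \<bar>\<Psi> p\<bar> \<le> C \<and> \<bar>exp (V (\<Psi> p))\<bar> \<le> C \<and> \<bar>\<Psi> p * exp (V (\<Psi> p))^2\<bar> \<le> C"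
    and Ct: "\<And>p q. p \<in> {\<epsilon>..1 - \<epsilon>} \<Longrightarrow> q \<in> {\<epsilon>..1 - \<epsilon>} \<Longrightarrow>
      \<bar>(\<Psi> q - \<Psi> p) - exp (V (\<Psi> p)) * (q - p) - \<Psi> p * exp (V (\<Psi> p))^2 * (q - p)\<^sup>2 / 2\<bar> \<le> C * \<bar>q - p\<bar>^3"
    using Psi_taylor[OF \<epsilon>] by metis
  define L where "L k = 27 * C * k^3 + C * k + 5 * C * k\<^sup>2" for k
  define k where "k = K * (1 + third_moment)"
  have Kk: "K \<le> k" "K * third_moment \<le> k" "0 \<le> k" using K third_moment_nonneg by (simp_all add: k_def algebra_simps)
  define M where "M = max (max C (C * K)) (max (C * K + C * K\<^sup>2) (max (L K) (L k)))"
  show ?thesis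
  proof (rule that[of M])
    show "M \<ge> 1" using C by (simp add: M_def)
    fix f f1 f2 assume f: "taylor3 K f f1 f2" and r: "\<And>x. f x \<in> {\<epsilon>..1 - \<epsilon>}"
    have [measurable]: "f \<in> borel_measurable borel"
      and f12: "\<And>x. \<bar>f1 x\<bar> \<le> K" "\<And>x. \<bar>f2 x\<bar> \<le> K"
      and exp: "\<And>x h. \<bar>f (x + h) - f x - f1 x * h - f2 x * h\<^sup>2 / 2\<bar> \<le> K * \<bar>h\<bar>^3"
      using f unfolding taylor3_def by blast+
    define A where "A x = exp (V (\<Psi> (f x)))" for x
    define B where "B x = \<Psi> (f x) * exp (V (\<Psi> (f x)))^2" for x
    have AB: "\<bar>A x\<bar> \<le> C" "\<bar>B x\<bar> \<le> C" for x using Cb[OF r] unfolding A_def B_def by blast+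
    let ?v1 = "\<lambda>x. A x * f1 x" and ?v2 = "\<lambda>x. A x * f2 x + B x * (f1 x)\<^sup>2"
    have "expands M f ?v1 ?v2"
      unfolding expands_def
    proof (intro allI conjI impI)
      fix x
      show "\<bar>\<Psi> (f x)\<bar> \<le> M" using Cb[OF r, of x] by (simp add: M_def le_max_iff_disj)
      have "\<bar>A x\<bar> * \<bar>f1 x\<bar> \<le> C * K" using AB f12 C K by (intro mult_mono) auto
      then show "\<bar>A x * f1 x\<bar> \<le> M" by (simp add: M_def abs_mult)
      have "\<bar>A x * f2 x + B x * (f1 x)\<^sup>2\<bar> \<le> \<bar>A x\<bar> * \<bar>f2 x\<bar> + \<bar>B x\<bar> * (f1 x)\<^sup>2"
        using abs_triangle_ineq[of "A x * f2 x" "B x * (f1 x)\<^sup>2"] by (simp add: abs_mult)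
      also have "\<dots> \<le> C * K + C * K\<^sup>2"
      proof (intro add_mono mult_mono)
        show "(f1 x)\<^sup>2 \<le> K\<^sup>2" using f12(1)[of x] K by (simp add: abs_le_square_iff[symmetric])
      qed (use AB f12 C K in auto)
      finally show "\<bar>A x * f2 x + B x * (f1 x)\<^sup>2\<bar> \<le> M" by (simp add: M_def)
    next
      fix x h :: real assume h: "\<bar>h\<bar> \<le> 1"
      have "\<bar>(\<Psi> (f (x + h)) - \<Psi> (f x)) - A x * f1 x * h - (A x * f2 x + B x * (f1 x)\<^sup>2) * h\<^sup>2 / 2\<bar> \<le> L K * \<bar>h\<bar>^3"
        unfolding L_def
        by (rule taylor_compose[OF AB _ exp f12 h K])
          (use Ct[OF r r, of "x + h" x] C in \<open>auto simp: A_def B_def\<close>)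
      also have "\<dots> \<le> M * \<bar>h\<bar>^3" by (intro mult_right_mono) (auto simp: M_def)
      finally show "\<bar>\<Psi> (f (x + h)) - \<Psi> (f x) - A x * f1 x * h - (A x * f2 x + B x * (f1 x)\<^sup>2) * h\<^sup>2 / 2\<bar> \<le> M * \<bar>h\<bar>^3" .
    next
      fix x \<eta> :: real assume \<eta>: "0 \<le> \<eta>" "\<eta> \<le> 1"
      have hr: "heat \<eta> f x \<in> {\<epsilon>..1 - \<epsilon>}" by (rule heat_range) (use r in auto)
      \<comment> \<open>Averaging kills the linear term, so the chain rule is applied with \<open>f1 = 0\<close>.\<close>
      have "\<bar>(\<Psi> (heat \<eta> f x) - \<Psi> (f x)) - (A x * 0) * \<eta> - (A x * f2 x + B x * 0\<^sup>2) * \<eta>\<^sup>2 / 2\<bar> \<le> L k * \<bar>\<eta>\<bar>^3"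
        unfolding L_def
      proof (rule taylor_compose[OF AB, where \<Delta> = "heat \<eta> f x - f x"])
        have "K * third_moment * \<eta>^3 \<le> k * \<eta>^3" using Kk \<eta> by (intro mult_right_mono) auto
        then show "\<bar>heat \<eta> f x - f x - 0 * \<eta> - f2 x * \<eta>\<^sup>2 / 2\<bar> \<le> k * \<bar>\<eta>\<bar>^3"
          using heat_expand[OF f r \<eta>(1), of x] \<eta> by simp
        show "\<bar>f2 x\<bar> \<le> k" using f12(2)[of x] Kk by linarith
        show "\<bar>(\<Psi> (heat \<eta> f x) - \<Psi> (f x)) - A x * (heat \<eta> f x - f x) - B x * (heat \<eta> f x - f x)\<^sup>2 / 2\<bar> \<le> C * \<bar>heat \<eta> f x - f x\<bar>^3"
          using Ct[OF r hr] by (simp add: A_def B_def)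
      qed (use Kk \<eta> C in auto)
      also have "\<dots> \<le> M * \<bar>\<eta>\<bar>^3" by (intro mult_right_mono) (auto simp: M_def)
      also have "A x * f2 x + B x * 0\<^sup>2 = (A x * f2 x + B x * (f1 x)\<^sup>2) - \<Psi> (f x) * (A x * f1 x)\<^sup>2"
        by (simp add: A_def B_def power_mult_distrib)
      finally show "\<bar>\<Psi> (heat \<eta> f x) - \<Psi> (f x) - ((A x * f2 x + B x * (f1 x)\<^sup>2) - \<Psi> (f x) * (A x * f1 x)\<^sup>2) * \<eta>\<^sup>2 / 2\<bar> \<le> M * \<eta>^3"
        using \<eta> by simp
    qed
    then show "\<exists>v1 v2. expands M f v1 v2" by blast
  qed
qed

text \<open>One step of the heat semigroup with variance \<open>\<theta>\<^sup>4\<close> decreases a nonpositive lower bound of \<open>S\<close> by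
  at most a multiple of \<open>\<theta>\<^sup>5\<close>. Where \<open>S\<close> exceeds its lower bound by a large multiple of \<open>\<theta>\<^sup>4\<close> the bounded
  drift cannot do any harm, elsewhere the second-order conditions apply.\<close>

lemma heat_step:
  assumes ab: "a > 0" "b > 0" and cond: "\<bar>1 - a\<^sup>2 - b\<^sup>2\<bar> \<le> 2 * a * b" and \<epsilon>: "\<epsilon> > 0" and K: "K \<ge> 0"
  obtains D where "D \<ge> 0"
    "\<And>f f1 f2 g g1 g2 h h1 h2 \<theta> m x y.
       taylor3 K f f1 f2 \<Longrightarrow> taylor3 K g g1 g2 \<Longrightarrow> taylor3 K h h1 h2 \<Longrightarrow>
       (\<And>x. f x \<in> {\<epsilon>..1 - \<epsilon>}) \<Longrightarrow> (\<And>x. g x \<in> {\<epsilon>..1 - \<epsilon>}) \<Longrightarrow> (\<And>x. h x \<in> {\<epsilon>..1 - \<epsilon>}) \<Longrightarrow>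
       0 < \<theta> \<Longrightarrow> \<theta> \<le> 1 \<Longrightarrow> \<theta> * (a + b) \<le> 1 \<Longrightarrow> m \<le> 0 \<Longrightarrow>
       (\<And>x y. m \<le> \<Psi> (h (a * x + b * y)) - a * \<Psi> (f x) - b * \<Psi> (g y)) \<Longrightarrow>
       m - D * \<theta>^5 \<le> \<Psi> (heat (\<theta>\<^sup>2) h (a * x + b * y)) - a * \<Psi> (heat (\<theta>\<^sup>2) f x) - b * \<Psi> (heat (\<theta>\<^sup>2) g y)"
proof -
  obtain C where C: "C \<ge> 1"
    and Cex: "\<And>f f1 f2. taylor3 K f f1 f2 \<Longrightarrow> (\<And>x. f x \<in> {\<epsilon>..1 - \<epsilon>}) \<Longrightarrow> \<exists>v1 v2. expands C f v1 v2"
    using Psi_expansion[OF \<epsilon> K] by blast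
  define \<rho> where "\<rho> = (1 - a\<^sup>2 - b\<^sup>2) / (2 * a * b)"
  have \<rho>: "\<bar>\<rho>\<bar> \<le> 1" "a\<^sup>2 + b\<^sup>2 + 2 * a * b * \<rho> = 1"
    using cond ab by (simp_all add: \<rho>_def abs_divide abs_mult)
  define B where "B = (1 + a + b) * (C + C^3)"
  define E where "E = C * ((a + b)^3 + a + b)"
  define D0 where "D0 = C * ((a + b)\<^sup>2 + a + b) / 2 + E + B"
  define F where "F = 4 * (E + B) + 4 * C\<^sup>2 * D0 + B * C\<^sup>2"
  have pos: "B \<ge> 0" "E \<ge> 0" "D0 \<ge> 0" "F \<ge> 0" using ab C by (simp_all add: B_def E_def D0_def F_def)
  show ?thesis
  proof (rule that[of "F + C * (1 + a + b)"])
    show "F + C * (1 + a + b) \<ge> 0" using pos ab C by simp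
    fix f f1 f2 g g1 g2 h h1 h2 :: "real \<Rightarrow> real" and \<theta> m x y :: real
    assume t: "taylor3 K f f1 f2" "taylor3 K g g1 g2" "taylor3 K h h1 h2"
      and r: "\<And>x. f x \<in> {\<epsilon>..1 - \<epsilon>}" "\<And>x. g x \<in> {\<epsilon>..1 - \<epsilon>}" "\<And>x. h x \<in> {\<epsilon>..1 - \<epsilon>}"
      and \<theta>: "0 < \<theta>" "\<theta> \<le> 1" "\<theta> * (a + b) \<le> 1" and m: "m \<le> 0"
      and min: "\<And>x y. m \<le> \<Psi> (h (a * x + b * y)) - a * \<Psi> (f x) - b * \<Psi> (g y)"
    obtain v1 v2 where v: "expands C f v1 v2" using Cex[OF t(1) r(1)] by blast
    obtain w1 w2 where w: "expands C g w1 w2" using Cex[OF t(2) r(2)] by blast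
    obtain u1 u2 where u: "expands C h u1 u2" using Cex[OF t(3) r(3)] by blast
    define z where "z = a * x + b * y"
    define S where "S = \<Psi> (h z) - a * \<Psi> (f x) - b * \<Psi> (g y)"
    define U where "U = u2 z - \<Psi> (h z) * (u1 z)\<^sup>2"
    define V' where "V' = v2 x - \<Psi> (f x) * (v1 x)\<^sup>2"
    define W where "W = w2 y - \<Psi> (g y) * (w1 y)\<^sup>2"
    define T where "T = U - a * V' - b * W"
    have \<theta>4: "(\<theta>\<^sup>2)\<^sup>2 = \<theta>^4" "(\<theta>\<^sup>2)^3 = \<theta>^6" by (simp_all flip: power_mult)
    have \<theta>01: "0 \<le> \<theta>\<^sup>2" "\<theta>\<^sup>2 \<le> 1" using \<theta> by (simp_all add: power_le_one)
    have hu: "\<bar>\<Psi> (heat (\<theta>\<^sup>2) h z) - \<Psi> (h z) - U * \<theta>^4 / 2\<bar> \<le> C * \<theta>^6"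
      using u \<theta>01 unfolding expands_def U_def \<theta>4[symmetric] by blast
    have hv: "\<bar>\<Psi> (heat (\<theta>\<^sup>2) f x) - \<Psi> (f x) - V' * \<theta>^4 / 2\<bar> \<le> C * \<theta>^6"
      using v \<theta>01 unfolding expands_def V'_def \<theta>4[symmetric] by blast
    have hw: "\<bar>\<Psi> (heat (\<theta>\<^sup>2) g y) - \<Psi> (g y) - W * \<theta>^4 / 2\<bar> \<le> C * \<theta>^6"
      using w \<theta>01 unfolding expands_def W_def \<theta>4[symmetric] by blast
    have new: "S + T * \<theta>^4 / 2 - C * (1 + a + b) * \<theta>^6
        \<le> \<Psi> (heat (\<theta>\<^sup>2) h z) - a * \<Psi> (heat (\<theta>\<^sup>2) f x) - b * \<Psi> (heat (\<theta>\<^sup>2) g y)"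
    proof -
      have "S + T * \<theta>^4 / 2 - C * (1 + a + b) * \<theta>^6
        = (\<Psi> (h z) + U * \<theta>^4 / 2 - C * \<theta>^6) - a * (\<Psi> (f x) + V' * \<theta>^4 / 2 + C * \<theta>^6) - b * (\<Psi> (g y) + W * \<theta>^4 / 2 + C * \<theta>^6)"
        by (simp add: S_def T_def field_simps)
      also have "\<dots> \<le> \<Psi> (heat (\<theta>\<^sup>2) h z) - a * \<Psi> (heat (\<theta>\<^sup>2) f x) - b * \<Psi> (heat (\<theta>\<^sup>2) g y)"
        using hu hv hw ab by (intro diff_mono mult_left_mono) (auto simp: abs_le_iff)
      finally show ?thesis .
    qed
    have p65: "\<theta>^6 \<le> \<theta>^5" using \<theta> by (simp add: power_decreasing)
    have "m - F * \<theta>^5 \<le> S + T * \<theta>^4 / 2"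
    proof (cases "S \<le> m + B * \<theta>^4")
      case True
      have eu: "\<bar>\<Psi> (h (z + t)) - \<Psi> (h z) - u1 z * t - u2 z * t\<^sup>2 / 2\<bar> \<le> C * \<bar>t\<bar>^3" if "\<bar>t\<bar> \<le> 1" for t
        using u that unfolding expands_def by blast
      have ev: "\<bar>\<Psi> (f (x + t)) - \<Psi> (f x) - v1 x * t - v2 x * t\<^sup>2 / 2\<bar> \<le> C * \<bar>t\<bar>^3" if "\<bar>t\<bar> \<le> 1" for t
        using v that unfolding expands_def by blast
      have ew: "\<bar>\<Psi> (g (y + t)) - \<Psi> (g y) - w1 y * t - w2 y * t\<^sup>2 / 2\<bar> \<le> C * \<bar>t\<bar>^3" if "\<bar>t\<bar> \<le> 1" for t
        using w that unfolding expands_def by blast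
      have b2: "\<bar>u2 z\<bar> \<le> C" "\<bar>v2 x\<bar> \<le> C" "\<bar>w2 y\<bar> \<le> C"
        and b1: "\<bar>u1 z\<bar> \<le> C" "\<bar>\<Psi> (f x)\<bar> \<le> C" "\<bar>v1 x\<bar> \<le> C" "\<bar>\<Psi> (g y)\<bar> \<le> C" "\<bar>w1 y\<bar> \<le> C"
        using u v w unfolding expands_def by blast+
      have C0: "C \<ge> 0" using C by simp
      note nm = near_minimum[where u = "\<lambda>z. \<Psi> (h z)" and v = "\<lambda>x. \<Psi> (f x)" and w = "\<lambda>y. \<Psi> (g y)",
          OF ab \<rho> \<theta> C0 pos(1) z_def eu ev ew b2 min True[unfolded S_def], folded E_def, folded D0_def]
      have "- (4 * (E + B) + 4 * C\<^sup>2 * D0 + B * C\<^sup>2) * \<theta> \<le> T"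
        unfolding T_def U_def V'_def W_def
        by (rule drift_bound[OF ab \<theta>(1,2) C0 pos(1) b1 nm True[unfolded S_def] m])
      then have "- F * \<theta> * \<theta>^4 \<le> T * \<theta>^4" unfolding F_def by (rule mult_right_mono) simp
      moreover have "F * \<theta> * \<theta>^4 = F * \<theta>^5" by (simp add: eval_nat_numeral)
      moreover have "0 \<le> F * \<theta>^5" using pos \<theta> by simp
      moreover have "m \<le> S" using min[of x y] by (simp add: S_def z_def)
      ultimately show ?thesis by simp
    next
      case False
      have b3: "\<bar>p2 - p * p1\<^sup>2\<bar> \<le> C + C^3" if "\<bar>p\<bar> \<le> C" "\<bar>p1\<bar> \<le> C" "\<bar>p2\<bar> \<le> C" for p p1 p2 :: real
      proof -
        have "\<bar>p\<bar> * p1\<^sup>2 \<le> C * C\<^sup>2"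
          using that C by (intro mult_mono) (auto simp: abs_le_square_iff[symmetric])
        then have "\<bar>p * p1\<^sup>2\<bar> \<le> C^3" by (simp add: abs_mult power2_eq_square power3_eq_cube)
        then show ?thesis using that(3) by linarith
      qed
      have "\<bar>U\<bar> \<le> C + C^3" "\<bar>V'\<bar> \<le> C + C^3" "\<bar>W\<bar> \<le> C + C^3"
        unfolding U_def V'_def W_def by (rule b3; use u v w in \<open>simp add: expands_def\<close>)+
      then have "- (C + C^3) - a * (C + C^3) - b * (C + C^3) \<le> T"
        unfolding T_def using ab by (intro diff_mono mult_left_mono) (auto simp: abs_le_iff)
      then have "- B \<le> T" by (simp add: B_def algebra_simps)
      then have "- B * \<theta>^4 \<le> T * \<theta>^4" by (rule mult_right_mono) simp
      moreover have "0 \<le> F * \<theta>^5" "0 \<le> B * \<theta>^4" using pos \<theta> by simp_all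
      ultimately show ?thesis using False by simp
    qed
    moreover have "C * (1 + a + b) * \<theta>^6 \<le> C * (1 + a + b) * \<theta>^5"
      using p65 C ab by (intro mult_left_mono) auto
    ultimately show "m - (F + C * (1 + a + b)) * \<theta>^5
       \<le> \<Psi> (heat (\<theta>\<^sup>2) h (a * x + b * y)) - a * \<Psi> (heat (\<theta>\<^sup>2) f x) - b * \<Psi> (heat (\<theta>\<^sup>2) g y)"
      using new by (simp add: z_def algebra_simps)
  qed
qed

text \<open>At time \<open>0\<close> the heat flow gives the functions, at time \<open>1\<close> their means. Running \<open>k^4\<close> steps of
  variance \<open>1 / k^4\<close> costs \<open>D / k\<close> in total, which vanishes as \<open>k\<close> grows.\<close>

lemma ehrhard_smooth:
  assumes ab: "a > 0" "b > 0" and cond: "\<bar>1 - a\<^sup>2 - b\<^sup>2\<bar> \<le> 2 * a * b" and \<epsilon>: "\<epsilon> > 0"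
    and t: "taylor3 K f f1 f2" "taylor3 K g g1 g2" "taylor3 K h h1 h2"
    and r: "\<And>x. f x \<in> {\<epsilon>..1 - \<epsilon>}" "\<And>x. g x \<in> {\<epsilon>..1 - \<epsilon>}" "\<And>x. h x \<in> {\<epsilon>..1 - \<epsilon>}"
    and m: "m \<le> 0" and min: "\<And>x y. m \<le> \<Psi> (h (a * x + b * y)) - a * \<Psi> (f x) - b * \<Psi> (g y)"
  shows "m \<le> \<Psi> (\<integral>x. h x \<partial>\<mu>) - a * \<Psi> (\<integral>x. f x \<partial>\<mu>) - b * \<Psi> (\<integral>x. g x \<partial>\<mu>)"
proof -
  have K: "K \<ge> 0" using t(1) unfolding taylor3_def by (meson abs_ge_zero order_trans)
  have meas: "f \<in> borel_measurable borel" "g \<in> borel_measurable borel" "h \<in> borel_measurable borel"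
    using t unfolding taylor3_def by blast+
  obtain D where D: "D \<ge> 0" and step: "\<And>f f1 f2 g g1 g2 h h1 h2 \<theta> m x y.
       taylor3 K f f1 f2 \<Longrightarrow> taylor3 K g g1 g2 \<Longrightarrow> taylor3 K h h1 h2 \<Longrightarrow>
       (\<And>x. f x \<in> {\<epsilon>..1 - \<epsilon>}) \<Longrightarrow> (\<And>x. g x \<in> {\<epsilon>..1 - \<epsilon>}) \<Longrightarrow> (\<And>x. h x \<in> {\<epsilon>..1 - \<epsilon>}) \<Longrightarrow>
       0 < \<theta> \<Longrightarrow> \<theta> \<le> 1 \<Longrightarrow> \<theta> * (a + b) \<le> 1 \<Longrightarrow> m \<le> 0 \<Longrightarrow>
       (\<And>x y. m \<le> \<Psi> (h (a * x + b * y)) - a * \<Psi> (f x) - b * \<Psi> (g y)) \<Longrightarrow>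
       m - D * \<theta>^5 \<le> \<Psi> (heat (\<theta>\<^sup>2) h (a * x + b * y)) - a * \<Psi> (heat (\<theta>\<^sup>2) f x) - b * \<Psi> (heat (\<theta>\<^sup>2) g y)"
    using heat_step[OF ab cond \<epsilon> K] by metis
  have iter: "taylor3 K ((heat \<eta> ^^ j) q) ((heat \<eta> ^^ j) q1) ((heat \<eta> ^^ j) q2) \<and> (\<forall>x. (heat \<eta> ^^ j) q x \<in> {\<epsilon>..1 - \<epsilon>})"
    if "taylor3 K q q1 q2" "\<And>x. q x \<in> {\<epsilon>..1 - \<epsilon>}" for \<eta> q q1 q2 j
  proof (induction j)
    case (Suc j)
    have "(heat \<eta> ^^ j) q \<in> borel_measurable borel" using Suc unfolding taylor3_def by blast
    then show ?case using Suc taylor3_heat[of K "(heat \<eta> ^^ j) q" _ _ \<epsilon> "1 - \<epsilon>" \<eta>] heat_range[of "(heat \<eta> ^^ j) q" \<epsilon> "1 - \<epsilon>" \<eta>]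
      by simp
  qed (use that in simp)
  let ?G = "\<Psi> (\<integral>x. h x \<partial>\<mu>) - a * \<Psi> (\<integral>x. f x \<partial>\<mu>) - b * \<Psi> (\<integral>x. g x \<partial>\<mu>)"
  have bound: "m - D / k \<le> ?G" if k: "k \<ge> 1" "a + b \<le> real k" for k :: nat
  proof -
    define \<theta> where "\<theta> = 1 / real k"
    have \<theta>: "0 < \<theta>" "\<theta> \<le> 1" "\<theta> * (a + b) \<le> 1" using k by (simp_all add: \<theta>_def)
    let ?P = "\<lambda>j q. (heat (\<theta>\<^sup>2) ^^ j) q"
    have steps: "\<forall>x y. m - real j * (D * \<theta>^5) \<le> \<Psi> (?P j h (a * x + b * y)) - a * \<Psi> (?P j f x) - b * \<Psi> (?P j g y)" for j
    proof (induction j)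
      case (Suc j)
      have "m - real j * (D * \<theta>^5) - D * \<theta>^5 \<le> \<Psi> (heat (\<theta>\<^sup>2) (?P j h) (a * x + b * y)) - a * \<Psi> (heat (\<theta>\<^sup>2) (?P j f) x) - b * \<Psi> (heat (\<theta>\<^sup>2) (?P j g) y)" for x y
      proof (rule step)
        have "0 \<le> real j * (D * \<theta>^5)" using D \<theta> by simp
        then show "m - real j * (D * \<theta>^5) \<le> 0" using m by linarith
      qed (use iter[OF t(1) r(1)] iter[OF t(2) r(2)] iter[OF t(3) r(3)] \<theta> Suc in blast)+
      then show ?case by (simp add: algebra_simps)
    qed (use min in simp)
    have end_eq: "?P (k^4) q 0 = (\<integral>x. q x \<partial>\<mu>)" if "q \<in> borel_measurable borel" "\<And>x. q x \<in> {\<epsilon>..1 - \<epsilon>}" for q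
    proof -
      have "sqrt (real (k^4)) = (real k)\<^sup>2" by (rule real_sqrt_unique) (simp_all flip: power_mult)
      then have "sqrt (real (k^4)) * \<theta>\<^sup>2 = 1" using k by (simp add: \<theta>_def power_divide)
      then show ?thesis using heat_iterate[OF that, of "\<theta>\<^sup>2" "k^4"] heat_1_at_0[of q] by simp
    qed
    have "real (k^4) * (D * \<theta>^5) = D / k" using k by (simp add: \<theta>_def power_divide field_simps eval_nat_numeral)
    then show ?thesis
      using steps[of "k^4", rule_format, of 0 0] end_eq[OF meas(1) r(1)] end_eq[OF meas(2) r(2)] end_eq[OF meas(3) r(3)] by simp
  qed
  have "(\<lambda>k. m - D / real k) \<longlonglongrightarrow> m - 0"
    by (intro tendsto_diff tendsto_const lim_const_over_n)
  moreover have "eventually (\<lambda>k. m - D / real k \<le> ?G) sequentially"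
  proof -
    obtain k0 :: nat where k0: "a + b \<le> real k0" using real_arch_simple by blast
    show ?thesis
      by (rule eventually_sequentiallyI[of "max 1 k0"]) (rule bound, use k0 in auto)
  qed
  ultimately show ?thesis
    using tendsto_upperbound[of "\<lambda>k. m - D / real k" m sequentially ?G] by simp
qed

end

section \<open>From smooth to semicontinuous functions\<close>

lemma difference_quotient:
  fixes F f :: "real \<Rightarrow> real"
  assumes F: "\<And>x. (F has_real_derivative f x) (at x)" and \<delta>: "\<delta> > 0"
  shows "\<exists>\<xi>. x \<le> \<xi> \<and> \<xi> \<le> x + \<delta> \<and> F (x + \<delta>) - F x = \<delta> * f \<xi>"
proof -
  obtain z where "x < z" "z < x + \<delta>" "F (x + \<delta>) - F x = (x + \<delta> - x) * f z"
    using MVT2[of x "x + \<delta>" F f] F \<delta> by auto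
  then show ?thesis by (intro exI[of _ z]) auto
qed

lemma difference_deriv:
  fixes F f :: "real \<Rightarrow> real"
  assumes F: "\<And>x. (F has_real_derivative f x) (at x)"
  shows "((\<lambda>x. F (x + \<delta>) - F x) has_real_derivative (f (x + \<delta>) - f x)) (at x)"
  using DERIV_diff[OF DERIV_shift[THEN iffD1, OF F[of "x + \<delta>"]] F[of x]] .

lemma has_antiderivative:
  fixes f :: "real \<Rightarrow> real"
  assumes "continuous_on UNIV f"
  obtains F where "\<And>x. (F has_real_derivative f x) (at x)"
proof -
  have "isCont f x" for x using assms continuous_on_eq_continuous_at by blast
  then have "\<exists>F. \<forall>x::real. - \<infinity> < ereal x \<longrightarrow> ereal x < \<infinity> \<longrightarrow> (F has_vector_derivative f x) (at x)"
    by (intro einterval_antiderivative) auto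
  then show ?thesis using that by (auto simp: has_real_derivative_iff_has_vector_derivative)
qed

lemma taylor3_if_third_derivative:
  assumes q: "\<And>x. (q has_real_derivative q1 x) (at x)" "\<And>x. (q1 has_real_derivative q2 x) (at x)"
      "\<And>x. (q2 has_real_derivative q3 x) (at x)"
    and bd: "\<And>x. \<bar>q1 x\<bar> \<le> K" "\<And>x. \<bar>q2 x\<bar> \<le> K" "\<And>x. \<bar>q3 x\<bar> \<le> K"
  shows "taylor3 K q q1 q2"
proof -
  have meas: "g \<in> borel_measurable borel" if "\<And>x. (g has_real_derivative g' x) (at x)" for g g' :: "real \<Rightarrow> real"
    by (intro borel_measurable_continuous_onI continuous_at_imp_continuous_on) (use DERIV_isCont that in blast)
  have "\<bar>q (x + h) - q x - q1 x * h - q2 x * h\<^sup>2 / 2\<bar> \<le> K * \<bar>h\<bar>^3" for x h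
  proof (cases "h = 0")
    case False
    define diff where "diff = (\<lambda>m::nat. if m = 0 then q else if m = 1 then q1 else if m = 2 then q2 else q3)"
    have "\<exists>t. (if x + h < x then x + h < t \<and> t < x else x < t \<and> t < x + h) \<and>
        q (x + h) = (\<Sum>m<3. (diff m x / fact m) * ((x + h) - x)^m) + (diff 3 t / fact 3) * ((x + h) - x)^3"
    proof (rule Taylor)
      show "\<forall>m t. m < 3 \<and> x - \<bar>h\<bar> \<le> t \<and> t \<le> x + \<bar>h\<bar> \<longrightarrow> (diff m has_real_derivative diff (Suc m) t) (at t)"
      proof (intro allI impI)
        fix m :: nat and t assume "m < 3 \<and> x - \<bar>h\<bar> \<le> t \<and> t \<le> x + \<bar>h\<bar>"
        then have "m = 0 \<or> m = 1 \<or> m = 2" by auto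
        then show "(diff m has_real_derivative diff (Suc m) t) (at t)" using q[of t] by (auto simp: diff_def)
      qed
    qed (use False in \<open>auto simp: diff_def\<close>)
    then obtain t where "q (x + h) = (\<Sum>m<3. (diff m x / fact m) * ((x + h) - x)^m) + (diff 3 t / fact 3) * ((x + h) - x)^3"
      by blast
    then have eq: "q (x + h) - q x - q1 x * h - q2 x * h\<^sup>2 / 2 = q3 t / 6 * h^3"
      by (simp add: diff_def eval_nat_numeral)
    have "\<bar>q3 t / 6\<bar> \<le> K" using bd(3)[of t] by linarith
    from mult_right_mono[OF this, of "\<bar>h\<bar>^3"] show ?thesis
      unfolding eq by (simp only: abs_mult[of "q3 t / 6"] power_abs) simp
  qed simp
  then show ?thesis unfolding taylor3_def using meas[OF q(1)] meas[OF q(2)] meas[OF q(3)] bd by blast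
qed

text \<open>Averaging three times over intervals of length \<open>\<delta>\<close>: up to the factor \<open>\<delta>^3\<close> the average is the third
  difference of a third antiderivative. Hence its derivatives are differences of lower
  antiderivatives, and by the mean value theorem it takes values of \<open>f\<close> at nearby points.\<close>

lemma mollify:
  fixes f :: "real \<Rightarrow> real"
  assumes f: "continuous_on UNIV f" "\<And>x. \<bar>f x\<bar> \<le> 1" and \<delta>: "\<delta> > 0"
  obtains q q1 q2 where "taylor3 (2 / \<delta> + 4 / \<delta>\<^sup>2 + 8 / \<delta>^3) q q1 q2" "\<And>x. \<exists>\<xi>. \<bar>\<xi> - x\<bar> \<le> 3 * \<delta> \<and> q x = f \<xi>"
proof -
  obtain F1 where F1: "\<And>x. (F1 has_real_derivative f x) (at x)" using has_antiderivative[OF f(1)] by blast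
  have c: "continuous_on UNIV g" if "\<And>x. (g has_real_derivative g' x) (at x)" for g g' :: "real \<Rightarrow> real"
    by (intro continuous_at_imp_continuous_on) (use DERIV_isCont that in blast)
  obtain F2 where F2: "\<And>x. (F2 has_real_derivative F1 x) (at x)" using has_antiderivative[OF c[OF F1]] by blast
  obtain F3 where F3: "\<And>x. (F3 has_real_derivative F2 x) (at x)" using has_antiderivative[OF c[OF F2]] by blast
  define \<Delta> where "\<Delta> g x = g (x + \<delta>) - g x" for g :: "real \<Rightarrow> real" and x
  have dd: "(\<Delta> F has_real_derivative \<Delta> f x) (at x)" if "\<And>x. (F has_real_derivative f x) (at x)" for F f x
    unfolding \<Delta>_def[abs_def] by (rule difference_deriv[OF that])
  have mv: "\<exists>\<xi>. x \<le> \<xi> \<and> \<xi> \<le> x + \<delta> \<and> \<Delta> F x = \<delta> * f \<xi>" if "\<And>x. (F has_real_derivative f x) (at x)" for F f x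
    unfolding \<Delta>_def by (rule difference_quotient[OF that \<delta>])
  have m1: "\<exists>\<xi>. x \<le> \<xi> \<and> \<xi> \<le> x + \<delta> \<and> \<Delta> F1 x = \<delta> * f \<xi>" for x by (rule mv[OF F1])
  have m2: "\<exists>\<xi>. x \<le> \<xi> \<and> \<xi> \<le> x + 2 * \<delta> \<and> \<Delta> (\<Delta> F2) x = \<delta>\<^sup>2 * f \<xi>" for x
  proof -
    obtain y where y: "x \<le> y" "y \<le> x + \<delta>" "\<Delta> (\<Delta> F2) x = \<delta> * \<Delta> F1 y" using mv[OF dd[OF F2]] by blast
    obtain \<xi> where "y \<le> \<xi>" "\<xi> \<le> y + \<delta>" "\<Delta> F1 y = \<delta> * f \<xi>" using m1 by blast
    then show ?thesis using y by (intro exI[of _ \<xi>]) (auto simp: power2_eq_square)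
  qed
  have m3: "\<exists>\<xi>. x \<le> \<xi> \<and> \<xi> \<le> x + 3 * \<delta> \<and> \<Delta> (\<Delta> (\<Delta> F3)) x = \<delta>^3 * f \<xi>" for x
  proof -
    obtain y where y: "x \<le> y" "y \<le> x + \<delta>" "\<Delta> (\<Delta> (\<Delta> F3)) x = \<delta> * \<Delta> (\<Delta> F2) y" using mv[OF dd[OF dd[OF F3]]] by blast
    obtain \<xi> where "y \<le> \<xi>" "\<xi> \<le> y + 2 * \<delta>" "\<Delta> (\<Delta> F2) y = \<delta>\<^sup>2 * f \<xi>" using m2 by blast
    then show ?thesis using y by (intro exI[of _ \<xi>]) (auto simp: power2_eq_square power3_eq_cube)
  qed
  define K where "K = 2 / \<delta> + 4 / \<delta>\<^sup>2 + 8 / \<delta>^3"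
  have Kle: "2 / \<delta> \<le> K" "4 / \<delta>\<^sup>2 \<le> K" "8 / \<delta>^3 \<le> K" using \<delta> by (simp_all add: K_def)
  have M1: "\<bar>\<Delta> F1 x\<bar> \<le> \<delta>" for x using m1[of x] f(2) \<delta> by (auto simp: abs_mult mult_left_le)
  have M2: "\<bar>\<Delta> (\<Delta> F2) x\<bar> \<le> \<delta>\<^sup>2" for x using m2[of x] f(2) \<delta> by (auto simp: abs_mult mult_left_le)
  have D1: "\<bar>\<Delta> (\<Delta> (\<Delta> F2)) x\<bar> \<le> 2 * \<delta>\<^sup>2" for x
    using M2[of x] M2[of "x + \<delta>"] unfolding \<Delta>_def[of "\<Delta> (\<Delta> F2)"] by linarith
  have D2: "\<bar>\<Delta> (\<Delta> (\<Delta> F1)) x\<bar> \<le> 4 * \<delta>" for x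
    using M1[of x] M1[of "x + \<delta>"] M1[of "x + \<delta> + \<delta>"] unfolding \<Delta>_def[of "\<Delta> (\<Delta> F1)"] \<Delta>_def[of "\<Delta> F1"] by linarith
  have D3: "\<bar>\<Delta> (\<Delta> (\<Delta> f)) x\<bar> \<le> 8" for x
    using f(2)[of x] f(2)[of "x + \<delta>"] f(2)[of "x + \<delta> + \<delta>"] f(2)[of "x + \<delta> + \<delta> + \<delta>"] unfolding \<Delta>_def by linarith
  have "taylor3 K (\<lambda>x. \<Delta> (\<Delta> (\<Delta> F3)) x / \<delta>^3) (\<lambda>x. \<Delta> (\<Delta> (\<Delta> F2)) x / \<delta>^3) (\<lambda>x. \<Delta> (\<Delta> (\<Delta> F1)) x / \<delta>^3)"
  proof (rule taylor3_if_third_derivative)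
    show "((\<lambda>x. \<Delta> (\<Delta> (\<Delta> F3)) x / \<delta>^3) has_real_derivative \<Delta> (\<Delta> (\<Delta> F2)) x / \<delta>^3) (at x)"
      "((\<lambda>x. \<Delta> (\<Delta> (\<Delta> F2)) x / \<delta>^3) has_real_derivative \<Delta> (\<Delta> (\<Delta> F1)) x / \<delta>^3) (at x)"
      "((\<lambda>x. \<Delta> (\<Delta> (\<Delta> F1)) x / \<delta>^3) has_real_derivative \<Delta> (\<Delta> (\<Delta> f)) x / \<delta>^3) (at x)" for x
      by (intro DERIV_cdivide dd F1 F2 F3)+
    fix x
    have "\<bar>\<Delta> (\<Delta> (\<Delta> F2)) x / \<delta>^3\<bar> \<le> (2 * \<delta>\<^sup>2) / \<delta>^3" using D1[of x] \<delta> by (simp add: divide_right_mono)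
    also have "\<dots> = 2 / \<delta>" using \<delta> by (simp add: power2_eq_square power3_eq_cube)
    finally show "\<bar>\<Delta> (\<Delta> (\<Delta> F2)) x / \<delta>^3\<bar> \<le> K" using Kle by linarith
    have "\<bar>\<Delta> (\<Delta> (\<Delta> F1)) x / \<delta>^3\<bar> \<le> (4 * \<delta>) / \<delta>^3" using D2[of x] \<delta> by (simp add: divide_right_mono)
    also have "\<dots> = 4 / \<delta>\<^sup>2" using \<delta> by (simp add: power2_eq_square power3_eq_cube)
    finally show "\<bar>\<Delta> (\<Delta> (\<Delta> F1)) x / \<delta>^3\<bar> \<le> K" using Kle by linarith
    have "\<bar>\<Delta> (\<Delta> (\<Delta> f)) x / \<delta>^3\<bar> \<le> 8 / \<delta>^3" using D3[of x] \<delta> by (simp add: divide_right_mono)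
    then show "\<bar>\<Delta> (\<Delta> (\<Delta> f)) x / \<delta>^3\<bar> \<le> K" using Kle by linarith
  qed
  moreover have "\<exists>\<xi>. \<bar>\<xi> - x\<bar> \<le> 3 * \<delta> \<and> \<Delta> (\<Delta> (\<Delta> F3)) x / \<delta>^3 = f \<xi>" for x
  proof -
    obtain \<xi> where "x \<le> \<xi>" "\<xi> \<le> x + 3 * \<delta>" "\<Delta> (\<Delta> (\<Delta> F3)) x = \<delta>^3 * f \<xi>" using m3 by blast
    then show ?thesis using \<delta> by (intro exI[of _ \<xi>]) auto
  qed
  ultimately show ?thesis using that unfolding K_def by blast
qed

context gaussian
begin

text \<open>Mollification spoils the pointwise inequality by at most a multiple of the scale \<open>\<delta>\<close>. The smooth
  case tolerates such a nonpositive lower bound \<open>m\<close>, and \<open>m\<close> tends to \<open>0\<close> with \<open>\<delta>\<close>.\<close>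

lemma ehrhard_lipschitz:
  assumes ab: "a > 0" "b > 0" and cond: "\<bar>1 - a\<^sup>2 - b\<^sup>2\<bar> \<le> 2 * a * b"
    and bd: "\<And>x. \<bar>v x\<bar> \<le> N" "\<And>x. \<bar>w x\<bar> \<le> N" "\<And>x. \<bar>u x\<bar> \<le> N"
    and lip: "\<And>x y. \<bar>v x - v y\<bar> \<le> L * \<bar>x - y\<bar>" "\<And>x y. \<bar>w x - w y\<bar> \<le> L * \<bar>x - y\<bar>" "\<And>x y. \<bar>u x - u y\<bar> \<le> L * \<bar>x - y\<bar>"
    and L: "L \<ge> 0"
    and le: "\<And>x y. a * v x + b * w y \<le> u (a * x + b * y)"
  shows "a * \<Psi> (\<integral>x. \<Phi> (v x) \<partial>\<mu>) + b * \<Psi> (\<integral>x. \<Phi> (w x) \<partial>\<mu>) \<le> \<Psi> (\<integral>x. \<Phi> (u x) \<partial>\<mu>)"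
proof -
  define \<delta> where "\<delta> n = 1 / real (Suc n)" for n
  have \<delta>: "\<delta> n > 0" for n by (simp add: \<delta>_def)
  have \<delta>0: "\<delta> \<longlonglongrightarrow> 0" unfolding \<delta>_def using LIMSEQ_inverse_real_of_nat by (simp add: inverse_eq_divide)
  let ?K = "\<lambda>n. 2 / \<delta> n + 4 / (\<delta> n)\<^sup>2 + 8 / \<delta> n^3"
  have cont: "continuous_on UNIV q" if "\<And>x y. \<bar>q x - q y\<bar> \<le> L * \<bar>x - y\<bar>" for q :: "real \<Rightarrow> real"
  proof -
    have "L-lipschitz_on UNIV q" using that L by (intro lipschitz_onI) (auto simp: dist_real_def)
    then show ?thesis by (rule lipschitz_on_continuous_on)
  qed
  \<comment> \<open>A mollification of \<open>\<Phi> \<circ> q\<close> takes at \<open>x\<close> the value of \<open>\<Phi> \<circ> q\<close> at a point \<open>s n x\<close> close to \<open>x\<close>.\<close>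
  have moll: "\<exists>f f1 f2 s. \<forall>n. taylor3 (?K n) (f n) (f1 n) (f2 n) \<and> (\<forall>x. \<bar>s n x - x\<bar> \<le> 3 * \<delta> n \<and> f n x = \<Phi> (q (s n x)))"
    if "\<And>x y. \<bar>q x - q y\<bar> \<le> L * \<bar>x - y\<bar>" for q
  proof -
    have "continuous_on UNIV (\<lambda>x. \<Phi> (q x))"
      by (rule continuous_on_compose2[OF cdf_cont cont[OF that]]) auto
    then have "\<exists>f f1 f2 s. taylor3 (?K n) f f1 f2 \<and> (\<forall>x. \<bar>s x - x\<bar> \<le> 3 * \<delta> n \<and> f x = \<Phi> (q (s x)))" for n
    proof -
      have "\<bar>\<Phi> (q x)\<bar> \<le> 1" for x using cdf_bounded_prob[of "q x"] cdf_nonneg[of "q x"] by simp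
      from mollify[OF \<open>continuous_on UNIV (\<lambda>x. \<Phi> (q x))\<close> this \<delta>[of n]]
      obtain f f1 f2 where "taylor3 (?K n) f f1 f2" "\<And>x. \<exists>\<xi>. \<bar>\<xi> - x\<bar> \<le> 3 * \<delta> n \<and> f x = \<Phi> (q \<xi>)" by blast
      then show ?thesis by metis
    qed
    then show ?thesis by metis
  qed
  obtain f f1 f2 sf where f: "\<And>n. taylor3 (?K n) (f n) (f1 n) (f2 n)" "\<And>n x. \<bar>sf n x - x\<bar> \<le> 3 * \<delta> n" "\<And>n x. f n x = \<Phi> (v (sf n x))"
    using moll[OF lip(1)] by blast
  obtain g g1 g2 sg where g: "\<And>n. taylor3 (?K n) (g n) (g1 n) (g2 n)" "\<And>n x. \<bar>sg n x - x\<bar> \<le> 3 * \<delta> n" "\<And>n x. g n x = \<Phi> (w (sg n x))"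
    using moll[OF lip(2)] by blast
  obtain h h1 h2 sh where h: "\<And>n. taylor3 (?K n) (h n) (h1 n) (h2 n)" "\<And>n x. \<bar>sh n x - x\<bar> \<le> 3 * \<delta> n" "\<And>n x. h n x = \<Phi> (u (sh n x))"
    using moll[OF lip(3)] by blast
  define \<epsilon> where "\<epsilon> = min (\<Phi> (- N)) (1 - \<Phi> N)"
  have \<epsilon>: "\<epsilon> > 0" by (simp add: \<epsilon>_def cdf_pos cdf_less_1)
  have range: "\<Phi> t \<in> {\<epsilon>..1 - \<epsilon>}" if "\<bar>t\<bar> \<le> N" for t
  proof -
    have "\<Phi> (- N) \<le> \<Phi> t" "\<Phi> t \<le> \<Phi> N" using that by (auto simp: abs_le_iff)
    moreover have "\<epsilon> \<le> \<Phi> (- N)" "\<epsilon> \<le> 1 - \<Phi> N" by (simp_all add: \<epsilon>_def)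
    ultimately show ?thesis unfolding atLeastAtMost_iff by linarith
  qed
  define m where "m n = - ((1 + a + b) * (L * (3 * \<delta> n)))" for n
  have close: "\<bar>q (s n x) - q x\<bar> \<le> L * (3 * \<delta> n)" if "\<And>x y. \<bar>q x - q y\<bar> \<le> L * \<bar>x - y\<bar>" "\<And>n x. \<bar>s n x - x\<bar> \<le> 3 * \<delta> n"
    for q :: "real \<Rightarrow> real" and s :: "nat \<Rightarrow> real \<Rightarrow> real" and n x
    using order_trans[OF that(1) mult_left_mono[OF that(2) L]] .
  have fin: "m n \<le> \<Psi> (\<integral>x. h n x \<partial>\<mu>) - a * \<Psi> (\<integral>x. f n x \<partial>\<mu>) - b * \<Psi> (\<integral>x. g n x \<partial>\<mu>)" for n
  proof (rule ehrhard_smooth[OF ab cond \<epsilon> f(1) g(1) h(1)])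
    show "m n \<le> 0" using ab L \<delta>[of n] by (simp add: m_def)
    fix x y
    have "m n = (u (a * x + b * y) - L * (3 * \<delta> n)) - a * (v x + L * (3 * \<delta> n)) - b * (w y + L * (3 * \<delta> n)) + (a * v x + b * w y - u (a * x + b * y))"
      by (simp add: m_def algebra_simps)
    also have "\<dots> \<le> (u (a * x + b * y) - L * (3 * \<delta> n)) - a * (v x + L * (3 * \<delta> n)) - b * (w y + L * (3 * \<delta> n))"
      using le[of x y] by simp
    also have "\<dots> \<le> u (sh n (a * x + b * y)) - a * v (sf n x) - b * w (sg n y)"
      using close[OF lip(1) f(2), of n x] close[OF lip(2) g(2), of n y] close[OF lip(3) h(2), of n "a * x + b * y"] ab
      by (intro diff_mono mult_left_mono) (auto simp: abs_le_iff)
    finally show "m n \<le> \<Psi> (h n (a * x + b * y)) - a * \<Psi> (f n x) - b * \<Psi> (g n y)"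
      by (simp add: f(3) g(3) h(3))
  qed (use bd range in \<open>simp_all add: f(3) g(3) h(3)\<close>)
  have lim: "(\<lambda>n. \<Psi> (\<integral>x. F n x \<partial>\<mu>)) \<longlonglongrightarrow> \<Psi> (\<integral>x. \<Phi> (q x) \<partial>\<mu>)"
    if l: "\<And>x y. \<bar>q x - q y\<bar> \<le> L * \<bar>x - y\<bar>" and s: "\<And>n x. \<bar>s n x - x\<bar> \<le> 3 * \<delta> n"
      and F: "\<And>n x. F n x = \<Phi> (q (s n x))" and [measurable]: "\<And>n. F n \<in> borel_measurable borel" for F q s
  proof -
    have [measurable]: "q \<in> borel_measurable borel" using cont[OF l] borel_measurable_continuous_onI by blast
    have "(\<lambda>n. \<integral>x. F n x \<partial>\<mu>) \<longlonglongrightarrow> (\<integral>x. \<Phi> (q x) \<partial>\<mu>)"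
    proof (rule integral_dominated_convergence[where w = "\<lambda>_. 1"])
      have "(\<lambda>n. F n x) \<longlonglongrightarrow> \<Phi> (q x)" for x
      proof -
        have "(\<lambda>n. L * (3 * \<delta> n)) \<longlonglongrightarrow> L * (3 * 0)" by (intro tendsto_intros \<delta>0)
        then have "(\<lambda>n. q (s n x) - q x) \<longlonglongrightarrow> 0"
        proof (rule Lim_null_comparison[rotated, OF tendsto_eq_rhs])
          show "\<forall>\<^sub>F n in sequentially. norm (q (s n x) - q x) \<le> L * (3 * \<delta> n)"
            using close[OF l s] by (intro always_eventually allI) (simp only: real_norm_def)
        qed simp
        then have "(\<lambda>n. q (s n x)) \<longlonglongrightarrow> q x" by (rule Lim_null[THEN iffD2])
        then show ?thesis unfolding F by (rule isCont_tendsto_compose[OF DERIV_isCont[OF cdf_deriv]])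
      qed
      then show "AE x in \<mu>. (\<lambda>n. F n x) \<longlonglongrightarrow> \<Phi> (q x)" by simp
      show "AE x in \<mu>. norm (F n x) \<le> 1" for n by (simp add: F cdf_nonneg cdf_bounded_prob)
    qed auto
    moreover have "isCont \<Psi> (\<integral>x. \<Phi> (q x) \<partial>\<mu>)"
      by (rule DERIV_isCont[OF Psi_deriv]) (rule integral_cdf_pos, measurable)+
    ultimately show ?thesis by (rule isCont_tendsto_compose[rotated])
  qed
  have lim_fin: "(\<lambda>n. \<Psi> (\<integral>x. h n x \<partial>\<mu>) - a * \<Psi> (\<integral>x. f n x \<partial>\<mu>) - b * \<Psi> (\<integral>x. g n x \<partial>\<mu>)) \<longlonglongrightarrow>
      \<Psi> (\<integral>x. \<Phi> (u x) \<partial>\<mu>) - a * \<Psi> (\<integral>x. \<Phi> (v x) \<partial>\<mu>) - b * \<Psi> (\<integral>x. \<Phi> (w x) \<partial>\<mu>)"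
    by (intro tendsto_intros lim[OF lip(1) f(2,3)] lim[OF lip(2) g(2,3)] lim[OF lip(3) h(2,3)])
      (use f(1) g(1) h(1) in \<open>auto simp: taylor3_def\<close>)
  have "m \<longlonglongrightarrow> - ((1 + a + b) * (L * (3 * 0)))" unfolding m_def by (intro tendsto_intros \<delta>0)
  from LIMSEQ_le[OF this lim_fin] have "- ((1 + a + b) * (L * (3 * 0))) \<le> \<Psi> (\<integral>x. \<Phi> (u x) \<partial>\<mu>) - a * \<Psi> (\<integral>x. \<Phi> (v x) \<partial>\<mu>) - b * \<Psi> (\<integral>x. \<Phi> (w x) \<partial>\<mu>)"
    using fin by blast
  then show ?thesis by simp
qed

end

text \<open>The least \<open>j\<close>-Lipschitz majorant. It commutes with supremal convolution, and for an upper
  semicontinuous function it decreases to that function as \<open>j\<close> grows.\<close>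

definition lip_majorant :: "real \<Rightarrow> (real \<Rightarrow> real) \<Rightarrow> real \<Rightarrow> real" where
  "lip_majorant j q x = (SUP y. q y - j * \<bar>x - y\<bar>)"

context
  fixes j N :: real and q :: "real \<Rightarrow> real"
  assumes j: "j \<ge> 0" and q: "\<And>x. \<bar>q x\<bar> \<le> N"
begin

lemma lip_majorant_bdd: "bdd_above (range (\<lambda>y. q y - j * \<bar>x - y\<bar>))"
proof (rule bdd_aboveI2)
  fix y show "q y - j * \<bar>x - y\<bar> \<le> N" using q[of y] mult_nonneg_nonneg[OF j, of "\<bar>x - y\<bar>"] by (simp add: abs_le_iff)
qed

lemma lip_majorant_upper: "q y - j * \<bar>x - y\<bar> \<le> lip_majorant j q x"
  unfolding lip_majorant_def by (rule cSUP_upper[OF _ lip_majorant_bdd]) simp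

lemma lip_majorant_least: "(\<And>y. q y - j * \<bar>x - y\<bar> \<le> c) \<Longrightarrow> lip_majorant j q x \<le> c"
  unfolding lip_majorant_def by (rule cSUP_least) auto

lemma lip_majorant_ge: "q x \<le> lip_majorant j q x"
  using lip_majorant_upper[of x x] by simp

lemma lip_majorant_bound: "\<bar>lip_majorant j q x\<bar> \<le> N"
proof -
  have "lip_majorant j q x \<le> N"
  proof (rule lip_majorant_least)
    fix y show "q y - j * \<bar>x - y\<bar> \<le> N" using q[of y] mult_nonneg_nonneg[OF j, of "\<bar>x - y\<bar>"] by (simp add: abs_le_iff)
  qed
  then show ?thesis using lip_majorant_ge[of x] q[of x] by (simp add: abs_le_iff)
qed

lemma lip_majorant_lipschitz: "\<bar>lip_majorant j q x - lip_majorant j q x'\<bar> \<le> j * \<bar>x - x'\<bar>"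
proof -
  have "lip_majorant j q x \<le> lip_majorant j q x' + j * \<bar>x - x'\<bar>" for x x'
  proof (rule lip_majorant_least)
    fix y
    have "j * \<bar>x' - y\<bar> \<le> j * (\<bar>x - x'\<bar> + \<bar>x - y\<bar>)" by (intro mult_left_mono j) simp
    then show "q y - j * \<bar>x - y\<bar> \<le> lip_majorant j q x' + j * \<bar>x - x'\<bar>"
      using lip_majorant_upper[of y x'] by (simp add: algebra_simps)
  qed
  from this[of x x'] this[of x' x] show ?thesis by (simp add: abs_le_iff abs_minus_commute)
qed

end

lemma lip_majorant_sup_convolution:
  fixes u v w :: "real \<Rightarrow> real"
  assumes ab: "a > 0" "b > 0" and j: "j \<ge> 0"
    and bd: "\<And>x. \<bar>v x\<bar> \<le> N" "\<And>x. \<bar>w x\<bar> \<le> N" "\<And>x. \<bar>u x\<bar> \<le> N"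
    and le: "\<And>x y. a * v x + b * w y \<le> u (a * x + b * y)"
  shows "a * lip_majorant j v x + b * lip_majorant j w y \<le> lip_majorant j u (a * x + b * y)"
proof -
  let ?U = "lip_majorant j u (a * x + b * y)"
  have *: "a * (v x' - j * \<bar>x - x'\<bar>) + b * (w y' - j * \<bar>y - y'\<bar>) \<le> ?U" for x' y'
  proof -
    have "\<bar>(a * x + b * y) - (a * x' + b * y')\<bar> = \<bar>a * (x - x') + b * (y - y')\<bar>" by (simp add: algebra_simps)
    also have "\<dots> \<le> a * \<bar>x - x'\<bar> + b * \<bar>y - y'\<bar>"
      using abs_triangle_ineq[of "a * (x - x')" "b * (y - y')"] ab by (simp add: abs_mult)
    finally have "j * \<bar>(a * x + b * y) - (a * x' + b * y')\<bar> \<le> j * (a * \<bar>x - x'\<bar> + b * \<bar>y - y'\<bar>)"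
      by (rule mult_left_mono[OF _ j])
    then show ?thesis
      using lip_majorant_upper[where q = u, OF j bd(3), where y = "a * x' + b * y'" and x = "a * x + b * y"] le[of x' y'] by (simp add: algebra_simps)
  qed
  have "lip_majorant j v x \<le> (?U - b * lip_majorant j w y) / a"
  proof (rule lip_majorant_least[OF j bd(1)])
    fix x'
    have "lip_majorant j w y \<le> (?U - a * (v x' - j * \<bar>x - x'\<bar>)) / b"
      by (rule lip_majorant_least[OF j bd(2)]) (use *[of x'] ab in \<open>simp add: pos_le_divide_eq mult.commute[of _ b] le_diff_eq add.commute\<close>)
    then have "b * lip_majorant j w y \<le> ?U - a * (v x' - j * \<bar>x - x'\<bar>)"
      using ab by (simp add: pos_le_divide_eq mult.commute)
    then have "a * (v x' - j * \<bar>x - x'\<bar>) \<le> ?U - b * lip_majorant j w y" by linarith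
    then show "v x' - j * \<bar>x - x'\<bar> \<le> (?U - b * lip_majorant j w y) / a"
      using ab by (simp add: pos_le_divide_eq mult.commute)
  qed
  then have "a * lip_majorant j v x \<le> ?U - b * lip_majorant j w y"
    using ab by (simp add: pos_le_divide_eq mult.commute)
  then show ?thesis by linarith
qed

lemma lip_majorant_tendsto:
  fixes q :: "real \<Rightarrow> real"
  assumes q: "\<And>x. \<bar>q x\<bar> \<le> N" and usc: "\<And>c. q z < c \<Longrightarrow> eventually (\<lambda>y. q y < c) (nhds z)"
  shows "(\<lambda>n. lip_majorant (real n) q z) \<longlonglongrightarrow> q z"
proof (rule order_tendstoI)
  fix c assume "c < q z"
  then show "eventually (\<lambda>n. c < lip_majorant (real n) q z) sequentially"
    by (intro always_eventually allI) (rule less_le_trans[OF _ lip_majorant_ge[OF _ q]], auto)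
next
  fix c assume "q z < c"
  then obtain c' where c': "q z < c'" "c' < c" using dense by blast
  obtain d where d: "d > 0" "\<And>y. \<bar>y - z\<bar> < d \<Longrightarrow> q y < c'"
    using usc[OF c'(1)] unfolding eventually_nhds_metric dist_real_def by blast
  obtain n0 :: nat where n0: "(N - c') / d \<le> real n0" using real_arch_simple by blast
  show "eventually (\<lambda>n. lip_majorant (real n) q z < c) sequentially"
  proof (rule eventually_sequentiallyI[of n0])
    fix n assume "n \<ge> n0"
    then have "(N - c') / d \<le> real n" using n0 by linarith
    then have n: "N - c' \<le> real n * d" using d(1) by (simp add: pos_divide_le_eq)
    have "lip_majorant (real n) q z \<le> c'"
    proof (rule lip_majorant_least[OF _ q])
      fix y
      show "q y - real n * \<bar>z - y\<bar> \<le> c'"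
      proof (cases "\<bar>y - z\<bar> < d")
        case True
        have "0 \<le> real n * \<bar>z - y\<bar>" by simp
        then show ?thesis using d(2)[OF True] by linarith
      next
        case False
        then have "real n * d \<le> real n * \<bar>z - y\<bar>" by (intro mult_left_mono) auto
        then show ?thesis using n q[of y] by (simp add: abs_le_iff)
      qed
    qed simp
    then show "lip_majorant (real n) q z < c" using c'(2) by simp
  qed
qed

context gaussian
begin

text \<open>Lipschitz majorants of \<open>v\<close> and \<open>w\<close> increase the left-hand side, and the same majorant of \<open>u\<close>
  keeps the pointwise inequality. Since \<open>u\<close> is semicontinuous, its majorants decrease to \<open>u\<close>.\<close>

lemma ehrhard_usc:
  assumes ab: "a > 0" "b > 0" and cond: "\<bar>1 - a\<^sup>2 - b\<^sup>2\<bar> \<le> 2 * a * b"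
    and [measurable]: "v \<in> borel_measurable borel" "w \<in> borel_measurable borel" "u \<in> borel_measurable borel"
    and bd: "\<And>x. \<bar>v x\<bar> \<le> N" "\<And>x. \<bar>w x\<bar> \<le> N" "\<And>x. \<bar>u x\<bar> \<le> N"
    and usc: "\<And>z c. u z < c \<Longrightarrow> eventually (\<lambda>y. u y < c) (nhds z)"
    and le: "\<And>x y. a * v x + b * w y \<le> u (a * x + b * y)"
  shows "a * \<Psi> (\<integral>x. \<Phi> (v x) \<partial>\<mu>) + b * \<Psi> (\<integral>x. \<Phi> (w x) \<partial>\<mu>) \<le> \<Psi> (\<integral>x. \<Phi> (u x) \<partial>\<mu>)"
proof -
  have meas: "lip_majorant (real n) q \<in> borel_measurable borel" if "\<And>x. \<bar>q x\<bar> \<le> N" for q n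
  proof -
    have "(real n)-lipschitz_on UNIV (lip_majorant (real n) q)"
      using lip_majorant_lipschitz[of "real n" q N] that by (intro lipschitz_onI) (auto simp: dist_real_def)
    then show ?thesis by (intro borel_measurable_continuous_onI lipschitz_on_continuous_on)
  qed
  note [measurable] = meas[OF bd(1)] meas[OF bd(2)] meas[OF bd(3)]
  have int: "integrable \<mu> (\<lambda>x. \<Phi> (q x))" if [measurable]: "q \<in> borel_measurable borel" for q
    by (rule bounded_integrable[where K = 1]) (simp_all add: cdf_bounded_prob cdf_nonneg)
  have mono: "\<Psi> (\<integral>x. \<Phi> (q x) \<partial>\<mu>) \<le> \<Psi> (\<integral>x. \<Phi> (lip_majorant (real n) q x) \<partial>\<mu>)"
    if [measurable]: "q \<in> borel_measurable borel" and q: "\<And>x. \<bar>q x\<bar> \<le> N" for q n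
  proof (intro Psi_mono integral_cdf_pos integral_mono int)
    note [measurable] = meas[OF q]
    show "q \<in> borel_measurable borel" "q \<in> borel_measurable borel" "lip_majorant (real n) q \<in> borel_measurable borel" "lip_majorant (real n) q \<in> borel_measurable borel" by measurable
    show "\<Phi> (q x) \<le> \<Phi> (lip_majorant (real n) q x)" for x using lip_majorant_ge[of "real n" q N x] q by simp
  qed
  have "a * \<Psi> (\<integral>x. \<Phi> (v x) \<partial>\<mu>) + b * \<Psi> (\<integral>x. \<Phi> (w x) \<partial>\<mu>) \<le> \<Psi> (\<integral>x. \<Phi> (lip_majorant (real n) u x) \<partial>\<mu>)" for n
  proof -
    have "a * \<Psi> (\<integral>x. \<Phi> (v x) \<partial>\<mu>) + b * \<Psi> (\<integral>x. \<Phi> (w x) \<partial>\<mu>)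
      \<le> a * \<Psi> (\<integral>x. \<Phi> (lip_majorant (real n) v x) \<partial>\<mu>) + b * \<Psi> (\<integral>x. \<Phi> (lip_majorant (real n) w x) \<partial>\<mu>)"
      using ab bd by (intro add_mono mult_left_mono mono) auto
    also have "\<dots> \<le> \<Psi> (\<integral>x. \<Phi> (lip_majorant (real n) u x) \<partial>\<mu>)"
      by (rule ehrhard_lipschitz[OF ab cond, where N = N and L = "real n"])
        (rule lip_majorant_bound lip_majorant_lipschitz lip_majorant_sup_convolution[OF ab, where N = N] | rule bd le | simp)+
    finally show ?thesis .
  qed
  moreover have "(\<lambda>n. \<Psi> (\<integral>x. \<Phi> (lip_majorant (real n) u x) \<partial>\<mu>)) \<longlonglongrightarrow> \<Psi> (\<integral>x. \<Phi> (u x) \<partial>\<mu>)"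
  proof -
    have "(\<lambda>n. \<integral>x. \<Phi> (lip_majorant (real n) u x) \<partial>\<mu>) \<longlonglongrightarrow> (\<integral>x. \<Phi> (u x) \<partial>\<mu>)"
    proof (rule integral_dominated_convergence[where w = "\<lambda>_. 1"])
      have "(\<lambda>n. \<Phi> (lip_majorant (real n) u x)) \<longlonglongrightarrow> \<Phi> (u x)" for x
        by (rule isCont_tendsto_compose[OF DERIV_isCont[OF cdf_deriv] lip_majorant_tendsto[OF bd(3) usc]])
      then show "AE x in \<mu>. (\<lambda>n. \<Phi> (lip_majorant (real n) u x)) \<longlonglongrightarrow> \<Phi> (u x)" by simp
      show "AE x in \<mu>. norm (\<Phi> (lip_majorant (real n) u x)) \<le> 1" for n by (simp add: cdf_nonneg cdf_bounded_prob)
    qed auto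
    moreover have "isCont \<Psi> (\<integral>x. \<Phi> (u x) \<partial>\<mu>)"
      by (rule DERIV_isCont[OF Psi_deriv]) (rule integral_cdf_pos, measurable)+
    ultimately show ?thesis by (rule isCont_tendsto_compose[rotated])
  qed
  ultimately show ?thesis by (intro tendsto_lowerbound[OF _ always_eventually]) auto
qed

end

section \<open>From semicontinuous functions to Borel functions and the essential supremum\<close>

text \<open>Points around which \<open>A\<close> fills at least three fifths of the interval of radius \<open>r\<close>. More than one
  half is what matters: two such sets always meet in a set of positive measure after a reflection.
  Since the scale \<open>r\<close> is fixed, the condition is closed.\<close>

definition thick :: "real \<Rightarrow> real set \<Rightarrow> real set" where
  "thick r A = {x. 6 / 5 * r \<le> measure lborel (A \<inter> {x - r..x + r})}"

lemma Int_Icc_fmeasurable: assumes "A \<in> sets borel" shows "A \<inter> {x..y::real} \<in> fmeasurable lborel"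
  by (rule fmeasurableI2[of "{x..y}"]) (use assms in \<open>auto simp: fmeasurable_def emeasure_lborel_Icc_eq\<close>)

lemma closed_thick: assumes A: "A \<in> sets borel" shows "closed (thick r A)"
proof -
  define F where "F x = measure lborel (A \<inter> {x - r..x + r})" for x
  have F: "F x \<le> F x' + \<bar>x - x'\<bar>" for x x'
  proof -
    let ?B = "A \<inter> {x' - r..x' + r}" and ?C = "UNIV \<inter> {x - r..x' - r}" and ?D = "UNIV \<inter> {x' + r..x + r}"
    have fm: "?B \<in> fmeasurable lborel" "?C \<in> fmeasurable lborel" "?D \<in> fmeasurable lborel"
      by (rule Int_Icc_fmeasurable, use A in simp)+
    have "F x \<le> measure lborel (?B \<union> (?C \<union> ?D))" unfolding F_def
      by (rule measure_mono_fmeasurable) (use A fm in auto)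
    also have "\<dots> \<le> measure lborel ?B + measure lborel (?C \<union> ?D)"
      by (rule measure_Un_le) (use A in auto)
    also have "measure lborel (?C \<union> ?D) \<le> measure lborel ?C + measure lborel ?D"
      by (rule measure_Un_le) auto
    also have "measure lborel ?C + measure lborel ?D \<le> \<bar>x - x'\<bar>"
      by (cases "x \<le> x'") (auto simp: measure_def emeasure_lborel_Icc_eq)
    finally show ?thesis by (simp add: F_def)
  qed
  have "1-lipschitz_on UNIV F"
  proof (rule lipschitz_onI)
    fix x y show "dist (F x) (F y) \<le> 1 * dist x y" using F[of x y] F[of y x] by (simp add: dist_real_def)
  qed simp
  then have "continuous_on UNIV F" by (rule lipschitz_on_continuous_on)
  then have "closed {x. 6 / 5 * r \<le> F x}" by (intro closed_Collect_le) auto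
  then show ?thesis by (simp add: thick_def F_def)
qed

lemma emeasure_lborel_translate: fixes B :: "real set" assumes "B \<in> sets borel"
  shows "emeasure lborel {x. s + x \<in> B} = emeasure lborel B"
proof -
  have "emeasure lborel B = emeasure (distr lborel borel ((+) s)) B" by (simp add: lborel_distr_plus)
  also have "\<dots> = emeasure lborel {x. s + x \<in> B}"
    using assms by (subst emeasure_distr) (auto intro!: arg_cong[of _ _ "emeasure lborel"])
  finally show ?thesis ..
qed

lemma emeasure_lborel_scale: fixes B :: "real set" assumes [measurable]: "B \<in> sets borel" and "c \<noteq> 0"
  shows "emeasure lborel {x. t + c * x \<in> B} = ennreal (1 / \<bar>c\<bar>) * emeasure lborel B"
proof -
  have "emeasure lborel B = \<bar>c\<bar> * (\<integral>\<^sup>+x. indicator B (t + c * x) \<partial>lborel)"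
    using nn_integral_real_affine[of "indicator B" c t] assms by simp
  also have "(\<integral>\<^sup>+x. indicator B (t + c * x) \<partial>lborel) = (\<integral>\<^sup>+x. indicator {x. t + c * x \<in> B} x \<partial>lborel)"
    by (intro nn_integral_cong) (simp split: split_indicator)
  also have "\<dots> = emeasure lborel {x. t + c * x \<in> B}"
    by (rule nn_integral_indicator) measurable
  finally show ?thesis
    using assms(2) by (simp add: mult.assoc[symmetric] ennreal_mult[symmetric])
qed

text \<open>After scaling, and reflecting one of them by \<open>t \<mapsto> a x + b y - t\<close>, both sets occupy more than half of the
  same interval of length \<open>2 r\<close>.\<close>

lemma reflected_sets_meet:
  fixes A B :: "real set"
  assumes [measurable]: "A \<in> sets borel" "B \<in> sets borel" and ab: "a > 0" "b > 0" and r: "r > 0"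
    and x: "x \<in> thick (r / a) A" and y: "y \<in> thick (r / b) B"
  shows "emeasure lborel {t. ((a * x + b * y) - t) / a \<in> A \<and> t / b \<in> B} > 0"
proof -
  let ?z = "a * x + b * y"
  let ?I = "{b * y - r..b * y + r}"
  let ?X = "{t. ?z / a + (- 1 / a) * t \<in> A \<inter> {x - r / a..x + r / a}}"
  let ?Y = "{t. 0 + (1 / b) * t \<in> B \<inter> {y - r / b..y + r / b}}"
  have thick_e: "ennreal (6 / 5 * r / c) \<le> emeasure lborel (S \<inter> {p - r / c..p + r / c})"
    if "p \<in> thick (r / c) S" "S \<in> sets borel" for p c S
  proof -
    have "6 / 5 * r / c \<le> measure lborel (S \<inter> {p - r / c..p + r / c})" using that(1) by (simp add: thick_def)
    then show ?thesis
      using Int_Icc_fmeasurable[OF that(2)] by (simp add: emeasure_eq_measure2 ennreal_leI)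
  qed
  have X: "ennreal (6 / 5 * r) \<le> emeasure lborel ?X"
  proof -
    have "ennreal (6 / 5 * r) = ennreal (1 / \<bar>- 1 / a\<bar>) * ennreal (6 / 5 * r / a)"
      using ab r by (simp add: ennreal_mult[symmetric])
    also have "\<dots> \<le> ennreal (1 / \<bar>- 1 / a\<bar>) * emeasure lborel (A \<inter> {x - r / a..x + r / a})"
      by (intro mult_left_mono thick_e x) auto
    also have "\<dots> = emeasure lborel ?X"
      by (rule emeasure_lborel_scale[symmetric]) (use ab in auto)
    finally show ?thesis .
  qed
  have Y: "ennreal (6 / 5 * r) \<le> emeasure lborel ?Y"
  proof -
    have "ennreal (6 / 5 * r) = ennreal (1 / \<bar>1 / b\<bar>) * ennreal (6 / 5 * r / b)"
      using ab r by (simp add: ennreal_mult[symmetric])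
    also have "\<dots> \<le> ennreal (1 / \<bar>1 / b\<bar>) * emeasure lborel (B \<inter> {y - r / b..y + r / b})"
      by (intro mult_left_mono thick_e y) auto
    also have "\<dots> = emeasure lborel ?Y"
      by (rule emeasure_lborel_scale[symmetric]) (use ab in auto)
    finally show ?thesis .
  qed
  have XI: "?X \<subseteq> ?I"
  proof
    fix t assume "t \<in> ?X"
    then have "(a * x - r) / a \<le> (?z - t) / a" "(?z - t) / a \<le> (a * x + r) / a"
      using ab by (simp_all add: add_divide_distrib diff_divide_distrib)
    then show "t \<in> ?I" using ab by (simp add: divide_le_cancel)
  qed
  have YI: "?Y \<subseteq> ?I"
  proof
    fix t assume "t \<in> ?Y"
    then have "(b * y - r) / b \<le> t / b" "t / b \<le> (b * y + r) / b"
      using ab by (simp_all add: add_divide_distrib diff_divide_distrib)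
    then show "t \<in> ?I" using ab by (simp add: divide_le_cancel)
  qed
  have [measurable]: "?X \<in> sets borel" "?Y \<in> sets borel" by measurable
  have "\<not> emeasure lborel (?X \<inter> ?Y) = 0"
  proof
    assume "emeasure lborel (?X \<inter> ?Y) = 0"
    then have "emeasure lborel ?X + emeasure lborel ?Y = emeasure lborel (?X \<union> ?Y)"
      by (intro emeasure_Un'[symmetric]) auto
    also have "\<dots> \<le> emeasure lborel ?I" using XI YI by (intro emeasure_mono) auto
    also have "\<dots> = ennreal (2 * r)" using r by simp
    finally have "ennreal (6 / 5 * r) + ennreal (6 / 5 * r) \<le> ennreal (2 * r)"
      using add_mono[OF X Y] by (rule order_trans[rotated])
    then show False using r by (simp add: ennreal_plus[symmetric] del: ennreal_plus)
  qed
  then have "0 < emeasure lborel (?X \<inter> ?Y)" by (simp add: zero_less_iff_neq_zero)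
  moreover have "?X \<inter> ?Y \<subseteq> {t. (?z - t) / a \<in> A \<and> t / b \<in> B}"
    by (auto simp: diff_divide_distrib)
  then have "emeasure lborel (?X \<inter> ?Y) \<le> emeasure lborel {t. (?z - t) / a \<in> A \<and> t / b \<in> B}"
    by (intro emeasure_mono) auto
  ultimately show ?thesis by (rule less_le_trans)
qed

context gaussian
begin

lemma mu_le_lborel: assumes [measurable]: "B \<in> sets borel" shows "emeasure \<mu> B \<le> emeasure lborel B"
proof -
  have "std_normal_density x \<le> 1" for x
  proof -
    have "exp (- x\<^sup>2 / 2) \<le> 1" by simp
    moreover have "1 \<le> sqrt (2 * pi)" using pi_ge_two by simp
    ultimately have "exp (- x\<^sup>2 / 2) / sqrt (2 * pi) \<le> 1" by (subst divide_le_eq_1_pos) linarith+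
    then show ?thesis by (simp add: std_normal_density_def)
  qed
  then have "(\<integral>\<^sup>+x. ennreal (std_normal_density x) * indicator B x \<partial>lborel) \<le> (\<integral>\<^sup>+x. indicator B x \<partial>lborel)"
    by (intro nn_integral_mono) (auto split: split_indicator)
  then show ?thesis unfolding mu_eq by (simp add: emeasure_density)
qed

text \<open>Up to a small loss \<open>A\<close> is a compact set, whose small translates stay in an open set of almost the
  same Lebesgue measure; translation invariance then bounds what leaves the compact set.\<close>

lemma translation_loss_small:
  assumes A[measurable]: "A \<in> sets borel" and e: "e > 0"
  shows "\<exists>d>0. \<forall>s. \<bar>s\<bar> < d \<longrightarrow> emeasure \<mu> {x\<in>A. x + s \<notin> A} \<le> ennreal e"
proof -
  obtain C where C: "C \<subseteq> A" "compact C" "measure \<mu> A - e / 2 \<le> measure \<mu> C"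
  proof (cases "measure \<mu> A \<le> e / 2")
    case True then show ?thesis using that[of "{}"] by auto
  next
    case False
    then have "ennreal (measure \<mu> A - e / 2) < emeasure \<mu> A"
      using e by (simp add: emeasure_eq_measure ennreal_less_iff)
    also have "emeasure \<mu> A = (SUP K \<in> {K. K \<subseteq> A \<and> compact K}. emeasure \<mu> K)"
      by (rule inner_regular) (auto simp: emeasure_eq_measure)
    finally obtain K where "K \<subseteq> A" "compact K" "ennreal (measure \<mu> A - e / 2) < emeasure \<mu> K"
      unfolding less_SUP_iff by auto
    then show ?thesis using that[of K] False by (simp add: emeasure_eq_measure ennreal_less_iff)
  qed
  have Cm[measurable]: "C \<in> sets borel" using C(2) by (simp add: borel_compact)
  have AC: "emeasure \<mu> (A - C) \<le> ennreal (e / 2)"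
    using C by (simp add: emeasure_eq_measure finite_measure_Diff ennreal_leI)
  obtain U where U: "open U" "C \<subseteq> U" "emeasure lborel (U - C) \<le> e / 2"
    using outer_regular_lborel_le[OF Cm, of "e / 2"] e by auto
  obtain d where d: "d > 0" "(\<Union>x\<in>C. ball x d) \<subseteq> U"
    using compact_subset_open_imp_ball_epsilon_subset[OF C(2) U(1,2)] .
  have [measurable]: "U \<in> sets borel" using U(1) by simp
  have "emeasure \<mu> {x\<in>A. x + s \<notin> A} \<le> ennreal e" if s: "\<bar>s\<bar> < d" for s
  proof -
    have "emeasure \<mu> {x\<in>A. x + s \<notin> A} \<le> emeasure \<mu> ((A - C) \<union> {x. s + x \<in> {y. y - s \<in> C \<and> y \<notin> C}})"
      using C(1) by (intro emeasure_mono) (auto simp: add.commute)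
    also have "\<dots> \<le> emeasure \<mu> (A - C) + emeasure \<mu> {x. s + x \<in> {y. y - s \<in> C \<and> y \<notin> C}}"
      by (rule emeasure_subadditive) measurable
    also have "emeasure \<mu> {x. s + x \<in> {y. y - s \<in> C \<and> y \<notin> C}} \<le> emeasure lborel {x. s + x \<in> {y. y - s \<in> C \<and> y \<notin> C}}"
      by (rule mu_le_lborel) measurable
    also have "\<dots> = emeasure lborel {y. y - s \<in> C \<and> y \<notin> C}"
      by (rule emeasure_lborel_translate) measurable
    also have "\<dots> \<le> emeasure lborel (U - C)"
    proof (rule emeasure_mono)
      show "{y. y - s \<in> C \<and> y \<notin> C} \<subseteq> U - C"
      proof
        fix y assume y: "y \<in> {y. y - s \<in> C \<and> y \<notin> C}"
        then have "y \<in> ball (y - s) d" using s by (simp add: dist_real_def)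
        then have "y \<in> (\<Union>x\<in>C. ball x d)" using y by blast
        then show "y \<in> U - C" using y d(2) by blast
      qed
    qed measurable
    also have "\<dots> \<le> ennreal (e / 2)" by (rule U(3))
    also have "emeasure \<mu> (A - C) \<le> ennreal (e / 2)" by (rule AC)
    also have "ennreal (e / 2) + ennreal (e / 2) = ennreal e" using e by (simp add: ennreal_plus[symmetric] del: ennreal_plus)
    finally show ?thesis by (simp add: add_mono)
  qed
  then show ?thesis using d(1) by blast
qed

text \<open>A quantitative substitute for the Lebesgue density theorem: on the part of \<open>A\<close> outside
  \<open>thick r A\<close>, translations by less than \<open>r\<close> leave \<open>A\<close> with probability at least two fifths.\<close>

lemma thick_full:
  assumes A[measurable]: "A \<in> sets borel" and e: "e > 0"
  shows "\<exists>d>0. \<forall>r. 0 < r \<longrightarrow> r < d \<longrightarrow> measure \<mu> (A - thick r A) \<le> e"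
proof -
  obtain d where d: "d > 0" "\<And>s. \<bar>s\<bar> < d \<Longrightarrow> emeasure \<mu> {x\<in>A. x + s \<notin> A} \<le> ennreal (2 / 5 * e)"
    using translation_loss_small[OF A, of "2 / 5 * e"] e by auto
  have "measure \<mu> (A - thick r A) \<le> e" if r: "0 < r" "r < d" for r
  proof -
    have [measurable]: "thick r A \<in> sets borel" using closed_thick[OF A] by simp
    interpret P: pair_sigma_finite \<mu> lborel by unfold_locales
    let ?bad = "A - thick r A"
    define k where "k x s = indicator ?bad x * (indicator {-r..r} s * indicator (- A) (x + s) :: ennreal)" for x s
    have k[measurable]: "(\<lambda>(x, s). k x s) \<in> borel_measurable (\<mu> \<Otimes>\<^sub>M lborel)"
      unfolding k_def by measurable
    have low: "ennreal (4 / 5 * r) * indicator ?bad x \<le> (\<integral>\<^sup>+s. k x s \<partial>lborel)" for x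
    proof (cases "x \<in> ?bad")
      case True
      then have x: "measure lborel (A \<inter> {x - r..x + r}) < 6 / 5 * r" by (simp add: thick_def)
      have "measure lborel ({x - r..x + r} - A) = measure lborel ({x - r..x + r} - (A \<inter> {x - r..x + r}))"
        by (rule arg_cong[of _ _ "measure lborel"]) auto
      also have "\<dots> = measure lborel {x - r..x + r} - measure lborel (A \<inter> {x - r..x + r})"
        by (rule measure_Diff) (auto simp: emeasure_lborel_Icc_eq)
      finally have m: "4 / 5 * r \<le> measure lborel ({x - r..x + r} - A)" using x r by simp
      have fin: "{x - r..x + r} - A \<in> fmeasurable lborel"
        by (rule fmeasurableI2[of "{x - r..x + r}"]) (auto simp: fmeasurable_def emeasure_lborel_Icc_eq)
      have "(\<integral>\<^sup>+s. k x s \<partial>lborel) = (\<integral>\<^sup>+s. indicator {s. x + s \<in> {x - r..x + r} - A} s \<partial>lborel)"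
        using True by (intro nn_integral_cong) (auto simp: k_def split: split_indicator)
      also have "\<dots> = emeasure lborel {s. x + s \<in> {x - r..x + r} - A}" by (rule nn_integral_indicator) measurable
      also have "\<dots> = emeasure lborel ({x - r..x + r} - A)" by (rule emeasure_lborel_translate) measurable
      also have "\<dots> = ennreal (measure lborel ({x - r..x + r} - A))" by (rule emeasure_eq_measure2[OF fin])
      finally show ?thesis using True m by (simp add: ennreal_leI)
    qed simp
    have "ennreal (4 / 5 * r) * emeasure \<mu> ?bad = (\<integral>\<^sup>+x. ennreal (4 / 5 * r) * indicator ?bad x \<partial>\<mu>)"
      by (subst nn_integral_cmult_indicator) auto
    also have "\<dots> \<le> (\<integral>\<^sup>+x. (\<integral>\<^sup>+s. k x s \<partial>lborel) \<partial>\<mu>)" by (rule nn_integral_mono) (rule low)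
    also have "\<dots> = (\<integral>\<^sup>+s. (\<integral>\<^sup>+x. k x s \<partial>\<mu>) \<partial>lborel)" by (rule P.Fubini'[symmetric]) (rule k)
    also have "\<dots> \<le> (\<integral>\<^sup>+s. ennreal (2 / 5 * e) * indicator {-r..r} s \<partial>lborel)"
    proof (rule nn_integral_mono)
      fix s
      have "(\<integral>\<^sup>+x. k x s \<partial>\<mu>) \<le> (\<integral>\<^sup>+x. indicator {-r..r} s * indicator {x\<in>A. x + s \<notin> A} x \<partial>\<mu>)"
        by (intro nn_integral_mono) (auto simp: k_def split: split_indicator)
      also have "\<dots> = indicator {-r..r} s * emeasure \<mu> {x\<in>A. x + s \<notin> A}"
        by (rule nn_integral_cmult_indicator) measurable
      also have "\<dots> \<le> ennreal (2 / 5 * e) * indicator {-r..r} s"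
        using d(2)[of s] r by (auto split: split_indicator)
      finally show "(\<integral>\<^sup>+x. k x s \<partial>\<mu>) \<le> ennreal (2 / 5 * e) * indicator {-r..r} s" .
    qed
    also have "\<dots> = ennreal (2 / 5 * e) * ennreal (2 * r)"
      using r by (subst nn_integral_cmult_indicator) auto
    finally have "ennreal (4 / 5 * r) * emeasure \<mu> ?bad \<le> ennreal (2 / 5 * e) * ennreal (2 * r)" .
    moreover have "ennreal (4 / 5 * r * measure \<mu> ?bad) = ennreal (4 / 5 * r) * emeasure \<mu> ?bad"
      by (subst emeasure_eq_measure, rule ennreal_mult) (use r in auto)
    moreover have "ennreal (2 / 5 * e * (2 * r)) = ennreal (2 / 5 * e) * ennreal (2 * r)"
      by (rule ennreal_mult) (use r e in auto)
    ultimately have "ennreal (4 / 5 * r * measure \<mu> ?bad) \<le> ennreal (2 / 5 * e * (2 * r))" by (simp only:)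
    then have "4 / 5 * r * measure \<mu> ?bad \<le> 2 / 5 * e * (2 * r)"
      using r e by (subst (asm) ennreal_le_iff) auto
    then have "(4 / 5 * r) * measure \<mu> ?bad \<le> (4 / 5 * r) * e" by (simp add: algebra_simps)
    then show ?thesis using r by (subst (asm) mult_le_cancel_left_pos) auto
  qed
  then show ?thesis using d(1) by blast
qed

lemma thick_compact:
  assumes A[measurable]: "A \<in> sets borel" and e: "e > 0" and c: "c > 0"
  shows "\<forall>\<^sub>F r in at_right 0. \<exists>K. compact K \<and> K \<subseteq> thick (r / c) A \<and> measure \<mu> (A - K) \<le> e"
proof -
  obtain d where d: "d > 0" "\<And>r. 0 < r \<Longrightarrow> r < d \<Longrightarrow> measure \<mu> (A - thick r A) \<le> e / 2"
    using thick_full[OF A, of "e / 2"] e by auto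
  have "(\<lambda>M::nat. measure \<mu> {- real M..real M}) \<longlonglongrightarrow> measure \<mu> (\<Union>M::nat. {- real M..real M})"
    by (rule finite_Lim_measure_incseq) (auto simp: incseq_def)
  also have "(\<Union>M::nat. {- real M..real M}) = UNIV"
  proof (rule UNIV_eq_I[symmetric])
    fix x :: real obtain n :: nat where "\<bar>x\<bar> \<le> real n" using real_arch_simple by blast
    then show "x \<in> (\<Union>M::nat. {- real M..real M})" by (auto intro!: exI[of _ n])
  qed
  finally have "\<forall>\<^sub>F M in sequentially. 1 - e / 2 < measure \<mu> {- real M..real M}"
    by (rule order_tendstoD) (use e prob_space in simp)
  then obtain M :: nat where M: "1 - e / 2 < measure \<mu> {- real M..real M}"
    using eventually_happens'[OF sequentially_bot] by blast
  have M': "measure \<mu> (- {- real M..real M}) \<le> e / 2"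
    using M prob_compl[of "{- real M..real M}"] by (simp add: Compl_eq_Diff_UNIV)
  have "\<exists>K. compact K \<and> K \<subseteq> thick (r / c) A \<and> measure \<mu> (A - K) \<le> e" if r: "0 < r" "r < c * d" for r
  proof (intro exI conjI)
    let ?K = "{- real M..real M} \<inter> thick (r / c) A"
    have th[measurable]: "thick (r / c) A \<in> sets borel" using closed_thick[OF A] by simp
    show "compact ?K" by (intro compact_Int_closed compact_Icc closed_thick A)
    show "?K \<subseteq> thick (r / c) A" by simp
    have "measure \<mu> (A - ?K) \<le> measure \<mu> ((A - thick (r / c) A) \<union> (- {- real M..real M}))"
      by (rule finite_measure_mono) auto
    also have "\<dots> \<le> measure \<mu> (A - thick (r / c) A) + measure \<mu> (- {- real M..real M})"
      by (rule measure_Un_le) auto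
    also have "\<dots> \<le> e / 2 + e / 2"
      using r c by (intro add_mono M' d(2)) (auto simp: field_simps)
    finally show "measure \<mu> (A - ?K) \<le> e" by simp
  qed
  then show ?thesis
    unfolding eventually_at_right_field using c d(1) by (intro exI[of _ "c * d"]) auto
qed

lemma level_sets_thick_compact:
  assumes [measurable]: "f \<in> borel_measurable borel" and e: "e > 0" and c: "c > 0"
  shows "\<forall>\<^sub>F r in at_right 0. \<exists>K. \<forall>k\<in>{1..<m::nat}. compact (K k) \<and>
           K k \<subseteq> thick (r / c) {x. real k / real m \<le> f x} \<and> measure \<mu> ({x. real k / real m \<le> f x} - K k) \<le> e"
proof -
  have "\<forall>\<^sub>F r in at_right 0. \<forall>k\<in>{1..<m}. \<exists>K. compact K \<and>
      K \<subseteq> thick (r / c) {x. real k / real m \<le> f x} \<and> measure \<mu> ({x. real k / real m \<le> f x} - K) \<le> e"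
    by (intro eventually_ball_finite ballI thick_compact e c) auto
  then show ?thesis by (rule eventually_mono) (rule bchoice)
qed

text \<open>If \<open>t0\<close> lies below all quantiles, this function equals the quantile \<open>\<Psi> (k / m)\<close> on \<open>K k\<close> (the
  largest one where these sets overlap) and \<open>t0\<close> elsewhere. Index \<open>0\<close> stands for the default value, which also keeps the maximum
  away from the empty set.\<close>

definition level_step :: "nat \<Rightarrow> real \<Rightarrow> (nat \<Rightarrow> real set) \<Rightarrow> real \<Rightarrow> real" where
  "level_step m t0 K x = Max ((\<lambda>k. if 1 \<le> k \<and> x \<in> K k then \<Psi> (real k / real m) else t0) ` {..<m})"

lemma level_step_measurable:
  assumes "\<And>k. k \<in> {1..<m} \<Longrightarrow> compact (K k)"
  shows "level_step m t0 K \<in> borel_measurable borel"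
  unfolding level_step_def[abs_def]
proof (rule borel_measurable_Max)
  fix k assume k: "k \<in> {..<m}"
  show "(\<lambda>x. if 1 \<le> k \<and> x \<in> K k then \<Psi> (real k / real m) else t0) \<in> borel_measurable borel"
  proof (cases "1 \<le> k")
    case True
    then have [measurable]: "K k \<in> sets borel" using assms k by (simp add: borel_compact)
    show ?thesis by measurable
  qed simp
qed simp

lemma level_step_cases:
  assumes "m \<ge> 1"
  shows "level_step m t0 K x = t0 \<or> (\<exists>k\<in>{1..<m}. x \<in> K k \<and> level_step m t0 K x = \<Psi> (real k / real m))"
proof -
  have "level_step m t0 K x \<in> (\<lambda>k. if 1 \<le> k \<and> x \<in> K k then \<Psi> (real k / real m) else t0) ` {..<m}"
    unfolding level_step_def
  proof (rule Max_in)
    show "(\<lambda>k. if 1 \<le> k \<and> x \<in> K k then \<Psi> (real k / real m) else t0) ` {..<m} \<noteq> {}"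
      unfolding image_is_empty using assms by (simp add: lessThan_empty_iff)
  qed simp
  then show ?thesis by (auto split: if_splits)
qed

lemma level_step_ge: assumes "k \<in> {1..<m}" "x \<in> K k" shows "\<Psi> (real k / real m) \<le> level_step m t0 K x"
  unfolding level_step_def by (rule Max_ge) (use assms in \<open>auto intro!: image_eqI[of _ _ k]\<close>)

lemma level_step_integral:
  assumes [measurable]: "f \<in> borel_measurable borel" and f: "\<And>x. 0 \<le> f x \<and> f x \<le> 1" and m: "m \<ge> 1"
    and K: "\<And>k. k \<in> {1..<m} \<Longrightarrow> compact (K k)"
      "\<And>k. k \<in> {1..<m} \<Longrightarrow> measure \<mu> ({x. real k / real m \<le> f x} - K k) \<le> e" and e: "e \<ge> 0"
  shows "(\<integral>x. f x \<partial>\<mu>) \<le> (\<integral>x. \<Phi> (level_step m t0 K x) \<partial>\<mu>) + 1 / real m + real m * e"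
proof -
  let ?v = "level_step m t0 K"
  let ?N = "\<lambda>k. {x. real k / real m \<le> f x} - K k"
  have [measurable]: "?v \<in> borel_measurable borel" by (rule level_step_measurable[OF K(1)])
  have N[measurable]: "?N k \<in> sets borel" if "k \<in> {1..<m}" for k
    using K(1)[OF that] by (auto simp: borel_compact)
  have pw: "f x \<le> \<Phi> (?v x) + 1 / real m + (\<Sum>k\<in>{1..<m}. indicator (?N k) x)" for x
  proof (cases "\<exists>k\<in>{1..<m}. x \<in> ?N k")
    case True
    then obtain k where k: "k \<in> {1..<m}" "x \<in> ?N k" by blast
    have "(1::real) = indicator (?N k) x" using k by simp
    also have "\<dots> \<le> (\<Sum>k\<in>{1..<m}. indicator (?N k) x)" by (rule member_le_sum) (use k in auto)
    moreover have "0 \<le> \<Phi> (?v x) + 1 / real m" by (simp add: cdf_nonneg)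
    ultimately show ?thesis using f[of x] by linarith
  next
    case False
    define k where "k = (if f x = 1 then m - 1 else nat \<lfloor>real m * f x\<rfloor>)"
    have k: "k < m" "real k / real m \<le> f x" "f x \<le> real k / real m + 1 / real m"
    proof -
      have *: "0 \<le> real m * f x" using f[of x] by simp
      show "k < m"
      proof (cases "f x = 1")
        case False
        then have "real m * f x < real m" using f[of x] m by simp
        then show ?thesis using False * by (simp add: k_def) (simp add: floor_less_iff nat_less_iff)
      qed (use m in \<open>simp add: k_def\<close>)
      show "real k / real m \<le> f x"
      proof (cases "f x = 1")
        case False
        have "real k \<le> real m * f x" using False * by (simp add: k_def)
        then show ?thesis using m by (simp add: divide_le_eq mult.commute)
      qed (use m in \<open>simp add: k_def\<close>)
      show "f x \<le> real k / real m + 1 / real m"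
      proof (cases "f x = 1")
        case True
        then show ?thesis using m by (simp add: k_def add_divide_distrib[symmetric])
      next
        case False
        have "real m * f x \<le> real k + 1" using False * by (simp add: k_def)
        then show ?thesis using m by (simp add: add_divide_distrib[symmetric] le_divide_eq mult.commute)
      qed
    qed
    have "real k / real m \<le> \<Phi> (?v x)"
    proof (cases "k = 0")
      case False
      then have k1: "k \<in> {1..<m}" using k(1) by simp
      then have "x \<in> K k" using \<open>\<not> (\<exists>k\<in>{1..<m}. x \<in> ?N k)\<close> k(2) by blast
      then have "\<Psi> (real k / real m) \<le> ?v x" by (rule level_step_ge[OF k1])
      then show ?thesis using k1 by (simp add: Psi_le_iff)
    qed (simp add: cdf_nonneg)
    moreover have "0 \<le> (\<Sum>k\<in>{1..<m}. indicator (?N k) x :: real)" by (rule sum_nonneg) simp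
    ultimately show ?thesis using k(3) by linarith
  qed
  have i1: "integrable \<mu> f" by (rule bounded_integrable[where K = 1]) (use f in auto)
  have i2: "integrable \<mu> (\<lambda>x. \<Phi> (?v x))"
    by (rule bounded_integrable[where K = 1]) (simp_all add: cdf_bounded_prob cdf_nonneg)
  have i3: "integrable \<mu> (\<lambda>x. indicator (?N k) x :: real)" if "k \<in> {1..<m}" for k
    using N[OF that] by (simp add: emeasure_eq_measure)
  have i4: "integrable \<mu> (\<lambda>x. \<Sum>k\<in>{1..<m}. indicator (?N k) x :: real)"
    by (rule Bochner_Integration.integrable_sum) (rule i3)
  have "(\<integral>x. f x \<partial>\<mu>) \<le> (\<integral>x. \<Phi> (?v x) + 1 / real m + (\<Sum>k\<in>{1..<m}. indicator (?N k) x) \<partial>\<mu>)"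
    by (intro integral_mono i1 Bochner_Integration.integrable_add i2 i4 pw) simp
  also have "\<dots> = (\<integral>x. \<Phi> (?v x) \<partial>\<mu>) + 1 / real m + (\<Sum>k\<in>{1..<m}. measure \<mu> (?N k))"
  proof -
    have "(\<integral>x. (\<Sum>k\<in>{1..<m}. indicator (?N k) x :: real) \<partial>\<mu>) = (\<Sum>k\<in>{1..<m}. measure \<mu> (?N k))"
      by (subst Bochner_Integration.integral_sum) (use i3 in auto)
    then show ?thesis using i2 i4 by (simp add: prob_space[simplified])
  qed
  also have "(\<Sum>k\<in>{1..<m}. measure \<mu> (?N k)) \<le> (\<Sum>k\<in>{1..<m}. e)" by (rule sum_mono) (rule K(2))
  also have "\<dots> \<le> real m * e" using e by (simp add: mult_right_mono)
  finally show ?thesis by simp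
qed

lemma esssup_ge_on_sumset:
  assumes [measurable]: "f \<in> borel_measurable borel" "g \<in> borel_measurable borel"
    and f: "\<And>x. 0 \<le> f x \<and> f x \<le> 1" and g: "\<And>x. 0 \<le> g x \<and> g x \<le> 1" and ab: "a > 0" "b > 0" and r: "r > 0"
    and x: "x \<in> thick (r / a) {x. \<Phi> s \<le> f x}" and y: "y \<in> thick (r / b) {y. \<Phi> t \<le> g y}"
  shows "ennreal (\<Phi> (a * s + b * t))
    \<le> esssup lborel (\<lambda>\<eta>. ennreal (H_fun \<mu> a b (f (((a * x + b * y) - \<eta>) / a)) (g (\<eta> / b))))"
proof -
  let ?z = "a * x + b * y"
  let ?k = "\<lambda>\<eta>. ennreal (H_fun \<mu> a b (f ((?z - \<eta>) / a)) (g (\<eta> / b)))"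
  let ?T = "{\<eta>. (?z - \<eta>) / a \<in> {x. \<Phi> s \<le> f x} \<and> \<eta> / b \<in> {y. \<Phi> t \<le> g y}}"
  have "0 < emeasure lborel ?T" by (rule reflected_sets_meet[OF _ _ ab r x y]) measurable
  moreover have "?T \<in> sets lborel" by measurable
  ultimately have "\<not> (AE \<eta> in lborel. \<eta> \<notin> ?T)" using AE_iff_null_sets[of ?T lborel] by (auto simp: null_sets_def)
  moreover have "AE \<eta> in lborel. ?k \<eta> \<le> esssup lborel ?k" by (rule esssup_AE)
  ultimately have "\<exists>\<eta>. \<eta> \<in> ?T \<and> ?k \<eta> \<le> esssup lborel ?k"
    using eventually_mono[of "\<lambda>\<eta>. ?k \<eta> \<le> esssup lborel ?k" "ae_filter lborel" "\<lambda>\<eta>. \<eta> \<notin> ?T"] by blast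
  then obtain \<eta> where \<eta>: "\<eta> \<in> ?T" "?k \<eta> \<le> esssup lborel ?k" by blast
  have "ennreal (\<Phi> (a * s + b * t)) \<le> ?k \<eta>"
    by (intro ennreal_leI H_ge_cdf) (use ab f g \<eta>(1) in auto)
  also note \<eta>(2)
  finally show ?thesis .
qed

text \<open>The approximation from below: \<open>f\<close> and \<open>g\<close> are replaced by step functions on compact sets of
  thick points of their level sets, for which the supremal convolution is upper semicontinuous and
  lies below the essential one. Off these sets the step functions take a value \<open>t0\<close> so negative
  that it cannot be compensated by the other function.\<close>

lemma ehrhard_below_means:
  assumes ab: "a > 0" "b > 0" and cond: "\<bar>1 - a\<^sup>2 - b\<^sup>2\<bar> \<le> 2 * a * b"
    and [measurable]: "f \<in> borel_measurable borel" "g \<in> borel_measurable borel"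
    and f: "\<And>x. 0 \<le> f x \<and> f x \<le> 1" and g: "\<And>x. 0 \<le> g x \<and> g x \<le> 1"
    and \<alpha>: "0 < \<alpha>" "\<alpha> < (\<integral>x. f x \<partial>\<mu>)" and \<beta>: "0 < \<beta>" "\<beta> < (\<integral>x. g x \<partial>\<mu>)" and \<omega>: "0 < \<omega>" "\<omega> < 1"
  shows "ennreal (\<Phi> (a * \<Psi> \<alpha> + b * \<Psi> \<beta>) - \<omega>)
    \<le> (\<integral>\<^sup>+z. esssup lborel (\<lambda>y. ennreal (H_fun \<mu> a b (f ((z - y) / a)) (g (y / b)))) \<partial>\<mu>)"
proof -
  define gap where "gap = min ((\<integral>x. f x \<partial>\<mu>) - \<alpha>) ((\<integral>x. g x \<partial>\<mu>) - \<beta>)"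
  have gap: "gap > 0" using \<alpha> \<beta> by (simp add: gap_def)
  have gle: "gap \<le> (\<integral>x. f x \<partial>\<mu>) - \<alpha>" "gap \<le> (\<integral>x. g x \<partial>\<mu>) - \<beta>" by (simp_all add: gap_def)
  obtain m0 :: nat where m0: "2 / gap \<le> real m0" using real_arch_simple by blast
  define m where "m = max m0 2"
  have m: "m \<ge> 2" "1 / real m \<le> gap / 2"
  proof -
    have "2 / gap \<le> real m" using m0 by (simp add: m_def)
    then show "1 / real m \<le> gap / 2" using gap by (simp add: m_def field_simps)
  qed (simp add: m_def)
  define e where "e = gap / 2 / real m"
  have e: "e > 0" "real m * e = gap / 2" using gap m by (simp_all add: e_def)
  have "\<forall>\<^sub>F r in at_right 0. r > (0::real)" by (simp add: eventually_at_right_less)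
  then have "\<forall>\<^sub>F r in at_right 0. r > 0 \<and>
      (\<exists>K. \<forall>k\<in>{1..<m}. compact (K k) \<and> K k \<subseteq> thick (r / a) {x. real k / real m \<le> f x} \<and> measure \<mu> ({x. real k / real m \<le> f x} - K k) \<le> e) \<and>
      (\<exists>K. \<forall>k\<in>{1..<m}. compact (K k) \<and> K k \<subseteq> thick (r / b) {x. real k / real m \<le> g x} \<and> measure \<mu> ({x. real k / real m \<le> g x} - K k) \<le> e)"
    by (intro eventually_conj level_sets_thick_compact e ab) measurable
  from eventually_happens'[OF trivial_limit_at_right_real this] obtain r K L where r: "r > 0"
    and K: "\<And>k. k \<in> {1..<m} \<Longrightarrow> compact (K k)" "\<And>k. k \<in> {1..<m} \<Longrightarrow> K k \<subseteq> thick (r / a) {x. real k / real m \<le> f x}"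
      "\<And>k. k \<in> {1..<m} \<Longrightarrow> measure \<mu> ({x. real k / real m \<le> f x} - K k) \<le> e"
    and L: "\<And>k. k \<in> {1..<m} \<Longrightarrow> compact (L k)" "\<And>k. k \<in> {1..<m} \<Longrightarrow> L k \<subseteq> thick (r / b) {x. real k / real m \<le> g x}"
      "\<And>k. k \<in> {1..<m} \<Longrightarrow> measure \<mu> ({x. real k / real m \<le> g x} - L k) \<le> e"
    by blast
  define \<tau> where "\<tau> k = \<Psi> (real k / real m)" for k
  define top where "top = \<tau> (m - 1)"
  define c0 where "c0 = \<Psi> \<omega>"
  define t0 where "t0 = min (\<tau> 1) (min ((c0 - b * top) / a) ((c0 - a * top) / b))"
  have lev: "0 < real k / real m" "real k / real m < 1" if "k \<in> {1..<m}" for k using that by auto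
  have \<tau>: "\<tau> 1 \<le> \<tau> k" "\<tau> k \<le> top" if "k \<in> {1..<m}" for k
    unfolding \<tau>_def top_def using that m by (auto intro!: Psi_mono divide_right_mono simp: of_nat_diff)
  have t0: "t0 \<le> \<tau> 1" "a * t0 + b * top \<le> c0" "a * top + b * t0 \<le> c0"
  proof -
    show "t0 \<le> \<tau> 1" by (simp add: t0_def)
    have "t0 \<le> (c0 - b * top) / a" "t0 \<le> (c0 - a * top) / b" by (simp_all add: t0_def)
    then show "a * t0 + b * top \<le> c0" "a * top + b * t0 \<le> c0"
      using ab by (simp_all add: pos_le_divide_eq mult.commute)
  qed
  have t0top: "t0 \<le> top" using t0(1) \<tau>[of 1] m by simp
  let ?v = "level_step m t0 K" and ?w = "level_step m t0 L"
  have vm[measurable]: "?v \<in> borel_measurable borel" by (rule level_step_measurable[OF K(1)])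
  have wm[measurable]: "?w \<in> borel_measurable borel" by (rule level_step_measurable[OF L(1)])
  have rng: "t0 \<le> level_step m t0 J x" "level_step m t0 J x \<le> top" for J x
    using level_step_cases[of m t0 J x] m \<tau> t0(1) t0top unfolding \<tau>_def[symmetric] by (auto intro: order_trans)
  define I where "I = {1..<m} \<times> {1..<m}"
  define S where "S p = (\<lambda>q. a * fst q + b * snd q) ` (K (fst p) \<times> L (snd p))" for p :: "nat \<times> nat"
  define val where "val p z = (if p \<in> I \<and> z \<in> S p then a * \<tau> (fst p) + b * \<tau> (snd p) else c0)" for p z
  define J where "J = insert (0, 0) I"
  define u where "u z = Max ((\<lambda>p. val p z) ` J)" for z
  have J: "finite J" "J \<noteq> {}" by (simp_all add: J_def I_def)
  have S_closed: "closed (S p)" if "p \<in> I" for p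
    unfolding S_def using that K(1) L(1)
    by (intro compact_imp_closed compact_continuous_image compact_Times continuous_intros) (auto simp: I_def)
  have val_meas: "val p \<in> borel_measurable borel" for p
  proof (cases "p \<in> I")
    case True
    then have [measurable]: "S p \<in> sets borel" using S_closed by simp
    show ?thesis unfolding val_def[abs_def] by measurable
  qed (simp add: val_def[abs_def])
  have um[measurable]: "u \<in> borel_measurable borel"
    unfolding u_def[abs_def] by (intro borel_measurable_Max J val_meas)
  have u_ge: "val p z \<le> u z" if "p \<in> J" for p z
    unfolding u_def using that J by (intro Max_ge) auto
  have u_in: "\<exists>p\<in>J. u z = val p z" for z
  proof -
    have "u z \<in> (\<lambda>p. val p z) ` J" unfolding u_def using J by (intro Max_in) auto
    then show ?thesis by blast
  qed
  have u_c0: "c0 \<le> u z" for z using u_ge[of "(0, 0)" z] by (simp add: J_def val_def I_def)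
  have usc: "eventually (\<lambda>y. u y < c) (nhds z)" if "u z < c" for z c
  proof -
    have "\<forall>p\<in>J. eventually (\<lambda>y. val p y < c) (nhds z)"
    proof
      fix p assume p: "p \<in> J"
      show "eventually (\<lambda>y. val p y < c) (nhds z)"
      proof (cases "p \<in> I \<and> z \<notin> S p")
        case True
        have "eventually (\<lambda>y. y \<in> - S p) (nhds z)"
          using True S_closed[of p] by (intro eventually_nhds_in_open open_Compl) auto
        then show ?thesis by (rule eventually_mono) (use u_c0[of z] that in \<open>simp add: val_def\<close>)
      next
        case False
        have "val p y \<le> max (val p z) c0" for y using False by (auto simp: val_def)
        moreover have "max (val p z) c0 < c" using u_ge[OF p, of z] u_c0[of z] that by simp
        ultimately have "val p y < c" for y by (meson le_less_trans)
        then show ?thesis by simp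
      qed
    qed
    then have "eventually (\<lambda>y. \<forall>p\<in>J. val p y < c) (nhds z)" by (rule eventually_ball_finite[OF J(1)])
    then show ?thesis by (rule eventually_mono) (use u_in in metis)
  qed
  have le: "a * ?v x + b * ?w y \<le> u (a * x + b * y)" for x y
  proof (cases "?v x = t0 \<or> ?w y = t0")
    case True
    then have "a * ?v x + b * ?w y \<le> c0"
    proof
      assume "?v x = t0"
      moreover have "b * ?w y \<le> b * top" using rng(2) ab by (intro mult_left_mono) auto
      ultimately show ?thesis using t0(2) by simp
    next
      assume "?w y = t0"
      moreover have "a * ?v x \<le> a * top" using rng(2) ab by (intro mult_left_mono) auto
      ultimately show ?thesis using t0(3) by simp
    qed
    then show ?thesis using u_c0 order_trans by blast
  next
    case False
    then obtain i j where ij: "i \<in> {1..<m}" "x \<in> K i" "?v x = \<tau> i" "j \<in> {1..<m}" "y \<in> L j" "?w y = \<tau> j"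
      using level_step_cases[of m t0 K x] level_step_cases[of m t0 L y] m unfolding \<tau>_def by auto
    have "a * x + b * y \<in> S (i, j)" using ij unfolding S_def by (intro image_eqI[of _ _ "(x, y)"]) auto
    then have "a * ?v x + b * ?w y = val (i, j) (a * x + b * y)" using ij by (simp add: val_def I_def)
    also have "\<dots> \<le> u (a * x + b * y)" using ij by (intro u_ge) (simp add: J_def I_def)
    finally show ?thesis .
  qed
  define T where "T = \<bar>t0\<bar> + \<bar>top\<bar>"
  have T0: "T \<ge> 0" by (simp add: T_def)
  define N where "N = \<bar>c0\<bar> + (a + b + 1) * T"
  have rb: "\<bar>q\<bar> \<le> T" if "t0 \<le> q" "q \<le> top" for q using that unfolding T_def by linarith
  have N1: "T \<le> N"
    using ab mult_right_mono[of 1 "a + b + 1" T] T0 by (simp add: N_def)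
  have val_bd: "\<bar>val p z\<bar> \<le> N" for p z
  proof (cases "p \<in> I \<and> z \<in> S p")
    case True
    then have "\<bar>\<tau> (fst p)\<bar> \<le> T" "\<bar>\<tau> (snd p)\<bar> \<le> T"
      using \<tau> t0(1) by (auto simp: I_def intro!: rb intro: order_trans)
    then have "\<bar>a * \<tau> (fst p)\<bar> \<le> a * T" "\<bar>b * \<tau> (snd p)\<bar> \<le> b * T"
      using ab by (simp_all add: abs_mult mult_left_mono)
    then have "\<bar>a * \<tau> (fst p) + b * \<tau> (snd p)\<bar> \<le> N" using T0 unfolding N_def distrib_right by linarith
    then show ?thesis using True by (simp add: val_def)
  next
    case False
    then show ?thesis using ab T0 by (auto simp: val_def N_def)
  qed
  have main: "a * \<Psi> (\<integral>x. \<Phi> (?v x) \<partial>\<mu>) + b * \<Psi> (\<integral>x. \<Phi> (?w x) \<partial>\<mu>) \<le> \<Psi> (\<integral>x. \<Phi> (u x) \<partial>\<mu>)"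
  proof (rule ehrhard_usc[OF ab cond vm wm um, where N = N])
    show "\<bar>?v x\<bar> \<le> N" "\<bar>?w x\<bar> \<le> N" for x using rb[OF rng] N1 order_trans by blast+
    show "\<bar>u x\<bar> \<le> N" for x using u_in[of x] val_bd by metis
  qed (use usc le in auto)
  have \<alpha>': "\<alpha> \<le> (\<integral>x. \<Phi> (?v x) \<partial>\<mu>)"
  proof -
    have "(\<integral>x. f x \<partial>\<mu>) \<le> (\<integral>x. \<Phi> (?v x) \<partial>\<mu>) + 1 / real m + real m * e"
      by (rule level_step_integral[OF _ f _ K(1,3)]) (use m e in auto)
    then show ?thesis using m(2) e(2) gle by linarith
  qed
  have \<beta>': "\<beta> \<le> (\<integral>x. \<Phi> (?w x) \<partial>\<mu>)"
  proof -
    have "(\<integral>x. g x \<partial>\<mu>) \<le> (\<integral>x. \<Phi> (?w x) \<partial>\<mu>) + 1 / real m + real m * e"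
      by (rule level_step_integral[OF _ g _ L(1,3)]) (use m e in auto)
    then show ?thesis using m(2) e(2) gle by linarith
  qed
  have "\<Psi> \<alpha> \<le> \<Psi> (\<integral>x. \<Phi> (?v x) \<partial>\<mu>)" "\<Psi> \<beta> \<le> \<Psi> (\<integral>x. \<Phi> (?w x) \<partial>\<mu>)"
    by (intro Psi_mono \<alpha> \<beta> \<alpha>' \<beta>' integral_cdf_pos vm wm)+
  then have "a * \<Psi> \<alpha> + b * \<Psi> \<beta> \<le> \<Psi> (\<integral>x. \<Phi> (u x) \<partial>\<mu>)"
    using ab by (intro order_trans[OF add_mono main] mult_left_mono) auto
  then have fin: "\<Phi> (a * \<Psi> \<alpha> + b * \<Psi> \<beta>) \<le> (\<integral>x. \<Phi> (u x) \<partial>\<mu>)"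
    by (subst (asm) le_Psi_iff) (rule integral_cdf_pos um)+
  let ?F = "\<lambda>z. esssup lborel (\<lambda>y. ennreal (H_fun \<mu> a b (f ((z - y) / a)) (g (y / b))))"
  have below: "ennreal (max 0 (\<Phi> (u z) - \<omega>)) \<le> ?F z" for z
  proof -
    obtain p where p: "p \<in> J" "u z = val p z" using u_in by blast
    show ?thesis
    proof (cases "p \<in> I \<and> z \<in> S p")
      case True
      then obtain x y where xy: "x \<in> K (fst p)" "y \<in> L (snd p)" "z = a * x + b * y" by (auto simp: S_def)
      have p1: "fst p \<in> {1..<m}" "snd p \<in> {1..<m}" using True by (auto simp: I_def)
      have "ennreal (\<Phi> (a * \<tau> (fst p) + b * \<tau> (snd p))) \<le> ?F z"
        unfolding xy(3)
        by (rule esssup_ge_on_sumset[OF _ _ f g ab r])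
          (use xy K(2)[OF p1(1)] L(2)[OF p1(2)] lev[OF p1(1)] lev[OF p1(2)] in \<open>auto simp: \<tau>_def\<close>)
      moreover have "max 0 (\<Phi> (u z) - \<omega>) \<le> \<Phi> (a * \<tau> (fst p) + b * \<tau> (snd p))"
        using True p(2) \<omega> cdf_nonneg by (simp add: val_def)
      ultimately show ?thesis using ennreal_leI order_trans by blast
    next
      case False
      then have "u z = c0" using p(2) by (auto simp: val_def)
      then show ?thesis using \<omega> by (simp add: c0_def)
    qed
  qed
  have "\<Phi> (a * \<Psi> \<alpha> + b * \<Psi> \<beta>) - \<omega> \<le> (\<integral>x. \<Phi> (u x) - \<omega> \<partial>\<mu>)"
  proof -
    have "integrable \<mu> (\<lambda>x. \<Phi> (u x))"
      by (rule bounded_integrable[where K = 1]) (simp_all add: cdf_bounded_prob cdf_nonneg)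
    then show ?thesis using fin by (simp add: prob_space[simplified])
  qed
  also have "\<dots> \<le> (\<integral>x. max 0 (\<Phi> (u x) - \<omega>) \<partial>\<mu>)"
  proof (rule integral_mono)
    have b: "\<bar>\<Phi> (u x) - \<omega>\<bar> \<le> 1" for x using cdf_nonneg[of "u x"] cdf_bounded_prob[of "u x"] \<omega> by linarith
    show "integrable \<mu> (\<lambda>x. \<Phi> (u x) - \<omega>)" by (rule bounded_integrable[where K = 1]) (use b in auto)
    show "integrable \<mu> (\<lambda>x. max 0 (\<Phi> (u x) - \<omega>))"
      by (rule bounded_integrable[where K = 1]) (use b in \<open>auto simp: abs_le_iff max_def\<close>)
  qed simp
  finally have "ennreal (\<Phi> (a * \<Psi> \<alpha> + b * \<Psi> \<beta>) - \<omega>) \<le> ennreal (\<integral>x. max 0 (\<Phi> (u x) - \<omega>) \<partial>\<mu>)" by (rule ennreal_leI)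
  also have "\<dots> = (\<integral>\<^sup>+x. ennreal (max 0 (\<Phi> (u x) - \<omega>)) \<partial>\<mu>)"
  proof (rule nn_integral_eq_integral[symmetric])
    have b: "\<bar>max 0 (\<Phi> (u x) - \<omega>)\<bar> \<le> 1" for x using cdf_nonneg[of "u x"] cdf_bounded_prob[of "u x"] \<omega> by linarith
    show "integrable \<mu> (\<lambda>x. max 0 (\<Phi> (u x) - \<omega>))" by (rule bounded_integrable[where K = 1]) (use b in auto)
  qed simp
  also have "\<dots> \<le> (\<integral>\<^sup>+z. ?F z \<partial>\<mu>)" by (rule nn_integral_mono) (rule below)
  finally show ?thesis .
qed

text \<open>Every positive value below \<open>H\<close> at the two means is attained as \<open>\<Phi> (a \<Psi> \<alpha> + b \<Psi> \<beta>)\<close> with \<open>\<alpha>\<close> and \<open>\<beta>\<close> strictly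
  below the means; if one mean is \<open>1\<close>, then \<open>H\<close> is \<open>1\<close>, and that coordinate alone is
  tuned while the other one stays at half of its mean.\<close>

lemma ehrhard_real_line:
  assumes ab: "a > 0" "b > 0" and cond: "\<bar>1 - a\<^sup>2 - b\<^sup>2\<bar> \<le> 2 * a * b"
    and [measurable]: "f \<in> borel_measurable borel" "g \<in> borel_measurable borel"
    and f: "\<And>x. 0 \<le> f x \<and> f x \<le> 1" and g: "\<And>x. 0 \<le> g x \<and> g x \<le> 1"
  shows "ennreal (H_fun \<mu> a b (\<integral>x. f x \<partial>\<mu>) (\<integral>x. g x \<partial>\<mu>))
    \<le> (\<integral>\<^sup>+z. esssup lborel (\<lambda>y. ennreal (H_fun \<mu> a b (f ((z - y) / a)) (g (y / b)))) \<partial>\<mu>)"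
proof -
  define X where "X = (\<integral>x. f x \<partial>\<mu>)"
  define Y where "Y = (\<integral>x. g x \<partial>\<mu>)"
  let ?I = "\<integral>\<^sup>+z. esssup lborel (\<lambda>y. ennreal (H_fun \<mu> a b (f ((z - y) / a)) (g (y / b)))) \<partial>\<mu>"
  have unit: "0 \<le> (\<integral>x. q x \<partial>\<mu>) \<and> (\<integral>x. q x \<partial>\<mu>) \<le> 1"
    if "\<And>x. 0 \<le> q x \<and> q x \<le> 1" and [measurable]: "q \<in> borel_measurable borel" for q :: "real \<Rightarrow> real"
  proof -
    have "integrable \<mu> q" by (rule bounded_integrable[where K = 1]) (use that(1) in auto)
    then show ?thesis using integral_ge_const[of q 0] integral_le_const[of q 1] that(1) by auto
  qed
  have XY: "0 \<le> X" "X \<le> 1" "0 \<le> Y" "Y \<le> 1" unfolding X_def Y_def using unit[OF f] unit[OF g] by auto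
  have approx: "\<exists>\<alpha> \<beta>. 0 < \<alpha> \<and> \<alpha> < X \<and> 0 < \<beta> \<and> \<beta> < Y \<and> \<Phi> (a * \<Psi> \<alpha> + b * \<Psi> \<beta>) = c"
    if c: "0 < c" "c < H_fun \<mu> a b X Y" for c
  proof -
    have pos: "0 < X" "0 < Y" using c XY by (auto simp: H_eq[OF ab] split: if_splits)
    have c1: "c < 1" using c(2) H_range[OF ab, of X Y] by linarith
    define s where "s = \<Psi> c"
    have s: "\<Phi> s = c" using c c1 by (simp add: s_def)
    consider "X = 1" | "Y = 1" | "X < 1" "Y < 1" using XY by linarith
    then show ?thesis
    proof cases
      case 1
      have "Y / 2 < 1" "0 < Y / 2" "Y / 2 < Y" using pos XY by auto
      moreover have "a * ((s - b * \<Psi> (Y / 2)) / a) + b * \<Psi> (Y / 2) = s" using ab by simp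
      ultimately show ?thesis
        by (intro exI[of _ "\<Phi> ((s - b * \<Psi> (Y / 2)) / a)"] exI[of _ "Y / 2"]) (use s 1 cdf_pos cdf_less_1 in simp)
    next
      case 2
      have "X / 2 < 1" "0 < X / 2" "X / 2 < X" using pos XY by auto
      moreover have "a * \<Psi> (X / 2) + b * ((s - a * \<Psi> (X / 2)) / b) = s" using ab by simp
      ultimately show ?thesis
        by (intro exI[of _ "X / 2"] exI[of _ "\<Phi> ((s - a * \<Psi> (X / 2)) / b)"]) (use s 2 cdf_pos cdf_less_1 in simp)
    next
      case 3
      define p where "p = a * \<Psi> X + b * \<Psi> Y"
      define d where "d = (p - s) / (a + b)"
      have "\<Phi> s < \<Phi> p" using c(2) s by (simp add: H_inner[OF ab pos(1) 3(1) pos(2) 3(2)] p_def)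
      then have d: "d > 0" using ab by (simp add: d_def)
      have "(a + b) * d = p - s" using ab by (simp add: d_def)
      then have e: "a * (\<Psi> X - d) + b * (\<Psi> Y - d) = s" by (simp add: p_def algebra_simps)
      have "\<Phi> (\<Psi> X - d) < \<Phi> (\<Psi> X)" "\<Phi> (\<Psi> Y - d) < \<Phi> (\<Psi> Y)" using d by (simp_all only: cdf_less_iff)
      then show ?thesis
        by (intro exI[of _ "\<Phi> (\<Psi> X - d)"] exI[of _ "\<Phi> (\<Psi> Y - d)"]) (use s e cdf_pos pos 3 in simp)
    qed
  qed
  have "ennreal (H_fun \<mu> a b X Y) \<le> ?I"
  proof (rule ccontr)
    assume n: "\<not> ennreal (H_fun \<mu> a b X Y) \<le> ?I"
    then have "?I < ennreal (H_fun \<mu> a b X Y)" by simp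
    then obtain i where i: "?I = ennreal i" "0 \<le> i" by (cases ?I) auto
    then have iH: "i < H_fun \<mu> a b X Y" using n H_range[OF ab, of X Y] by (simp add: ennreal_le_iff not_le)
    define \<omega> where "\<omega> = (H_fun \<mu> a b X Y - i) / 3"
    have \<omega>: "0 < \<omega>" "\<omega> < 1" using iH i(2) H_range[OF ab, of X Y] by (auto simp: \<omega>_def)
    have c: "0 < i + 2 * \<omega>" "i + 2 * \<omega> < H_fun \<mu> a b X Y" using iH i(2) by (auto simp: \<omega>_def field_simps)
    obtain \<alpha> \<beta> where "0 < \<alpha>" "\<alpha> < X" "0 < \<beta>" "\<beta> < Y" "\<Phi> (a * \<Psi> \<alpha> + b * \<Psi> \<beta>) = i + 2 * \<omega>" using approx[OF c] by blast
    then have "ennreal (i + 2 * \<omega> - \<omega>) \<le> ?I"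
      using ehrhard_below_means[where f = f and g = g, OF ab cond _ _ f g, where \<alpha> = \<alpha> and \<beta> = \<beta> and \<omega> = \<omega>] \<omega> by (simp add: X_def Y_def)
    then show False using i \<omega> by (simp add: ennreal_le_iff)
  qed
  then show ?thesis by (simp add: X_def Y_def)
qed

end

section \<open>From the real line to product spaces\<close>

text \<open>The essential supremum exceeds \<open>c\<close> exactly where the section of the superlevel set \<open>{k > c}\<close> has
  positive measure.\<close>

lemma esssup_measurable_parameter:
  fixes k :: "'a \<Rightarrow> 'b \<Rightarrow> ennreal"
  assumes N: "sigma_finite_measure N" and k[measurable]: "case_prod k \<in> borel_measurable (M \<Otimes>\<^sub>M N)"
  shows "(\<lambda>x. esssup N (k x)) \<in> borel_measurable M"
proof (rule borel_measurableI_greater)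
  fix c :: ennreal
  interpret sigma_finite_measure N by fact
  define Q where "Q = {p \<in> space (M \<Otimes>\<^sub>M N). c < case_prod k p}"
  have Q: "Q \<in> sets (M \<Otimes>\<^sub>M N)" unfolding Q_def by measurable
  have "c < esssup N (k x) \<longleftrightarrow> 0 < emeasure N (Pair x -` Q)" if x: "x \<in> space M" for x
  proof -
    have kx: "k x \<in> borel_measurable N" using measurable_Pair2[OF k x] by simp
    have eq: "Pair x -` Q = {y \<in> space N. c < k x y}" using x by (auto simp: Q_def space_pair_measure)
    show ?thesis
    proof
      assume "c < esssup N (k x)"
      then show "0 < emeasure N (Pair x -` Q)" unfolding eq by (rule esssup_pos_measure[OF kx])
    next
      assume p: "0 < emeasure N (Pair x -` Q)"
      show "c < esssup N (k x)"
      proof (rule ccontr)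
        assume "\<not> c < esssup N (k x)"
        then have "emeasure N {y \<in> space N. c < k x y} \<le> emeasure N {y \<in> space N. esssup N (k x) < k x y}"
          using kx by (intro emeasure_mono) auto
        then show False using p esssup_zero_measure[of N "k x"] by (simp add: eq)
      qed
    qed
  qed
  then have "{x \<in> space M. c < esssup N (k x)} = {x \<in> space M. 0 < emeasure N (Pair x -` Q)}" by blast
  also have "\<dots> \<in> sets M" using measurable_emeasure_Pair[OF Q] by measurable
  finally show "{x \<in> space M. c < esssup N (k x)} \<in> sets M" .
qed

abbreviation coord_space :: "nat \<Rightarrow> (nat \<Rightarrow> real) measure" where
  "coord_space n \<equiv> Pi\<^sub>M {..<n} (\<lambda>_. borel)"

lemma sets_prod_measure: "sets M = sets borel \<Longrightarrow> sets (prod_measure n M) = sets (coord_space n)"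
  unfolding prod_measure_def by (intro sets_PiM_cong) auto

lemma space_prod_measure: "sets M = sets borel \<Longrightarrow> space (prod_measure n M) = ({..<n} \<rightarrow>\<^sub>E UNIV)"
  using sets_eq_imp_space_eq[of M borel] by (simp add: prod_measure_def space_PiM)

lemma fun_upd_measurable_PiM:
  assumes "f \<in> measurable N (coord_space n)" "h \<in> borel_measurable N"
  shows "(\<lambda>x. (f x)(n := h x)) \<in> measurable N (coord_space (Suc n))"
  by (rule measurable_fun_upd[where J = "{..<n}"]) (use assms in auto)

lemma combine_measurable_PiM:
  assumes "f \<in> measurable N (coord_space n)" "g \<in> measurable N (coord_space n)"
  shows "(\<lambda>p. \<lambda>i\<in>{..<n}. (f p i - g p i) / a) \<in> measurable N (coord_space n)"
    "(\<lambda>p. \<lambda>i\<in>{..<n}. f p i / a) \<in> measurable N (coord_space n)"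
proof -
  have [measurable]: "(\<lambda>p. f p i) \<in> borel_measurable N" "(\<lambda>p. g p i) \<in> borel_measurable N" if "i < n" for i
    using measurable_compose[OF assms(1) measurable_component_singleton[of i]]
      measurable_compose[OF assms(2) measurable_component_singleton[of i]] that by auto
  show "(\<lambda>p. \<lambda>i\<in>{..<n}. (f p i - g p i) / a) \<in> measurable N (coord_space n)"
    "(\<lambda>p. \<lambda>i\<in>{..<n}. f p i / a) \<in> measurable N (coord_space n)"
    by (intro measurable_restrict; simp)+
qed

lemma AE_prod_measure_Suc:
  fixes M :: "real measure"
  assumes M: "sigma_finite_measure M" "sets M = sets borel"
    and P[measurable]: "Measurable.pred (coord_space (Suc n)) P"
    and AE: "AE x in prod_measure (Suc n) M. P x"
  shows "AE x in prod_measure n M. AE t in M. P (x(n := t))"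
proof -
  interpret product_sigma_finite "\<lambda>_::nat. M" using M(1) by (simp add: product_sigma_finite_def)
  interpret sigma_finite_measure M by fact
  note [measurable_cong] = M(2) sets_prod_measure[OF M(2), of n] sets_prod_measure[OF M(2), of "Suc n"]
  have Suc: "{..<Suc n} = insert n {..<n}" by auto
  define b where "b x = (if P x then 0 else 1 :: ennreal)" for x
  have b[measurable]: "b \<in> borel_measurable (coord_space (Suc n))" unfolding b_def[abs_def] by measurable
  have upd[measurable]: "(\<lambda>p. (fst p)(n := snd p)) \<in> measurable (prod_measure n M \<Otimes>\<^sub>M M) (coord_space (Suc n))"
    by (rule fun_upd_measurable_PiM) measurable
  have bp[measurable]: "(\<lambda>(x, t). b (x(n := t))) \<in> borel_measurable (prod_measure n M \<Otimes>\<^sub>M M)"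
    using measurable_compose[OF upd b] by (simp add: case_prod_beta)
  have "(\<integral>\<^sup>+x. b x \<partial>prod_measure (Suc n) M) = 0"
    using AE by (subst nn_integral_0_iff_AE) (measurable, auto simp: b_def)
  moreover have "(\<integral>\<^sup>+x. b x \<partial>prod_measure (Suc n) M) = (\<integral>\<^sup>+x. (\<integral>\<^sup>+t. b (x(n := t)) \<partial>M) \<partial>prod_measure n M)"
  proof -
    have "sets (Pi\<^sub>M (insert n {..<n}) (\<lambda>_. M)) = sets (coord_space (Suc n))"
      using sets_prod_measure[OF M(2), of "Suc n"] unfolding prod_measure_def Suc .
    then have "b \<in> borel_measurable (Pi\<^sub>M (insert n {..<n}) (\<lambda>_. M))"
      using b measurable_cong_sets[OF _ refl] by blast
    then show ?thesis
      unfolding prod_measure_def Suc by (intro product_nn_integral_insert) auto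
  qed
  ultimately have "(\<integral>\<^sup>+x. (\<integral>\<^sup>+t. b (x(n := t)) \<partial>M) \<partial>prod_measure n M) = 0" by simp
  then have "AE x in prod_measure n M. (\<integral>\<^sup>+t. b (x(n := t)) \<partial>M) = 0"
    by (rule nn_integral_0_iff_AE[OF borel_measurable_nn_integral[OF bp], THEN iffD1])
  then show ?thesis
  proof (rule AE_mp[OF _ AE_I2[OF impI]])
    fix x assume x: "x \<in> space (prod_measure n M)" and z: "(\<integral>\<^sup>+t. b (x(n := t)) \<partial>M) = 0"
    have "(\<lambda>t. b (x(n := t))) \<in> borel_measurable M" using measurable_Pair2[OF bp x] by simp
    then have "AE t in M. b (x(n := t)) = 0" using z by (subst (asm) nn_integral_0_iff_AE)
    then show "AE t in M. P (x(n := t))" by eventually_elim (simp add: b_def split: if_splits)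
  qed
qed

lemma restrict_Suc_combine:
  "(\<lambda>i\<in>{..<Suc n}. ((x(n := s)) i - (y(n := t)) i) / a) = (\<lambda>i\<in>{..<n}. (x i - y i) / a)(n := (s - t) / (a::real))"
  "(\<lambda>i\<in>{..<Suc n}. (y(n := t)) i / b) = (\<lambda>i\<in>{..<n}. y i / b)(n := t / (b::real))"
  by (auto simp: fun_eq_iff)

context exp_prob
begin

lemma sets_prod_mu: "sets (prod_measure n \<mu>) = sets (coord_space n)"
  by (rule sets_prod_measure) simp

lemma unit_fun_section:
  assumes f: "f \<in> borel_unit_funs (Suc n)"
  shows "(\<lambda>x. \<integral>t. f (x(n := t)) \<partial>\<mu>) \<in> borel_unit_funs n"
    "x \<in> {..<n} \<rightarrow>\<^sub>E UNIV \<Longrightarrow> (\<lambda>t. f (x(n := t))) \<in> borel_measurable borel"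
    "x \<in> {..<n} \<rightarrow>\<^sub>E UNIV \<Longrightarrow> 0 \<le> f (x(n := t)) \<and> f (x(n := t)) \<le> 1"
    "(\<integral>x. f x \<partial>prod_measure (Suc n) \<mu>) = (\<integral>x. (\<integral>t. f (x(n := t)) \<partial>\<mu>) \<partial>prod_measure n \<mu>)"
proof -
  have fm[measurable]: "f \<in> borel_measurable (coord_space (Suc n))"
    and fr: "\<And>x. x \<in> {..<Suc n} \<rightarrow>\<^sub>E UNIV \<Longrightarrow> 0 \<le> f x \<and> f x \<le> 1"
    using f by (auto simp: borel_unit_funs_def)
  have upd[measurable]: "(\<lambda>p. (fst p)(n := snd p))
      \<in> measurable (coord_space n \<Otimes>\<^sub>M borel) (coord_space (Suc n))"
    by (rule fun_upd_measurable_PiM) measurable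
  have fp: "(\<lambda>(x, t). f (x(n := t))) \<in> borel_measurable (coord_space n \<Otimes>\<^sub>M borel)"
    using measurable_compose[OF upd fm] by (simp add: case_prod_beta)
  show sec: "(\<lambda>t. f (x(n := t))) \<in> borel_measurable borel" if "x \<in> {..<n} \<rightarrow>\<^sub>E UNIV" for x
    using measurable_Pair2[OF fp, of x] that by (simp add: space_PiM)
  show r: "0 \<le> f (x(n := t)) \<and> f (x(n := t)) \<le> 1" if "x \<in> {..<n} \<rightarrow>\<^sub>E UNIV" for x t
  proof (rule fr)
    show "x(n := t) \<in> {..<Suc n} \<rightarrow>\<^sub>E UNIV" using that by (auto simp: PiE_iff extensional_def)
  qed
  have i: "integrable \<mu> (\<lambda>t. f (x(n := t)))" if "x \<in> {..<n} \<rightarrow>\<^sub>E UNIV" for x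
    by (rule bounded_integrable[where K = 1]) (use sec r that in \<open>auto simp: abs_le_iff intro: order_trans[of _ 0]\<close>)
  have "(\<lambda>x. \<integral>t. f (x(n := t)) \<partial>\<mu>) \<in> borel_measurable (coord_space n)"
    by (rule borel_measurable_lebesgue_integral) (use fp in measurable)
  moreover have "0 \<le> (\<integral>t. f (x(n := t)) \<partial>\<mu>) \<and> (\<integral>t. f (x(n := t)) \<partial>\<mu>) \<le> 1" if "x \<in> {..<n} \<rightarrow>\<^sub>E UNIV" for x
    using integral_ge_const[OF i[OF that], of 0] integral_le_const[OF i[OF that], of 1] r[OF that] by auto
  ultimately show "(\<lambda>x. \<integral>t. f (x(n := t)) \<partial>\<mu>) \<in> borel_unit_funs n"
    unfolding borel_unit_funs_def by blast
  interpret P: product_sigma_finite "\<lambda>_::nat. \<mu>" by standard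
  have Suc: "{..<Suc n} = insert n {..<n}" by auto
  have "integrable (prod_measure (Suc n) \<mu>) f"
  proof -
    have "prob_space (prod_measure (Suc n) \<mu>)" unfolding prod_measure_def by (rule prob_space_PiM) (rule prob)
    then interpret Q: prob_space "prod_measure (Suc n) \<mu>" .
    show ?thesis
    proof (rule Q.integrable_const_bound[where B = 1])
      show "AE x in prod_measure (Suc n) \<mu>. norm (f x) \<le> 1"
        using fr by (intro AE_I2) (auto simp: space_prod_measure)
      show "f \<in> borel_measurable (prod_measure (Suc n) \<mu>)"
        using fm by (simp add: measurable_cong_sets[OF sets_prod_mu])
    qed
  qed
  then show "(\<integral>x. f x \<partial>prod_measure (Suc n) \<mu>) = (\<integral>x. (\<integral>t. f (x(n := t)) \<partial>\<mu>) \<partial>prod_measure n \<mu>)"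
    unfolding prod_measure_def Suc by (intro P.product_integral_insert) auto
qed

text \<open>The inequality is inherited by products: apply it in dimension \<open>n\<close> to the means over the last
  coordinate and bound the integrand by the inequality on the line. What remains is that an iterated
  essential supremum is at most the joint one, and that the essential supremum of an integral is at
  most the integral of the essential supremum.\<close>

lemma ehrhard_ineq_Suc:
  assumes ab: "a > 0" "b > 0"
    and line: "\<And>f g. f \<in> borel_measurable borel \<Longrightarrow> g \<in> borel_measurable borel \<Longrightarrow>
       (\<And>x. 0 \<le> f x \<and> f x \<le> 1) \<Longrightarrow> (\<And>x. 0 \<le> g x \<and> g x \<le> 1) \<Longrightarrow>
       ennreal (H_fun \<mu> a b (\<integral>x. f x \<partial>\<mu>) (\<integral>x. g x \<partial>\<mu>))
         \<le> (\<integral>\<^sup>+z. esssup lborel (\<lambda>y. ennreal (H_fun \<mu> a b (f ((z - y) / a)) (g (y / b)))) \<partial>\<mu>)"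
    and IH: "\<And>f g. f \<in> borel_unit_funs n \<Longrightarrow> g \<in> borel_unit_funs n \<Longrightarrow> ehrhard_ineq \<mu> a b n f g"
    and f: "f \<in> borel_unit_funs (Suc n)" and g: "g \<in> borel_unit_funs (Suc n)"
  shows "ehrhard_ineq \<mu> a b (Suc n) f g"
proof -
  have fm[measurable]: "f \<in> borel_measurable (coord_space (Suc n))" and gm[measurable]: "g \<in> borel_measurable (coord_space (Suc n))"
    using f g unfolding borel_unit_funs_def by blast+
  let ?G = "\<lambda>n. prod_measure n \<mu>" and ?L = "\<lambda>n. prod_measure n (lborel :: real measure)"
  note G_sets[measurable_cong] = sets_prod_mu[of n] sets_prod_mu[of "Suc n"]
  have L_sets[measurable_cong]: "sets (?L n) = sets (coord_space n)" for n by (rule sets_prod_measure) simp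
  interpret PG: product_sigma_finite "\<lambda>_::nat. \<mu>" by standard
  interpret PL: product_sigma_finite "\<lambda>_::nat. lborel :: real measure" by standard
  have L_sigma: "sigma_finite_measure (?L n)" for n unfolding prod_measure_def by (rule PL.sigma_finite) simp
  interpret LG: pair_sigma_finite "?L n" \<mu> using L_sigma by (rule pair_sigma_finite.intro) unfold_locales
  define k where "k x y = ennreal (H_fun \<mu> a b (f (\<lambda>i\<in>{..<Suc n}. (x i - y i) / a)) (g (\<lambda>i\<in>{..<Suc n}. y i / b)))"
    for x y :: "nat \<Rightarrow> real"
  have k_meas: "(\<lambda>p. k (F p) (Gf p)) \<in> borel_measurable N"
    if "F \<in> measurable N (coord_space (Suc n))" "Gf \<in> measurable N (coord_space (Suc n))" for F Gf N
    unfolding k_def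
    by (intro measurable_compose[OF _ measurable_ennreal] H_measurable ab
        measurable_compose[OF combine_measurable_PiM(1)[OF that] fm]
        measurable_compose[OF combine_measurable_PiM(2)[OF that(2) that(1)] gm])
  define R where "R x = esssup (?L (Suc n)) (k x)" for x
  define Q where "Q X Y \<xi> = esssup lborel (\<lambda>\<eta>. k (X(n := \<xi>)) (Y(n := \<eta>)))" for X Y \<xi>
  have R[measurable]: "R \<in> borel_measurable (coord_space (Suc n))"
    unfolding R_def[abs_def]
  proof (rule esssup_measurable_parameter)
    show "sigma_finite_measure (?L (Suc n))" by (rule L_sigma)
    show "case_prod k \<in> borel_measurable (coord_space (Suc n) \<Otimes>\<^sub>M ?L (Suc n))"
      unfolding case_prod_beta by (rule k_meas) measurable
  qed
  have inner: "esssup (?L n) (\<lambda>Y. ennreal (H_fun \<mu> a b (\<integral>t. f ((\<lambda>i\<in>{..<n}. (X i - Y i) / a)(n := t)) \<partial>\<mu>)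
        (\<integral>t. g ((\<lambda>i\<in>{..<n}. Y i / b)(n := t)) \<partial>\<mu>)))
      \<le> (\<integral>\<^sup>+\<xi>. R (X(n := \<xi>)) \<partial>\<mu>)" (is "esssup _ ?h \<le> _") if X: "X \<in> space (?G n)" for X
  proof (rule esssup_I)
    have Xs: "X \<in> space (coord_space n)" using X sets_eq_imp_space_eq[OF sets_prod_mu] by simp
    have Xc[measurable]: "(\<lambda>_. X) \<in> measurable N (coord_space n)" for N by (rule measurable_const) (rule Xs)
    have idL: "(\<lambda>Y. Y) \<in> measurable (?L n) (coord_space n)" by measurable
    show "?h \<in> borel_measurable (?L n)"
    proof -
      have F: "(\<lambda>x. \<integral>t. f (x(n := t)) \<partial>\<mu>) \<in> borel_measurable (coord_space n)" "(\<lambda>x. \<integral>t. g (x(n := t)) \<partial>\<mu>) \<in> borel_measurable (coord_space n)"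
        using unit_fun_section(1)[OF f] unit_fun_section(1)[OF g] by (auto simp: borel_unit_funs_def)
      show ?thesis
        by (intro measurable_compose[OF _ measurable_ennreal] H_measurable ab
          measurable_compose[OF combine_measurable_PiM(1)[OF Xc idL] F(1)]
          measurable_compose[OF combine_measurable_PiM(2)[OF idL idL] F(2)])
    qed
    \<comment> \<open>the inequality on the line, applied to the sections in the last coordinate\<close>
    have h_le: "?h Y \<le> (\<integral>\<^sup>+\<xi>. Q X Y \<xi> \<partial>\<mu>)" for Y
    proof -
      let ?x = "\<lambda>i\<in>{..<n}. (X i - Y i) / a" and ?y = "\<lambda>i\<in>{..<n}. Y i / b"
      have xy: "?x \<in> {..<n} \<rightarrow>\<^sub>E UNIV" "?y \<in> {..<n} \<rightarrow>\<^sub>E UNIV" by auto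
      have "?h Y \<le> (\<integral>\<^sup>+z. esssup lborel (\<lambda>y. ennreal (H_fun \<mu> a b (f (?x(n := (z - y) / a))) (g (?y(n := y / b))))) \<partial>\<mu>)"
        by (rule line) (use unit_fun_section(2,3)[OF f xy(1)] unit_fun_section(2,3)[OF g xy(2)] in auto)
      also have "\<dots> = (\<integral>\<^sup>+\<xi>. Q X Y \<xi> \<partial>\<mu>)"
        unfolding Q_def k_def restrict_Suc_combine ..
      finally show ?thesis .
    qed
    have updX[measurable]: "(\<lambda>\<xi>. X(n := \<xi>)) \<in> measurable borel (coord_space (Suc n))"
      by (rule fun_upd_measurable_PiM) (rule Xc, measurable)
    have Q_meas: "(\<lambda>p. Q X (fst p) (snd p)) \<in> borel_measurable (?L n \<Otimes>\<^sub>M \<mu>)"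
      unfolding Q_def
    proof (rule esssup_measurable_parameter)
      show "sigma_finite_measure (lborel :: real measure)" ..
      have m1: "(\<lambda>q::((nat \<Rightarrow> real) \<times> real) \<times> real. X(n := snd (fst q))) \<in> measurable ((?L n \<Otimes>\<^sub>M \<mu>) \<Otimes>\<^sub>M lborel) (coord_space (Suc n))"
        by (rule fun_upd_measurable_PiM) (rule Xc, measurable)
      have m2: "(\<lambda>q::((nat \<Rightarrow> real) \<times> real) \<times> real. (fst (fst q))(n := snd q)) \<in> measurable ((?L n \<Otimes>\<^sub>M \<mu>) \<Otimes>\<^sub>M lborel) (coord_space (Suc n))"
        by (rule fun_upd_measurable_PiM) measurable
      show "(\<lambda>(p, \<eta>). k (X(n := snd p)) ((fst p)(n := \<eta>))) \<in> borel_measurable ((?L n \<Otimes>\<^sub>M \<mu>) \<Otimes>\<^sub>M lborel)"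
        using k_meas[OF m1 m2] by (simp add: case_prod_beta)
    qed
    \<comment> \<open>an iterated essential supremum is at most the joint one\<close>
    have "AE Y in ?L n. Q X Y \<xi> \<le> R (X(n := \<xi>))" for \<xi>
    proof -
      have x1: "X(n := \<xi>) \<in> space (coord_space (Suc n))" using measurable_space[OF updX, of \<xi>] by simp
      have kk: "k (X(n := \<xi>)) \<in> borel_measurable (coord_space (Suc n))"
        by (rule k_meas) (rule measurable_const[OF x1], measurable)
      have "AE Y in ?L n. AE \<eta> in lborel. k (X(n := \<xi>)) (Y(n := \<eta>)) \<le> R (X(n := \<xi>))"
      proof (rule AE_prod_measure_Suc)
        show "AE y in ?L (Suc n). k (X(n := \<xi>)) y \<le> R (X(n := \<xi>))" unfolding R_def by (rule esssup_AE)
        show "Measurable.pred (coord_space (Suc n)) (\<lambda>y. k (X(n := \<xi>)) y \<le> R (X(n := \<xi>)))" using kk by measurable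
      qed (auto intro: lborel.sigma_finite_measure_axioms)
      then show ?thesis
      proof (rule AE_mp, intro AE_I2 impI)
        fix Y assume Y: "Y \<in> space (?L n)" and ae: "AE \<eta> in lborel. k (X(n := \<xi>)) (Y(n := \<eta>)) \<le> R (X(n := \<xi>))"
        have Ys: "Y \<in> space (coord_space n)" using Y sets_eq_imp_space_eq[OF L_sets] by simp
        have "(\<lambda>\<eta>. Y(n := \<eta>)) \<in> measurable lborel (coord_space (Suc n))"
          by (rule fun_upd_measurable_PiM) (rule measurable_const[OF Ys], measurable)
        then have "(\<lambda>\<eta>. k (X(n := \<xi>)) (Y(n := \<eta>))) \<in> borel_measurable lborel" by (rule measurable_compose[OF _ kk])
        then show "Q X Y \<xi> \<le> R (X(n := \<xi>))" unfolding Q_def using ae by (rule esssup_I)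
      qed
    qed
    then have "AE \<xi> in \<mu>. AE Y in ?L n. Q X Y \<xi> \<le> R (X(n := \<xi>))" by simp
    then have "AE Y in ?L n. AE \<xi> in \<mu>. Q X Y \<xi> \<le> R (X(n := \<xi>))"
    proof (subst LG.AE_commute)
      have "(\<lambda>p. R (X(n := snd p))) \<in> borel_measurable (?L n \<Otimes>\<^sub>M \<mu>)" by measurable
      with Q_meas show "{p \<in> space (?L n \<Otimes>\<^sub>M \<mu>). Q X (fst p) (snd p) \<le> R (X(n := snd p))} \<in> sets (?L n \<Otimes>\<^sub>M \<mu>)"
        by measurable
    qed
    then show "AE Y in ?L n. ?h Y \<le> (\<integral>\<^sup>+\<xi>. R (X(n := \<xi>)) \<partial>\<mu>)"
    proof (rule AE_mp, intro AE_I2 impI)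
      fix Y assume "AE \<xi> in \<mu>. Q X Y \<xi> \<le> R (X(n := \<xi>))"
      then have "(\<integral>\<^sup>+\<xi>. Q X Y \<xi> \<partial>\<mu>) \<le> (\<integral>\<^sup>+\<xi>. R (X(n := \<xi>)) \<partial>\<mu>)" by (rule nn_integral_mono_AE)
      then show "?h Y \<le> (\<integral>\<^sup>+\<xi>. R (X(n := \<xi>)) \<partial>\<mu>)" by (rule order_trans[OF h_le])
    qed
  qed
  have "ennreal (H_fun \<mu> a b (\<integral>x. f x \<partial>?G (Suc n)) (\<integral>x. g x \<partial>?G (Suc n)))
     = ennreal (H_fun \<mu> a b (\<integral>x. (\<integral>t. f (x(n := t)) \<partial>\<mu>) \<partial>?G n) (\<integral>x. (\<integral>t. g (x(n := t)) \<partial>\<mu>) \<partial>?G n))"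
    unfolding unit_fun_section(4)[OF f] unit_fun_section(4)[OF g] ..
  also have "\<dots> \<le> (\<integral>\<^sup>+X. esssup (?L n) (\<lambda>Y. ennreal (H_fun \<mu> a b (\<integral>t. f ((\<lambda>i\<in>{..<n}. (X i - Y i) / a)(n := t)) \<partial>\<mu>)
        (\<integral>t. g ((\<lambda>i\<in>{..<n}. Y i / b)(n := t)) \<partial>\<mu>))) \<partial>?G n)"
    using IH[OF unit_fun_section(1)[OF f] unit_fun_section(1)[OF g]] unfolding ehrhard_ineq_def .
  also have "\<dots> \<le> (\<integral>\<^sup>+X. (\<integral>\<^sup>+\<xi>. R (X(n := \<xi>)) \<partial>\<mu>) \<partial>?G n)" by (rule nn_integral_mono) (rule inner)
  also have "\<dots> = (\<integral>\<^sup>+x. R x \<partial>?G (Suc n))"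
  proof -
    have Suc: "{..<Suc n} = insert n {..<n}" by auto
    have "R \<in> borel_measurable (?G (Suc n))" using R by (simp add: measurable_cong_sets[OF sets_prod_mu])
    then have "R \<in> borel_measurable (Pi\<^sub>M (insert n {..<n}) (\<lambda>_. \<mu>))" by (simp only: prod_measure_def Suc)
    then show ?thesis unfolding prod_measure_def Suc by (intro PG.product_nn_integral_insert[symmetric]) auto
  qed
  finally show ?thesis unfolding ehrhard_ineq_def R_def k_def[abs_def] .
qed

lemma ehrhard_ineq_0: "ehrhard_ineq \<mu> a b 0 f g"
  unfolding ehrhard_ineq_def
  by (simp add: prod_measure_def PiM_empty lebesgue_integral_count_space_finite nn_integral_count_space_finite
      esssup_const restrict_def)

lemma ehrhard_ineq_all:
  assumes ab: "a > 0" "b > 0"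
    and line: "\<And>f g. f \<in> borel_measurable borel \<Longrightarrow> g \<in> borel_measurable borel \<Longrightarrow>
       (\<And>x. 0 \<le> f x \<and> f x \<le> 1) \<Longrightarrow> (\<And>x. 0 \<le> g x \<and> g x \<le> 1) \<Longrightarrow>
       ennreal (H_fun \<mu> a b (\<integral>x. f x \<partial>\<mu>) (\<integral>x. g x \<partial>\<mu>))
         \<le> (\<integral>\<^sup>+z. esssup lborel (\<lambda>y. ennreal (H_fun \<mu> a b (f ((z - y) / a)) (g (y / b)))) \<partial>\<mu>)"
    and "f \<in> borel_unit_funs n" "g \<in> borel_unit_funs n"
  shows "ehrhard_ineq \<mu> a b n f g"
  using assms(4,5)
proof (induction n arbitrary: f g)
  case 0
  show ?case by (rule ehrhard_ineq_0)
next
  case (Suc n)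
  show ?case by (rule ehrhard_ineq_Suc[OF ab line Suc.IH Suc.prems])
qed

end

section \<open>Necessity and sufficiency\<close>

lemma gaussian_potential: "gaussian (\<lambda>x. x\<^sup>2 / 2 + ln (sqrt (2 * pi)))"
  "exp_measure (\<lambda>x. x\<^sup>2 / 2 + ln (sqrt (2 * pi))) = std_gaussian"
proof -
  let ?V = "\<lambda>x::real. x\<^sup>2 / 2 + ln (sqrt (2 * pi))"
  show eq: "exp_measure ?V = std_gaussian"
    unfolding exp_measure_def std_gaussian_def exp_gaussian_potential ..
  have d: "(?V has_real_derivative x) (at x)" for x by (auto intro!: derivative_eq_intros)
  then have d1: "deriv ?V = (\<lambda>x. x)" by (auto simp: fun_eq_iff intro: DERIV_imp_deriv)
  have d2: "deriv (\<lambda>x::real. x) = (\<lambda>x. 1)" by (auto simp: fun_eq_iff)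
  have "C2_on_reals ?V"
    unfolding C2_on_reals_def d1 d2
    using d by (auto simp: differentiable_on_def real_differentiable_def intro: differentiable_at_withinI)
  moreover have "prob_space (exp_measure ?V)"
    unfolding eq std_gaussian_def by (rule prob_space_normal_density) simp
  ultimately have "exp_prob ?V" by (rule exp_prob.intro[rotated])
  then show "gaussian ?V" by (rule gaussian.intro) (rule gaussian_axioms.intro, rule refl)
qed

theorem theorem2:
  fixes V :: "real \<Rightarrow> real" and a b :: real
  assumes "prob_space (exp_measure V)"
    and "C2_on_reals V"
    and "integrable (exp_measure V) (\<lambda>x. \<bar>x\<bar> ^ 5)"
    and "a > 0" and "b > 0"
  shows "((\<forall>f\<in>borel_unit_funs 1. \<forall>g\<in>borel_unit_funs 1. ehrhard_ineq (exp_measure V) a b 1 f g)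
            \<longrightarrow> cond_C V a b) \<and>
         (exp_measure V = std_gaussian \<longrightarrow>
            (cond_C V a b \<longleftrightarrow>
               (\<forall>n\<ge>1. \<forall>f\<in>borel_unit_funs n. \<forall>g\<in>borel_unit_funs n.
                  ehrhard_ineq (exp_measure V) a b n f g)))"
proof -
  interpret exp_prob V using assms(1,2) by (rule exp_prob.intro)
  have necessary: "cond_C V a b"
    if "\<forall>f\<in>borel_unit_funs 1. \<forall>g\<in>borel_unit_funs 1. ehrhard_ineq (exp_measure V) a b 1 f g"
    by (rule ehrhard_necessary[OF that assms(4,5,3)])
  have sufficient: "ehrhard_ineq (exp_measure V) a b n f g"
    if eq: "exp_measure V = std_gaussian" and C: "cond_C V a b"
      and fg: "f \<in> borel_unit_funs n" "g \<in> borel_unit_funs n" for n f g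
  proof -
    interpret G: gaussian "\<lambda>x. x\<^sup>2 / 2 + ln (sqrt (2 * pi))" by (rule gaussian_potential)
    have cond: "\<bar>1 - a\<^sup>2 - b\<^sup>2\<bar> \<le> 2 * a * b" using C by (simp add: cond_C_def)
    have "ehrhard_ineq std_gaussian a b n f g"
      using G.ehrhard_ineq_all[OF assms(4,5) G.ehrhard_real_line[OF assms(4,5) cond] fg]
      unfolding gaussian_potential(2) .
    then show ?thesis unfolding eq .
  qed
  show ?thesis using necessary sufficient by blast
qed

end
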